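(* Let $n\ge2$ and $\alpha\in\mathbb{N}_0$, and consider the projections $P_k$ ($k\in\mathbb{N}_0$) associated with the Grushin operator $\Delta_\alpha$ on $\mathbb{R}^{n+1}$. For $\beta\in[0,1)\setminus\{1/2\}$ there exists a constant $C>0$ depending only on $n,\alpha$ and $\beta$ such that, for every $k\in\mathbb{N}_0$ and every $g\in L^2(\Omega,d\Omega)$, $$\int_\Omega\left|(\sin\phi)^{-\beta}P_k\left(\sin^{-\beta}(\cdot)g\right)(\phi,\omega)\right|^2d\Omega\le\begin{cases}C\int_\Omega|g|^2\,d\Omega,&0\le\beta<\frac12,\\[2pt] C(k+1)^{2(2\beta-1)}\int_\Omega|g|^2\,d\Omega,&\frac12<\beta<1.\end{cases}$$ In particular, when $\alpha\in\mathbb{N}\setminus\{1\}$ and $\frac{\alpha+1}{4\alpha}\le\beta<\frac12$, there exists a constant $C>0$, depending on $\alpha,\beta$ and $n$, such that for every $k\in\mathbb{N}_0$ and every $g\in L^2(\Omega,d\Omega)$, $$\int_\Omega\left|\psi^{-\beta}(\phi)P_k\left(\psi^{-\beta}(\cdot)g\right)(\phi,\omega)\right|^2d\Omega\le C(k+1)^{\frac{2(\alpha-1)}{\alpha+1}}\int_\Omega|g|^2\,d\Omega.$$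
   Context: $\mathbb{N}=\{1,2,\dots\}$, $\mathbb{N}_0=\{0,1,2,\dots\}$. $\Delta_\alpha=\Delta_x+|x|^{2\alpha}\partial_y^2$ on $\mathbb{R}^{n+1}=\{(x,y):x\in\mathbb{R}^n,y\in\mathbb{R}\}$. Polar coordinates $(\rho,\phi,\omega)$: $\rho=\left(|x|^{2(\alpha+1)}+(\alpha+1)^2y^2\right)^{\frac{1}{2(\alpha+1)}}$, $\phi\in(0,\pi)$ with $|x|=\rho\sin^{\frac{1}{\alpha+1}}\phi$, $y=\frac{1}{\alpha+1}\rho^{\alpha+1}\cos\phi$, $\omega=x/|x|\in\mathbb{S}^{n-1}$. $\psi(\phi)=\sin^{\frac{2\alpha}{\alpha+1}}\phi$. $\Omega=\{\rho=1\}$ is equipped with $d\Omega=\sin^{\frac{n-2}{\alpha+1}+1}\phi\,d\phi\,d\omega$, $d\omega$ the surface measure on $\mathbb{S}^{n-1}$. Let $\{Y_{\ell,p}\}_{1\le p\le d_\ell(n)}$ be an orthonormal basis of the spherical harmonics of degree $\ell$ on $\mathbb{S}^{n-1}$ and $C_N^{(\lambda)}$ the Gegenbauer polynomials. $\mathcal{H}_k^\alpha$ (restricted to $\Omega$) is the span of the mutually orthogonal functions $$\sin^{\frac{\ell}{\alpha+1}}\phi\;C_{\frac{k-\ell}{\alpha+1}}^{\left(\frac{2\ell+n-2}{2(\alpha+1)}+\frac12\right)}(\cos\phi)\,Y_{\ell,p}(\omega),\qquad 0\le\ell\le k,\ \ell\equiv k\ (\mathrm{mod}\ (\alpha+1)),\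 1\le p\le d_\ell(n).$$ $P_k$ is the orthogonal projection from $L^2(\Omega,d\Omega)$ onto $\mathcal{H}_k^\alpha$, which is the integral operator with kernel $G_k(z,\zeta)=\sum_ie_i(z)\overline{e_i(\zeta)}$ (with respect to $d\Omega$) for any orthonormal basis $\{e_i\}$ of $\mathcal{H}_k^\alpha$; this also defines $P_k$ on $L^1(\Omega,d\Omega)$. *)

theory Defs
  imports "HOL-Analysis.Analysis"
begin

definition L2 :: "'a measure \<Rightarrow> ('a \<Rightarrow> complex) set" where
  "L2 M = {f \<in> borel_measurable M. integrable M (\<lambda>z. (cmod (f z))\<^sup>2)}"

text \<open>Members of \<open>V\<close> are compared as functions on \<open>space M\<close>, pointwise and not merely almost
  everywhere, because the kernel below evaluates them at points.\<close>

definition orthonormal_basis ::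
    "'a measure \<Rightarrow> ('a \<Rightarrow> complex) set \<Rightarrow> nat \<Rightarrow> (nat \<Rightarrow> 'a \<Rightarrow> complex) \<Rightarrow> bool" where
  "orthonormal_basis M V m e \<longleftrightarrow>
     (\<forall>i\<in>{1..m}. e i \<in> V \<inter> L2 M) \<and>
     (\<forall>i\<in>{1..m}. \<forall>j\<in>{1..m}. (\<integral>z. e i z * cnj (e j z) \<partial>M) = (if i = j then 1 else 0)) \<and>
     (\<forall>f\<in>V. \<exists>c. \<forall>z\<in>space M. f z = (\<Sum>i=1..m. c i * e i z))"

definition kernel_of :: "nat \<Rightarrow> (nat \<Rightarrow> 'a \<Rightarrow> complex) \<Rightarrow> 'a \<Rightarrow> 'a \<Rightarrow> complex" where
  "kernel_of m e z \<zeta> = (\<Sum>i=1..m. e i z * cnj (e i \<zeta>))"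

text \<open>The choice of the basis is immaterial: see \<open>proj_kernel_eq\<close> below.\<close>

definition proj_kernel :: "'a measure \<Rightarrow> ('a \<Rightarrow> complex) set \<Rightarrow> 'a \<Rightarrow> 'a \<Rightarrow> complex" where
  "proj_kernel M V =
     (case (SOME (m, e). orthonormal_basis M V m e) of (m, e) \<Rightarrow> kernel_of m e)"

definition orth_proj ::
    "'a measure \<Rightarrow> ('a \<Rightarrow> complex) set \<Rightarrow> ('a \<Rightarrow> complex) \<Rightarrow> 'a \<Rightarrow> complex" where
  "orth_proj M V f z = (\<integral>\<zeta>. proj_kernel M V z \<zeta> * f \<zeta> \<partial>M)"

lemma L2_mult_integrable:
  assumes "f \<in> L2 M" "g \<in> L2 M"
  shows "integrable M (\<lambda>z. f z * cnj (g z))"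
proof -
  have m [measurable]: "f \<in> borel_measurable M" "g \<in> borel_measurable M"
    using assms by (auto simp: L2_def)
  have mc: "(\<lambda>z. cnj (g z)) \<in> borel_measurable M"
    by (rule borel_measurable_continuous_on[OF _ m(2)]) (intro continuous_intros)
  have "integrable M (\<lambda>z. (cmod (f z))\<^sup>2 + (cmod (g z))\<^sup>2)"
    using assms by (auto simp: L2_def)
  then show ?thesis
  proof (rule Bochner_Integration.integrable_bound)
    show "(\<lambda>z. f z * cnj (g z)) \<in> borel_measurable M"
      using m(1) mc by (rule borel_measurable_times)
    have "a * b \<le> a\<^sup>2 + b\<^sup>2" if "0 \<le> a" "0 \<le> b" for a b :: real
      using sum_squares_bound[of a b] that mult_nonneg_nonneg[OF that] by linarith
    then show "AE z in M. norm (f z * cnj (g z)) \<le> norm ((cmod (f z))\<^sup>2 + (cmod (g z))\<^sup>2)"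
      by (auto simp: norm_mult)
  qed
qed

lemma orthonormal_basis_coeff:
  assumes e: "orthonormal_basis M V m e" and j: "j \<in> {1..m}"
    and f: "\<forall>z\<in>space M. f z = (\<Sum>i=1..m. c i * e i z)"
  shows "(\<integral>z. f z * cnj (e j z) \<partial>M) = c j"
proof -
  have int: "integrable M (\<lambda>z. e i z * cnj (e j z))" if "i \<in> {1..m}" for i
    using e j that by (intro L2_mult_integrable) (auto simp: orthonormal_basis_def)
  have "(\<integral>z. f z * cnj (e j z) \<partial>M) = (\<integral>z. (\<Sum>i=1..m. c i * (e i z * cnj (e j z))) \<partial>M)"
    using f by (intro Bochner_Integration.integral_cong)
      (auto simp: sum_distrib_right mult.assoc)
  also have "\<dots> = (\<Sum>i=1..m. c i * (\<integral>z. e i z * cnj (e j z) \<partial>M))"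
    using int by (subst Bochner_Integration.integral_sum) auto
  also have "\<dots> = (\<Sum>i=1..m. if i = j then c i else 0)"
    using e j by (intro sum.cong) (auto simp: orthonormal_basis_def)
  finally show ?thesis
    using j by simp
qed

lemma kernel_of_unique:
  assumes e: "orthonormal_basis M V m e" and e': "orthonormal_basis M V m' e'"
    and z: "z \<in> space M" and \<zeta>: "\<zeta> \<in> space M"
  shows "kernel_of m e z \<zeta> = kernel_of m' e' z \<zeta>"
proof -
  define a where "a j i = (\<integral>z. e' j z * cnj (e i z) \<partial>M)" for i j
  have 1: "e' j z = (\<Sum>i=1..m. a j i * e i z)" if j: "j \<in> {1..m'}" and z: "z \<in> space M" for j z
  proof -
    obtain c where c: "\<forall>z\<in>space M. e' j z = (\<Sum>i=1..m. c i * e i z)"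
      using e e' j unfolding orthonormal_basis_def by blast
    then have "c i = a j i" if "i \<in> {1..m}" for i
      unfolding a_def using orthonormal_basis_coeff[OF e that c] by simp
    then show ?thesis using c z by simp
  qed
  have 2: "e i z = (\<Sum>j=1..m'. cnj (a j i) * e' j z)" if i: "i \<in> {1..m}" and z: "z \<in> space M" for i z
  proof -
    obtain c where c: "\<forall>z\<in>space M. e i z = (\<Sum>j=1..m'. c j * e' j z)"
      using e e' i unfolding orthonormal_basis_def by blast
    have "c j = cnj (a j i)" if "j \<in> {1..m'}" for j
    proof -
      have "c j = (\<integral>z. e i z * cnj (e' j z) \<partial>M)"
        using orthonormal_basis_coeff[OF e' that c] by simp
      also have "\<dots> = cnj (a j i)"
        unfolding a_def Bochner_Integration.integral_cnj[symmetric] by (simp add: mult.commute)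
      finally show ?thesis .
    qed
    then show ?thesis using c z by simp
  qed
  have "kernel_of m' e' z \<zeta> = (\<Sum>j=1..m'. \<Sum>i=1..m. a j i * e i z * cnj (e' j \<zeta>))"
    unfolding kernel_of_def using 1 z by (simp add: sum_distrib_right)
  also have "\<dots> = (\<Sum>i=1..m. \<Sum>j=1..m'. a j i * e i z * cnj (e' j \<zeta>))"
    by (rule sum.swap)
  also have "\<dots> = (\<Sum>i=1..m. e i z * cnj (\<Sum>j=1..m'. cnj (a j i) * e' j \<zeta>))"
    by (simp add: sum_distrib_left mult_ac)
  also have "\<dots> = kernel_of m e z \<zeta>"
    unfolding kernel_of_def using 2 \<zeta> by simp
  finally show ?thesis by simp
qed

lemma proj_kernel_eq:
  assumes "orthonormal_basis M V m e" "z \<in> space M" "\<zeta> \<in> space M"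
  shows "proj_kernel M V z \<zeta> = kernel_of m e z \<zeta>"
proof -
  obtain m' e' where eq: "(SOME (m, e). orthonormal_basis M V m e) = (m', e')"
    by (rule prod.exhaust)
  have "case (SOME (m, e). orthonormal_basis M V m e) of (m, e) \<Rightarrow> orthonormal_basis M V m e"
    by (rule someI[where x = "(m, e)"]) (simp only: prod.case assms(1))
  then have "orthonormal_basis M V m' e'"
    by (simp only: eq prod.case)
  from kernel_of_unique[OF this assms] show ?thesis
    by (simp only: proj_kernel_def eq prod.case)
qed

text \<open>Surface measure: \<open>n\<close> times the Lebesgue measure of the cone \<open>{t \<omega> | 0 < t < 1, \<omega> \<in> A}\<close>.\<close>

definition sphere_measure :: "(real ^ 'n) measure" where
  "sphere_measure = scale_measure (of_nat CARD('n))
     (distr (restrict_space lborel (ball 0 1 - {0})) (restrict_space borel (sphere 0 1)) sgn)"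

definition laplacian :: "(real ^ 'n \<Rightarrow> complex) \<Rightarrow> real ^ 'n \<Rightarrow> complex" where
  "laplacian f x = (\<Sum>i\<in>UNIV.
     vector_derivative
       (\<lambda>t. vector_derivative (\<lambda>s. f (x + s *\<^sub>R axis i 1)) (at t)) (at 0))"

text \<open>Restrictions to the sphere of homogeneous harmonic polynomials; the values off the sphere
  are irrelevant.\<close>

definition spherical_harmonics :: "nat \<Rightarrow> (real ^ 'n \<Rightarrow> complex) set" where
  "spherical_harmonics l = {Y. \<exists>p. polynomial_function p \<and>
     (\<forall>t x. p (t *\<^sub>R x) = of_real (t ^ l) * p x) \<and>
     (\<forall>x. laplacian p x = 0) \<and>
     (\<forall>\<omega>\<in>sphere 0 1. Y \<omega> = p \<omega>)}"

text \<open>The number \<open>d l\<close> is forced to be the dimension of the space of harmonics of degree \<open>l\<close>.\<close>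

definition spherical_harmonics_basis ::
    "(nat \<Rightarrow> nat) \<Rightarrow> (nat \<Rightarrow> nat \<Rightarrow> real ^ 'n \<Rightarrow> complex) \<Rightarrow> bool" where
  "spherical_harmonics_basis d Y \<longleftrightarrow>
     (\<forall>l. orthonormal_basis sphere_measure (spherical_harmonics l) (d l) (Y l))"

definition gegenbauer :: "nat \<Rightarrow> real \<Rightarrow> real \<Rightarrow> real" where
  "gegenbauer N \<nu> x = (\<Sum>j\<le>N div 2.
     (-1) ^ j * pochhammer \<nu> (N - j) / (fact j * fact (N - 2 * j)) * (2 * x) ^ (N - 2 * j))"

definition grushin_norm :: "nat \<Rightarrow> (real ^ 'n) \<times> real \<Rightarrow> real" where
  "grushin_norm \<alpha> z =
     (norm (fst z) ^ (2 * (\<alpha> + 1)) + (real \<alpha> + 1)\<^sup>2 * (snd z)\<^sup>2) powr (1 / (2 * (real \<alpha> + 1)))"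

definition Grushin_sphere :: "nat \<Rightarrow> ((real ^ 'n) \<times> real) set" where
  "Grushin_sphere \<alpha> = {z. grushin_norm \<alpha> z = 1}"

text \<open>The point of \<open>\<Omega>\<close> with polar coordinates \<open>(1, \<phi>, \<omega>)\<close>. This parametrizes \<open>\<Omega>\<close> without its two
  poles \<open>x = 0\<close>, and \<open>grushin_angle\<close>, \<open>grushin_dir\<close> are the inverse coordinates. At the poles,
  which are null for \<open>d\<Omega>\<close>, the direction takes the dummy value \<open>sgn 0 = 0\<close>.\<close>

definition grushin_point :: "nat \<Rightarrow> real \<times> (real ^ 'n) \<Rightarrow> (real ^ 'n) \<times> real" where
  "grushin_point \<alpha> = (\<lambda>(\<phi>, \<omega>).
     ((sin \<phi> powr (1 / (real \<alpha> + 1))) *\<^sub>R \<omega>, cos \<phi> / (real \<alpha> + 1)))"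

definition grushin_angle :: "nat \<Rightarrow> (real ^ 'n) \<times> real \<Rightarrow> real" where
  "grushin_angle \<alpha> z = arccos ((real \<alpha> + 1) * snd z / grushin_norm \<alpha> z ^ (\<alpha> + 1))"

definition grushin_dir :: "(real ^ 'n) \<times> real \<Rightarrow> real ^ 'n" where
  "grushin_dir z = sgn (fst z)"

definition Grushin_measure :: "nat \<Rightarrow> ((real ^ 'n) \<times> real) measure" where
  "Grushin_measure \<alpha> =
     distr
       (density (restrict_space lborel {0<..<pi} \<Otimes>\<^sub>M sphere_measure)
         (\<lambda>(\<phi>, \<omega>). ennreal (sin \<phi> powr ((real CARD('n) - 2) / (real \<alpha> + 1) + 1))))
       (restrict_space borel (Grushin_sphere \<alpha>))
       (grushin_point \<alpha>)"

definition grushin_psi :: "nat \<Rightarrow> real \<Rightarrow> real" where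
  "grushin_psi \<alpha> \<phi> = sin \<phi> powr (2 * real \<alpha> / (real \<alpha> + 1))"

definition grushin_harmonic ::
    "nat \<Rightarrow> (nat \<Rightarrow> nat \<Rightarrow> real ^ 'n \<Rightarrow> complex) \<Rightarrow> nat \<Rightarrow> nat \<Rightarrow> nat \<Rightarrow> (real ^ 'n) \<times> real \<Rightarrow> complex" where
  "grushin_harmonic \<alpha> Y k l p z =
     of_real (sin (grushin_angle \<alpha> z) powr (real l / (real \<alpha> + 1)) *
       gegenbauer ((k - l) div (\<alpha> + 1))
         ((2 * real l + real CARD('n) - 2) / (2 * (real \<alpha> + 1)) + 1 / 2)
         (cos (grushin_angle \<alpha> z))) *
     Y l p (grushin_dir z)"

definition grushin_index :: "nat \<Rightarrow> (nat \<Rightarrow> nat) \<Rightarrow> nat \<Rightarrow> (nat \<times> nat) set" where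
  "grushin_index \<alpha> d k =
     {(l, p). l \<le> k \<and> l mod (\<alpha> + 1) = k mod (\<alpha> + 1) \<and> 1 \<le> p \<and> p \<le> d l}"

definition grushin_space ::
    "nat \<Rightarrow> (nat \<Rightarrow> nat) \<Rightarrow> (nat \<Rightarrow> nat \<Rightarrow> real ^ 'n \<Rightarrow> complex) \<Rightarrow> nat
      \<Rightarrow> ((real ^ 'n) \<times> real \<Rightarrow> complex) set" where
  "grushin_space \<alpha> d Y k =
     {f. \<exists>c. f = (\<lambda>z. \<Sum>(l, p)\<in>grushin_index \<alpha> d k. c l p * grushin_harmonic \<alpha> Y k l p z)}"

definition grushin_proj ::
    "nat \<Rightarrow> (nat \<Rightarrow> nat) \<Rightarrow> (nat \<Rightarrow> nat \<Rightarrow> real ^ 'n \<Rightarrow> complex) \<Rightarrow> nat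
      \<Rightarrow> ((real ^ 'n) \<times> real \<Rightarrow> complex) \<Rightarrow> (real ^ 'n) \<times> real \<Rightarrow> complex" where
  "grushin_proj \<alpha> d Y k = orth_proj (Grushin_measure \<alpha>) (grushin_space \<alpha> d Y k)"

end

theory Submission
  imports Defs "HOL-Computational_Algebra.Polynomial"
begin

text \<open>
  In polar coordinates the space \<open>H\<^sub>k\<close> splits, over the degree \<open>l\<close> of the spherical harmonic,
  into pieces with a single radial profile each, and harmonics of different degrees are orthogonal. Hence
  the norm of \<open>sin\<^bsup>-\<beta>\<^esup> P\<^sub>k sin\<^bsup>-\<beta>\<^esup>\<close> is the maximum over \<open>l\<close> of the ratio
  of the integrals of \<open>sin\<^bsup>-2\<beta>\<^esup> u\<^sup>2\<close> and \<open>u\<^sup>2\<close> for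
  \<open>u(\<phi>) = sin\<^bsup>\<nu>\<^esup> \<phi> C\<^sub>N\<^bsup>(\<nu>)\<^esup>(cos \<phi>)\<close>. This function solves
  \<open>u'' + Qu = 0\<close> with \<open>Q = L\<^sup>2 - \<nu>(\<nu> - 1)/sin\<^sup>2\<close> and \<open>L = N + \<nu>\<close>.

  With \<open>e = 1/(L + 1)\<close>, the weight \<open>s\<^bsup>-2\<beta>\<^esup>\<close> is dominated by
  \<open>(s + e)\<^bsup>-2\<beta>\<^esup> + e\<^bsup>2-2\<beta>\<^esup> s\<^bsup>-2\<^esup>\<close>. The second term is
  integrated exactly. For \<open>\<nu> > 1\<close> the first one is bounded by a multiplier identity whose multiplier is
  \<open>cos \<phi>\<close> times a concave function of \<open>sin \<phi>\<close>; for \<open>1/2 \<le> \<nu> \<le> 1\<close> Sonin's argument bounds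
  \<open>u\<^sup>2\<close> pointwise. In the borderline case \<open>\<nu> = 1/2\<close> (Legendre polynomials) the second term
  is not integrable and is replaced by the bound of the polynomial by its values at the end points.
\<close>

section \<open>The interval (0, pi)\<close>

text \<open>The operator is sin^(-\<beta>) P sin^(-\<beta>) g = sum of <g, F_j> F_j, where F_j is
  the weighted j-th element of an orthonormal basis. The weight depends on \<phi> only, so the F_j
  stay orthogonal, and if their squared norms are at most B, so is the operator norm. Squared norms
  are compared in the theorem, hence B squared and the exponent 2(2\<beta> - 1).

  The obstacle is uniformity in N and \<nu>. The multiplier bound costs 1/(L^2 - 1) and the exact
  integral 1/(2\<nu> - 1), which degenerate as \<nu> comes down to 1 and 1/2. The orders that occur
  form a discrete set, so each lies on the safe side of a threshold or stays a fixed gap above it.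

  The scale e is chosen so that L e is at most 1: the exact integral of the second term carries a
  factor L, one power of e absorbs it, and e^(1 - 2\<beta>) remains. This is the source of the
  growth in k.

  The weight \<psi>^(-\<beta>) is the sine to the power -2\<alpha>\<beta>/(\<alpha> + 1). At \<beta>
  = (\<alpha> + 1)/(4\<alpha>) this power is the excluded -1/2, so it is replaced by the more
  singular -\<alpha>/(\<alpha> + 1), for which the exponent of k + 1 is exactly the one
  claimed.\<close>

abbreviation Ipi :: "real measure" where
  "Ipi \<equiv> restrict_space lborel {0<..<pi}"

lemma Ipi_integral: "(\<integral>x. f x \<partial>Ipi) = (LINT x:{0<..<pi}|lborel. f x)"
  for f :: "real \<Rightarrow> real"
  by (simp add: integral_restrict_space set_lebesgue_integral_def)

lemma Ipi_integrable: "integrable Ipi f \<longleftrightarrow> set_integrable lborel {0<..<pi} f"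
  for f :: "real \<Rightarrow> real"
  by (simp add: integrable_restrict_space set_integrable_def)

lemma Ipi_measurable:
  fixes f :: "real \<Rightarrow> real"
  assumes "continuous_on {0<..<pi} f"
  shows "f \<in> borel_measurable Ipi"
proof -
  have "sets Ipi = sets (restrict_space borel {0<..<pi})"
    by (simp add: sets_restrict_space)
  then show ?thesis
    using borel_measurable_continuous_on_restrict[OF assms] measurable_cong_sets by blast
qed

text \<open>The gauge integral is the bridge to the fundamental theorem of calculus: there,
  continuity on the closed interval and a derivative on the open one suffice, so derivatives may
  blow up at the poles.\<close>

lemma Ipi_has_integral:
  fixes f :: "real \<Rightarrow> real"
  assumes "integrable Ipi f"
  shows "(f has_integral (\<integral>x. f x \<partial>Ipi)) {0..pi}"
proof -
  have "set_integrable lborel {0<..<pi} f"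
    using assms by (simp add: Ipi_integrable)
  from set_borel_integral_eq_integral[OF this]
  have "(f has_integral (\<integral>x. f x \<partial>Ipi)) {0<..<pi}"
    by (simp add: Ipi_integral has_integral_integrable_integral)
  then show ?thesis
    by (simp add: has_integral_Icc_iff_Ioo)
qed

text \<open>The primitive yields only gauge integrability; the sign of \<open>g\<close> upgrades it
  to Lebesgue integrability.\<close>

lemma Ipi_FTC_nonneg_integrable:
  fixes G g :: "real \<Rightarrow> real"
  assumes "continuous_on {0..pi} G" "continuous_on {0<..<pi} g"
    and "\<And>x. 0 < x \<Longrightarrow> x < pi \<Longrightarrow> (G has_real_derivative g x) (at x)"
    and "\<And>x. 0 < x \<Longrightarrow> x < pi \<Longrightarrow> 0 \<le> g x"
  shows "integrable Ipi g"
proof -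
  have "(g has_integral (G pi - G 0)) {0..pi}"
    using assms(1,3) by (intro fundamental_theorem_of_calculus_interior)
      (auto simp: has_real_derivative_iff_has_vector_derivative)
  then have "g integrable_on {0<..<pi}"
    by (auto simp: has_integral_Icc_iff_Ioo)
  then have "g absolutely_integrable_on {0<..<pi}"
    using assms(4) by (intro nonnegative_absolutely_integrable_1) auto
  then have i: "integrable lebesgue (\<lambda>x. indicator {0<..<pi} x *\<^sub>R g x)"
    by (simp add: set_integrable_def)
  have "(\<lambda>x. indicator {0<..<pi} x *\<^sub>R g x) \<in> borel_measurable lborel"
    using borel_measurable_continuous_on_indicator[OF _ assms(2)] by simp
  then show ?thesis
    using i by (simp add: Ipi_integrable set_integrable_def integrable_completion)
qed

lemma Ipi_FTC:
  fixes G g :: "real \<Rightarrow> real"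
  assumes "continuous_on {0..pi} G" "integrable Ipi g"
    and "\<And>x. 0 < x \<Longrightarrow> x < pi \<Longrightarrow> (G has_real_derivative g x) (at x)"
  shows "(\<integral>x. g x \<partial>Ipi) = G pi - G 0"
proof -
  have "(g has_integral (G pi - G 0)) {0..pi}"
    using assms(1,3) by (intro fundamental_theorem_of_calculus_interior)
      (auto simp: has_real_derivative_iff_has_vector_derivative)
  with Ipi_has_integral[OF assms(2)] show ?thesis
    by (rule has_integral_unique)
qed

text \<open>Lebesgue integrability is asked of the minorant \<open>f\<close> alone. The derivatives
  of the multiplier expressions below are singular at the poles, and comparing in the gauge integral
  avoids proving them Lebesgue integrable.\<close>

lemma Ipi_FTC_le:
  fixes G g :: "real \<Rightarrow> real"
  assumes "continuous_on {0..pi} G" "integrable Ipi f"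
    and "\<And>x. 0 < x \<Longrightarrow> x < pi \<Longrightarrow> (G has_real_derivative g x) (at x)"
    and "\<And>x. 0 < x \<Longrightarrow> x < pi \<Longrightarrow> f x \<le> g x"
  shows "(\<integral>x. f x \<partial>Ipi) \<le> G pi - G 0"
proof -
  have g: "(g has_integral (G pi - G 0)) {0..pi}"
    using assms(1,3) by (intro fundamental_theorem_of_calculus_interior)
      (auto simp: has_real_derivative_iff_has_vector_derivative)
  show ?thesis
  proof (rule has_integral_le)
    show "(f has_integral (\<integral>x. f x \<partial>Ipi)) {0<..<pi}"
      using Ipi_has_integral[OF assms(2)] unfolding has_integral_Icc_iff_Ioo .
    show "(g has_integral (G pi - G 0)) {0<..<pi}"
      using g unfolding has_integral_Icc_iff_Ioo .
    show "f x \<le> g x" if "x \<in> {0<..<pi}" for x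
      using that assms(4) by simp
  qed
qed

section \<open>Gegenbauer polynomials\<close>

lemma Ipi_integrable_continuous:
  fixes f :: "real \<Rightarrow> real"
  assumes "continuous_on {0..pi} f"
  shows "integrable Ipi f"
  unfolding Ipi_integrable
  by (rule set_integrable_subset[OF borel_integrable_atLeastAtMost'[OF assms]]) auto

lemma sin_in_0_pi: "0 < x \<Longrightarrow> x < pi \<Longrightarrow> 0 < sin x \<and> sin x \<le> 1"
  by (simp add: sin_gt_zero)

lemma continuous_on_sin_powr [continuous_intros]:
  assumes "p > 0"
  shows "continuous_on {0..pi} (\<lambda>x. sin x powr p)"
  using assms by (intro continuous_on_powr' continuous_intros) (auto simp: sin_ge_zero)

lemma continuous_on_sin_powr_open [continuous_intros]: "continuous_on {0<..<pi} (\<lambda>x. sin x powr p)"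
proof (intro continuous_on_powr' continuous_intros ballI)
  fix x :: real assume "x \<in> {0<..<pi}"
  then show "0 \<le> sin x \<and> (sin x = 0 \<longrightarrow> 0 < p)" using sin_gt_zero[of x] by auto
qed

lemma has_real_derivative_sin_powr:
  assumes "0 < x" "x < pi"
  shows "((\<lambda>x. sin x powr p) has_real_derivative p * sin x powr (p - 1) * cos x) (at x)"
proof -
  have "sin x > 0" using assms by (rule sin_gt_zero)
  then show ?thesis
    by (auto intro!: derivative_eq_intros simp: powr_diff)
qed

text \<open>The derivative of \<open>cos x * sin x powr (p + 1)\<close> is (p + 1) cos^2 sin^p -
  sin^(p + 2). Adding \<open>x\<close> to the primitive makes it nonnegative, hence integrable;
  since cos^2 = 1 - sin^2, the power sin^p is recovered from it and the bounded sin^(p + 2).\<close>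

lemma sin_powr_integrable:
  assumes "p > -1"
  shows "integrable Ipi (\<lambda>x. sin x powr p)"
proof -
  let ?g = "\<lambda>x. (1 - sin x powr (p + 2)) + (p + 1) * (cos x)\<^sup>2 * sin x powr p"
  have g: "integrable Ipi ?g"
  proof (rule Ipi_FTC_nonneg_integrable)
    show "continuous_on {0..pi} (\<lambda>x. cos x * sin x powr (p + 1) + x)"
      using assms by (intro continuous_intros) auto
    show "continuous_on {0<..<pi} ?g"
      by (intro continuous_intros)
    fix x :: real assume x: "0 < x" "x < pi"
    have s: "0 < sin x" "sin x \<le> 1" using sin_in_0_pi[OF x] by auto
    have p2: "sin x powr (p + 2) = sin x powr (p + 1) * sin x"
      using s powr_add[of "sin x" "p + 1" 1] by (simp add: add.commute add.left_commute)
    show "((\<lambda>x. cos x * sin x powr (p + 1) + x) has_real_derivative ?g x) (at x)"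
      by (rule derivative_eq_intros has_real_derivative_sin_powr x refl)+
        (simp add: p2 power2_eq_square algebra_simps)
    show "0 \<le> ?g x"
    proof -
      have "sin x powr (p + 2) \<le> 1" using s assms by (intro powr_le1) auto
      moreover have "0 \<le> (p + 1) * (cos x)\<^sup>2 * sin x powr p" using assms by simp
      ultimately show ?thesis by linarith
    qed
  qed
  have s2: "integrable Ipi (\<lambda>x. sin x powr (p + 2))"
    using assms by (intro Ipi_integrable_continuous continuous_intros) auto
  have one: "integrable Ipi (\<lambda>x. 1 :: real)"
    by (intro Ipi_integrable_continuous continuous_intros)
  have "integrable Ipi (\<lambda>x. (?g x - 1 + (p + 2) * sin x powr (p + 2)) / (p + 1))"
    by (rule integrable_divide[OF Bochner_Integration.integrable_add
      [OF Bochner_Integration.integrable_diff[OF g one] integrable_mult_right[OF s2]]])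
  then show ?thesis
  proof (rule Bochner_Integration.integrable_cong[THEN iffD1, OF refl, rotated])
    fix x assume "x \<in> space Ipi"
    then have x: "0 < x" "x < pi" by (auto simp: space_restrict_space)
    have s: "0 < sin x" using sin_in_0_pi[OF x] by auto
    have "sin x powr (p + 2) = sin x powr p * (1 - (cos x)\<^sup>2)"
      using s powr_add[of "sin x" p 2] by (simp add: sin_squared_eq[symmetric])
    then have "?g x - 1 + (p + 2) * sin x powr (p + 2) = (p + 1) * sin x powr p"
      by algebra
    then show "(?g x - 1 + (p + 2) * sin x powr (p + 2)) / (p + 1) = sin x powr p"
      using assms by simp
  qed
qed

lemma sin_powr_mult_integrable:
  fixes h :: "real \<Rightarrow> real"
  assumes "p > -1" "continuous_on {0..pi} h"
  shows "integrable Ipi (\<lambda>x. sin x powr p * h x)"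
proof -
  have "bounded (h ` {0..pi})"
    using assms(2) by (intro compact_imp_bounded compact_continuous_image) auto
  then obtain B where B: "\<And>x. x \<in> {0..pi} \<Longrightarrow> \<bar>h x\<bar> \<le> B"
    unfolding bounded_iff by fastforce
  show ?thesis
  proof (rule Bochner_Integration.integrable_bound)
    show "integrable Ipi (\<lambda>x. B * sin x powr p)"
      using sin_powr_integrable[OF assms(1)] by (rule integrable_mult_right)
    show "(\<lambda>x. sin x powr p * h x) \<in> borel_measurable Ipi"
      by (intro Ipi_measurable continuous_intros continuous_on_subset[OF assms(2)]) auto
    have "norm (sin x powr p * h x) \<le> norm (B * sin x powr p)" if "x \<in> space Ipi" for x
    proof -
      have x: "x \<in> {0..pi}" using that by (auto simp: space_restrict_space)
      have "\<bar>h x\<bar> \<le> \<bar>B\<bar>" using B[OF x] by linarith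
      then show ?thesis by (simp add: abs_mult mult.commute mult_right_mono)
    qed
    then show "AE x in Ipi. norm (sin x powr p * h x) \<le> norm (B * sin x powr p)"
      by auto
  qed
qed

lemma continuous_on_poly_cos [continuous_intros]: "continuous_on A (\<lambda>x. poly q (cos x))" for q :: "real poly"
  by (intro continuous_intros)

lemma has_real_derivative_poly_cos:
  "((\<lambda>x. poly q (cos x)) has_real_derivative - poly (pderiv q) (cos x) * sin x) (at x)"
  for q :: "real poly"
  by (rule DERIV_chain2[OF poly_DERIV, THEN DERIV_cong]) (auto intro!: derivative_eq_intros)

section \<open>Gegenbauer polynomials as elements of \<open>real poly\<close>, and their
  differential equation\<close>

definition gegenbauer_coeff :: "nat \<Rightarrow> real \<Rightarrow> nat \<Rightarrow> real" where
  "gegenbauer_coeff N \<nu> j =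
     (-1) ^ j * pochhammer \<nu> (N - j) / (fact j * fact (N - 2 * j)) * 2 ^ (N - 2 * j)"

definition gegenbauer_poly :: "nat \<Rightarrow> real \<Rightarrow> real poly" where
  "gegenbauer_poly N \<nu> = (\<Sum>j\<le>N div 2. monom (gegenbauer_coeff N \<nu> j) (N - 2 * j))"

lemma poly_gegenbauer_poly: "poly (gegenbauer_poly N \<nu>) x = gegenbauer N \<nu> x"
  by (simp add: gegenbauer_poly_def gegenbauer_def gegenbauer_coeff_def poly_sum poly_monom
    power_mult_distrib mult.assoc)

lemma degree_gegenbauer_poly: "degree (gegenbauer_poly N \<nu>) \<le> N"
  unfolding gegenbauer_poly_def
  by (rule degree_sum_le) (auto intro: order.trans[OF degree_monom_le])

lemma gegenbauer_poly_nonzero: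
  assumes "\<nu> > 0"
  shows "gegenbauer_poly N \<nu> \<noteq> 0"
proof -
  have "coeff (gegenbauer_poly N \<nu>) N = (\<Sum>j\<le>N div 2. if j = 0 then gegenbauer_coeff N \<nu> 0 else 0)"
    unfolding gegenbauer_poly_def coeff_sum
  proof (rule sum.cong[OF refl])
    fix j assume "j \<in> {..N div 2}"
    then show "coeff (monom (gegenbauer_coeff N \<nu> j) (N - 2 * j)) N = (if j = 0 then gegenbauer_coeff N \<nu> 0 else 0)"
      by (cases "N = 0"; cases "j = 0") auto
  qed
  also have "\<dots> = gegenbauer_coeff N \<nu> 0"
    by simp
  also have "\<dots> \<noteq> 0"
    using pochhammer_pos[OF assms, of N] by (simp add: gegenbauer_coeff_def)
  finally show ?thesis by auto
qed

text \<open>This two-term recurrence is what makes the sum in \<open>gegenbauer_ode\<close>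
  telescope.\<close>

lemma gegenbauer_coeff_Suc:
  assumes "\<nu> > 0" "2 * (j + 1) \<le> N"
  shows "4 * (real j + 1) * (\<nu> + real (N - j - 1)) * gegenbauer_coeff N \<nu> (Suc j) =
    - (real (N - 2 * j) * (real (N - 2 * j) - 1)) * gegenbauer_coeff N \<nu> j"
proof -
  define i where "i = N - 2 * j - 2"
  have N: "N = i + 2 * j + 2" using assms by (simp add: i_def)
  have e: "N - j = Suc (N - Suc j)" "N - 2 * j = Suc (Suc i)" "N - 2 * Suc j = i" "N - j - 1 = N - Suc j"
    using N by auto
  show ?thesis
    unfolding gegenbauer_coeff_def e(3) unfolding e(1,2,4)
    by (simp add: pochhammer_Suc divide_simps)
qed

lemma gegenbauer_ode:
  fixes N :: nat and \<nu> x :: real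
  assumes "\<nu> > 0"
  defines "y \<equiv> gegenbauer_poly N \<nu>"
  shows "(1 - x\<^sup>2) * poly (pderiv (pderiv y)) x
    = (2 * \<nu> + 1) * x * poly (pderiv y) x - N * (N + 2 * \<nu>) * poly y x"
proof -
  let ?a = "gegenbauer_coeff N \<nu>"
  \<comment> \<open>The operator maps a monomial of degree \<open>e\<close> to a multiple of itself
    plus a multiple of degree \<open>e - 2\<close>. \<open>b j\<close> is the diagonal part from
    index \<open>j\<close>, and by the recurrence the lower part is \<open>- b (Suc j)\<close>. Both
    ends of the telescope vanish: \<open>b 0\<close> has the factor \<open>j\<close>, and beyond
    \<open>N div 2\<close> the definition gives 0.\<close>
  define b where
    "b j = (if 2 * j \<le> N then ?a j * (4 * j * (\<nu> + real (N - j))) * x ^ (N - 2 * j) else 0)" for j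
  have pd: "pderiv (sum f A) = (\<Sum>i\<in>A. pderiv (f i))" for f :: "nat \<Rightarrow> real poly" and A
    by (induction A rule: infinite_finite_induct) (simp_all add: pderiv_add)
  have mono: "(1 - x\<^sup>2) * poly (pderiv (pderiv (monom c e))) x
      - (2 * \<nu> + 1) * x * poly (pderiv (monom c e)) x + N * (N + 2 * \<nu>) * poly (monom c e) x
      = c * ((real N - e) * (N + e + 2 * \<nu>) * x ^ e + real e * (real e - 1) * x ^ (e - 2))" for c e
  proof -
    consider "e = 0" | "e = 1" | i where "e = Suc (Suc i)"
      by (metis One_nat_def old.nat.exhaust)
    then show ?thesis
      by cases (simp_all add: pderiv_monom poly_monom algebra_simps power2_eq_square)
  qed
  have "(1 - x\<^sup>2) * poly (pderiv (pderiv y)) x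
      - (2 * \<nu> + 1) * x * poly (pderiv y) x + N * (N + 2 * \<nu>) * poly y x
    = (\<Sum>j\<le>N div 2. (1 - x\<^sup>2) * poly (pderiv (pderiv (monom (?a j) (N - 2 * j)))) x
      - (2 * \<nu> + 1) * x * poly (pderiv (monom (?a j) (N - 2 * j))) x
      + N * (N + 2 * \<nu>) * poly (monom (?a j) (N - 2 * j)) x)"
    unfolding y_def gegenbauer_poly_def pd poly_sum
    by (simp add: sum.distrib sum_subtractf sum_distrib_left)
  also have "\<dots> = (\<Sum>j\<le>N div 2. b j - b (Suc j))"
  proof (rule sum.cong[OF refl])
    fix j assume "j \<in> {..N div 2}"
    then have j: "2 * j \<le> N" by auto
    define e where "e = N - 2 * j"
    have eN: "real N = real e + 2 * real j" using j by (simp add: e_def)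
    have bj: "?a j * ((real N - e) * (N + e + 2 * \<nu>) * x ^ e) = b j"
    proof -
      have "real (N - j) = real e + real j" using j by (simp add: e_def)
      then show ?thesis unfolding b_def e_def[symmetric] eN using j by (simp add: algebra_simps)
    qed
    have bS: "?a j * (real e * (real e - 1) * x ^ (e - 2)) = - b (Suc j)"
    proof (cases "2 * (j + 1) \<le> N")
      case True
      have "?a j * (e * (real e - 1)) = - (?a (Suc j) * (4 * real (Suc j) * (\<nu> + real (N - Suc j))))"
        using gegenbauer_coeff_Suc[OF assms(1) True] by (simp add: e_def algebra_simps)
      moreover have "real (e - 1) = real e - 1" using True by (simp add: e_def)
      moreover have "N - 2 * Suc j = e - 2" by (simp add: e_def)
      ultimately show ?thesis unfolding b_def using True by (simp add: mult.assoc[symmetric])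
    next
      case False
      then have "e = 0 \<or> e = 1" by (auto simp: e_def)
      moreover have "b (Suc j) = 0"
        using False by (simp add: b_def)
      ultimately show ?thesis by auto
    qed
    show "(1 - x\<^sup>2) * poly (pderiv (pderiv (monom (?a j) (N - 2 * j)))) x
      - (2 * \<nu> + 1) * x * poly (pderiv (monom (?a j) (N - 2 * j))) x
      + N * (N + 2 * \<nu>) * poly (monom (?a j) (N - 2 * j)) x = b j - b (Suc j)"
      unfolding e_def[symmetric] mono using bj bS by (simp add: distrib_left)
  qed
  also have "\<dots> = b 0 - b (Suc (N div 2))"
    by (rule sum_telescope)
  also have "\<dots> = 0"
    by (simp add: b_def)
  finally show ?thesis by simp
qed

text \<open>Only the differential equation and the degree enter the estimates. These are quadratic
  in \<open>y\<close> on both sides, so the normalization of the polynomial is immaterial.\<close>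

locale gegenbauer_solution =
  fixes y :: "real poly" and N :: nat and \<nu> :: real
  assumes \<nu>_ge: "\<nu> \<ge> 1 / 2"
    and degree_le: "degree y \<le> N"
    and ode: "\<And>x. (1 - x\<^sup>2) * poly (pderiv (pderiv y)) x
      = (2 * \<nu> + 1) * x * poly (pderiv y) x - N * (N + 2 * \<nu>) * poly y x"
begin

definition moment :: "real \<Rightarrow> real" where
  "moment p = (\<integral>x. sin x powr (2 * \<nu> + p) * (poly y (cos x))\<^sup>2 \<partial>Ipi)"

lemma moment_integrable:
  assumes "2 * \<nu> + p > -1"
  shows "integrable Ipi (\<lambda>x. sin x powr (2 * \<nu> + p) * (poly y (cos x))\<^sup>2)"
  using assms by (intro sin_powr_mult_integrable continuous_intros)

lemma moment_nonneg: "moment p \<ge> 0"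
  unfolding moment_def by (intro Bochner_Integration.integral_nonneg) simp

text \<open>Lagrange's identity for \<open>y\<close> and the monomial: sin^(2\<nu> + 1) times the
  Wronskian \<open>w\<close> vanishes at both poles, and its derivative integrates to a relation
  between the moments of orders \<open>j\<close> and \<open>j - 2\<close>. The factor
  \<open>N - j\<close> is nonzero, so strong induction applies.\<close>

lemma orthogonal_monomial:
  "j < N \<Longrightarrow> (\<integral>x. sin x powr (2 * \<nu>) * (poly y (cos x) * cos x ^ j) \<partial>Ipi) = 0"
proof (induction j rule: less_induct)
  case (less j)
  define A where "A j = (\<integral>x. sin x powr (2 * \<nu>) * (poly y (cos x) * cos x ^ j) \<partial>Ipi)" for j
  define q :: "real poly" where "q = monom 1 j"
  define w where "w = pderiv y * q - y * pderiv q"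
  define r where "r = smult ((real N - j) * (N + j + 2 * \<nu>)) (y * q)
    + smult (real j * real (j - 1)) (y * monom 1 (j - 2))"
  have r: "(2 * \<nu> + 1) * x * poly w x - (1 - x\<^sup>2) * poly (pderiv w) x = poly r x" for x
  proof -
    have D: "(1 - x\<^sup>2) * poly (pderiv (pderiv q)) x - (2 * \<nu> + 1) * x * poly (pderiv q) x
        = real j * real (j - 1) * x ^ (j - 2) - j * (j + 2 * \<nu>) * x ^ j"
    proof -
      consider "j = 0" | "j = 1" | i where "j = Suc (Suc i)"
        by (metis One_nat_def old.nat.exhaust)
      then show ?thesis
        by cases (simp_all add: q_def pderiv_monom poly_monom algebra_simps power2_eq_square)
    qed
    have "(2 * \<nu> + 1) * x * poly w x - (1 - x\<^sup>2) * poly (pderiv w) x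
      = ((2 * \<nu> + 1) * x * poly (pderiv y) x - (1 - x\<^sup>2) * poly (pderiv (pderiv y)) x) * poly q x
        + poly y x * ((1 - x\<^sup>2) * poly (pderiv (pderiv q)) x - (2 * \<nu> + 1) * x * poly (pderiv q) x)"
      by (simp add: w_def pderiv_diff pderiv_mult algebra_simps)
    also have "\<dots> = poly r x"
      unfolding ode D r_def by (simp add: q_def poly_monom algebra_simps)
    finally show ?thesis .
  qed
  have int: "integrable Ipi (\<lambda>x. sin x powr (2 * \<nu>) * (poly y (cos x) * cos x ^ i))" for i
    using \<nu>_ge by (intro sin_powr_mult_integrable continuous_intros) auto
  have "0 = (\<integral>x. sin x powr (2 * \<nu>) * poly r (cos x) \<partial>Ipi)"
  proof -
    have "(\<integral>x. sin x powr (2 * \<nu>) * poly r (cos x) \<partial>Ipi) =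
      sin pi powr (2 * \<nu> + 1) * poly w (cos pi) - sin 0 powr (2 * \<nu> + 1) * poly w (cos 0)"
    proof (rule Ipi_FTC)
      show "continuous_on {0..pi} (\<lambda>x. sin x powr (2 * \<nu> + 1) * poly w (cos x))"
        using \<nu>_ge by (intro continuous_intros) auto
      show "integrable Ipi (\<lambda>x. sin x powr (2 * \<nu>) * poly r (cos x))"
        using \<nu>_ge by (intro sin_powr_mult_integrable continuous_intros) auto
      fix x :: real assume x: "0 < x" "x < pi"
      have s: "sin x powr (2 * \<nu> + 1) * sin x = sin x powr (2 * \<nu>) * (1 - (cos x)\<^sup>2)"
        using sin_in_0_pi[OF x] by (simp add: powr_add sin_squared_eq[symmetric]) (simp add: power2_eq_square)
      show "((\<lambda>x. sin x powr (2 * \<nu> + 1) * poly w (cos x)) has_real_derivative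
          sin x powr (2 * \<nu>) * poly r (cos x)) (at x)"
        unfolding r[symmetric]
        by (rule has_real_derivative_sin_powr[OF x] has_real_derivative_poly_cos derivative_eq_intros refl)+
          (use s in \<open>simp, algebra\<close>)
    qed
    then show ?thesis by simp
  qed
  also have "\<dots> = (\<integral>x. (real N - j) * (N + j + 2 * \<nu>) * (sin x powr (2 * \<nu>) * (poly y (cos x) * cos x ^ j))
      + real j * real (j - 1) * (sin x powr (2 * \<nu>) * (poly y (cos x) * cos x ^ (j - 2))) \<partial>Ipi)"
    by (intro Bochner_Integration.integral_cong) (auto simp: r_def q_def poly_monom algebra_simps)
  also have "\<dots> = (real N - j) * (N + j + 2 * \<nu>) * A j + real j * real (j - 1) * A (j - 2)"
    unfolding A_def using int by simp
  finally have *: "(real N - j) * (N + j + 2 * \<nu>) * A j + real j * real (j - 1) * A (j - 2) = 0"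
    by simp
  have "real j * real (j - 1) * A (j - 2) = 0"
  proof (cases "j \<ge> 2")
    case True
    then show ?thesis using less.IH[of "j - 2"] less.prems by (simp add: A_def)
  next
    case False
    then show ?thesis by (cases j) auto
  qed
  with * have "(real N - j) * (N + j + 2 * \<nu>) * A j = 0" by linarith
  moreover have "(real N - j) * (N + j + 2 * \<nu>) \<noteq> 0" using less.prems \<nu>_ge by auto
  ultimately show ?case by (simp add: A_def)
qed

text \<open>The polynomials x y' and N y have the same coefficient of degree \<open>N\<close>, so
  their difference has lower degree and is orthogonal to \<open>y\<close>.\<close>

lemma integral_x_deriv:
  "(\<integral>x. sin x powr (2 * \<nu>) * (poly y (cos x) * (cos x * poly (pderiv y) (cos x))) \<partial>Ipi) = N * moment 0"
proof -
  have *: "x * poly (pderiv y) x = N * poly y x + (\<Sum>j<N. (real j - N) * coeff y j * x ^ j)" for x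
  proof -
    have "coeff (pCons 0 (pderiv y) - smult N y) j = (if j < N then (real j - N) * coeff y j else 0)" for j
      using degree_le by (cases j; cases "j = N") (auto simp: coeff_pCons coeff_pderiv algebra_simps coeff_eq_0)
    then have "pCons 0 (pderiv y) - smult N y = (\<Sum>j<N. monom ((real j - N) * coeff y j) j)"
      by (intro poly_eqI) (simp add: coeff_sum)
    from arg_cong[OF this, of "\<lambda>p. poly p x"] show ?thesis
      by (simp add: poly_sum poly_monom)
  qed
  have int: "integrable Ipi (\<lambda>x. sin x powr (2 * \<nu>) * (poly y (cos x) * cos x ^ i))" for i
    using \<nu>_ge by (intro sin_powr_mult_integrable continuous_intros) auto
  have int2: "integrable Ipi (\<lambda>x. sin x powr (2 * \<nu>) * (poly y (cos x))\<^sup>2)"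
    using \<nu>_ge by (intro sin_powr_mult_integrable continuous_intros) auto
  have "(\<integral>x. sin x powr (2 * \<nu>) * (poly y (cos x) * (cos x * poly (pderiv y) (cos x))) \<partial>Ipi)
    = (\<integral>x. N * (sin x powr (2 * \<nu>) * (poly y (cos x))\<^sup>2)
       + (\<Sum>j<N. (real j - N) * coeff y j * (sin x powr (2 * \<nu>) * (poly y (cos x) * cos x ^ j))) \<partial>Ipi)"
    by (intro Bochner_Integration.integral_cong)
      (auto simp: * power2_eq_square sum_distrib_left algebra_simps)
  also have "\<dots> = N * moment 0 + (\<Sum>j<N. (real j - N) * coeff y j *
      (\<integral>x. sin x powr (2 * \<nu>) * (poly y (cos x) * cos x ^ j) \<partial>Ipi))"
    unfolding moment_def using int int2
    by (subst Bochner_Integration.integral_add) (auto simp: Bochner_Integration.integral_sum)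
  also have "\<dots> = N * moment 0"
    by (simp add: orthogonal_monomial)
  finally show ?thesis .
qed

text \<open>Integration of the derivative of \<open>cos x * sin x powr (2 * \<nu> - 1) * (poly y
  (cos x))\<^sup>2\<close>. The boundary values vanish because \<nu> exceeds 1/2, and the term with
  y y' is known from \<open>integral_x_deriv\<close>.\<close>

lemma moment_minus_2:
  assumes "\<nu> > 1 / 2"
  shows "(2 * \<nu> - 1) * moment (-2) = 2 * (N + \<nu>) * moment 0"
proof -
  have i1: "integrable Ipi (\<lambda>x. sin x powr (2 * \<nu>) * (poly y (cos x) * (cos x * poly (pderiv y) (cos x))))"
    using \<nu>_ge by (intro sin_powr_mult_integrable continuous_intros) auto
  have i2: "integrable Ipi (\<lambda>x. sin x powr (2 * \<nu> + 0) * (poly y (cos x))\<^sup>2)"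
    "integrable Ipi (\<lambda>x. sin x powr (2 * \<nu> + - 2) * (poly y (cos x))\<^sup>2)"
    using assms by (intro moment_integrable; simp)+
  note ii = integrable_mult_right[OF i2(2), of "2 * \<nu> - 1"]
    integrable_mult_right[OF i2(1), of "2 * \<nu>"] integrable_mult_right[OF i1, of 2]
  have "(\<integral>x. (2 * \<nu> - 1) * (sin x powr (2 * \<nu> + - 2) * (poly y (cos x))\<^sup>2)
      - 2 * \<nu> * (sin x powr (2 * \<nu> + 0) * (poly y (cos x))\<^sup>2)
      - 2 * (sin x powr (2 * \<nu>) * (poly y (cos x) * (cos x * poly (pderiv y) (cos x)))) \<partial>Ipi)
    = cos pi * sin pi powr (2 * \<nu> - 1) * (poly y (cos pi))\<^sup>2 - cos 0 * sin 0 powr (2 * \<nu> - 1) * (poly y (cos 0))\<^sup>2"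
  proof (rule Ipi_FTC)
    show "continuous_on {0..pi} (\<lambda>x. cos x * sin x powr (2 * \<nu> - 1) * (poly y (cos x))\<^sup>2)"
      using assms by (intro continuous_intros) auto
    fix x :: real assume x: "0 < x" "x < pi"
    define t where "t = sin x powr (2 * \<nu> + - 2)"
    have e: "sin x powr (2 * \<nu> - 1) = t * sin x" "sin x powr (2 * \<nu> - 1 - 1) = t"
      "sin x powr (2 * \<nu> + 0) = t * (1 - (cos x)\<^sup>2)" "sin x powr (2 * \<nu>) = t * (1 - (cos x)\<^sup>2)"
      unfolding t_def using sin_in_0_pi[OF x] powr_add[of "sin x" "2 * \<nu> - 2" 1] powr_add[of "sin x" "2 * \<nu> - 2" 2]
      by (auto simp: sin_squared_eq[symmetric])
    show "((\<lambda>x. cos x * sin x powr (2 * \<nu> - 1) * (poly y (cos x))\<^sup>2) has_real_derivative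
       (2 * \<nu> - 1) * (sin x powr (2 * \<nu> + - 2) * (poly y (cos x))\<^sup>2)
      - 2 * \<nu> * (sin x powr (2 * \<nu> + 0) * (poly y (cos x))\<^sup>2)
      - 2 * (sin x powr (2 * \<nu>) * (poly y (cos x) * (cos x * poly (pderiv y) (cos x))))) (at x)"
      by (rule has_real_derivative_sin_powr[OF x] has_real_derivative_poly_cos derivative_eq_intros refl)+
        (unfold e t_def[symmetric], use sin_cos_squared_add[of x] in \<open>simp, algebra\<close>)
  qed (intro Bochner_Integration.integrable_diff integrable_mult_right i1 i2)
  also have "\<dots> = 0" using assms by simp
  finally have "(2 * \<nu> - 1) * moment (- 2) - 2 * \<nu> * moment 0 - 2 * (N * moment 0) = 0"
    unfolding moment_def
    by (simp only: integral_x_deriv[unfolded moment_def] Bochner_Integration.integral_diff[OF Bochner_Integration.integrable_diff] ii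
        Bochner_Integration.integral_diff integral_mult_right_zero)
  then show ?thesis by (simp add: algebra_simps)
qed

end

section \<open>Pointwise bounds for small order\<close>

lemma deriv_unimodal:
  fixes f f' :: "real \<Rightarrow> real"
  assumes deriv: "\<And>z. 0 < z \<Longrightarrow> z < pi \<Longrightarrow> (f has_real_derivative f' z) (at z)"
    and "\<And>z. 0 < z \<Longrightarrow> z \<le> pi / 2 \<Longrightarrow> f' z \<le> 0" "\<And>z. pi / 2 \<le> z \<Longrightarrow> z < pi \<Longrightarrow> 0 \<le> f' z"
    and x: "0 < x" "x < pi"
  shows "f (pi / 2) \<le> f x"
proof (cases "x \<le> pi / 2")
  case True
  show ?thesis
  proof (rule DERIV_nonpos_imp_nonincreasing[OF True])
    fix z assume "x \<le> z" "z \<le> pi / 2"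
    then show "\<exists>d. (f has_real_derivative d) (at z) \<and> d \<le> 0"
      using x assms(2) pi_gt_zero by (intro exI[of _ "f' z"] conjI deriv) auto
  qed
next
  case False
  then have "pi / 2 \<le> x" by simp
  then show ?thesis
  proof (rule DERIV_nonneg_imp_nondecreasing)
    fix z assume "pi / 2 \<le> z" "z \<le> x"
    then show "\<exists>d. (f has_real_derivative d) (at z) \<and> 0 \<le> d"
      using x assms(3) pi_gt_zero by (intro exI[of _ "f' z"] conjI deriv) auto
  qed
qed

context gegenbauer_solution
begin

abbreviation "L \<equiv> real N + \<nu>"

text \<open>Liouville normal form: the factor sin^\<nu> removes the first-order term of the
  Gegenbauer equation and at the same time absorbs the weight of the integral.\<close>

definition u :: "real \<Rightarrow> real" where
  "u x = sin x powr \<nu> * poly y (cos x)"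

text \<open>This is u' as an explicit formula. It is continuous up to the poles for \<nu> > 1, but
  its first term may blow up there for smaller orders.\<close>

definition v :: "real \<Rightarrow> real" where
  "v x = \<nu> * sin x powr (\<nu> - 1) * cos x * poly y (cos x) - sin x powr (\<nu> + 1) * poly (pderiv y) (cos x)"

lemma u_squared: "(u x)\<^sup>2 = sin x powr (2 * \<nu>) * (poly y (cos x))\<^sup>2"
  by (simp add: u_def power_mult_distrib power2_eq_square powr_add[symmetric])

lemma moment_0: "moment 0 = (\<integral>x. (u x)\<^sup>2 \<partial>Ipi)"
  by (simp add: moment_def u_squared)

lemma u_squared_mult_integrable:
  assumes "continuous_on {0..pi} h"
  shows "integrable Ipi (\<lambda>x. h x * (u x)\<^sup>2)"
proof -
  have "integrable Ipi (\<lambda>x. sin x powr (2 * \<nu>) * ((poly y (cos x))\<^sup>2 * h x))"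
    using \<nu>_ge by (intro sin_powr_mult_integrable continuous_intros assms) auto
  then show ?thesis
    by (simp add: u_squared mult_ac)
qed

lemma u_deriv:
  assumes x: "0 < x" "x < pi"
  shows "(u has_real_derivative v x) (at x)"
proof -
  have e: "sin x powr (\<nu> + 1) = sin x powr \<nu> * sin x"
    using sin_in_0_pi[OF x] by (simp add: powr_add)
  show ?thesis
    unfolding u_def[abs_def] v_def
    by (rule has_real_derivative_sin_powr[OF x] has_real_derivative_poly_cos derivative_eq_intros refl)+
      (simp only: e add_diff_cancel_right', simp add: algebra_simps)
qed

lemma v_deriv:
  assumes x: "0 < x" "x < pi"
  shows "(v has_real_derivative - (L\<^sup>2 - \<nu> * (\<nu> - 1) / (sin x)\<^sup>2) * u x) (at x)"
proof -
  define t where "t = sin x powr (\<nu> - 2)"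
  have s: "sin x > 0" using sin_in_0_pi[OF x] by auto
  have pw: "sin x powr a = t * sin x ^ n" if "a = \<nu> - 2 + real n" for a n
    unfolding that t_def using s by (simp add: powr_add powr_realpow)
  have e: "sin x powr (\<nu> - 1) = t * sin x" "sin x powr (\<nu> - 1 - 1) = t"
    "sin x powr \<nu> = t * (sin x)\<^sup>2" "sin x powr (\<nu> + 1) = t * sin x ^ 3"
    "sin x powr (\<nu> + 1 - 1) = t * (sin x)\<^sup>2"
    using pw[of "\<nu> - 1" 1] pw[of "\<nu> - 1 - 1" 0] pw[of \<nu> 2] pw[of "\<nu> + 1" 3] by simp_all
  have o: "(sin x)\<^sup>2 * poly (pderiv (pderiv y)) (cos x)
      = (2 * \<nu> + 1) * cos x * poly (pderiv y) (cos x) - N * (N + 2 * \<nu>) * poly y (cos x)"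
    using ode[of "cos x"] by (simp add: sin_squared_eq)
  have c: "(cos x)\<^sup>2 = 1 - (sin x)\<^sup>2" by (simp add: cos_squared_eq)
  have q: "(L\<^sup>2 - \<nu> * (\<nu> - 1) / (sin x)\<^sup>2) * (t * (sin x)\<^sup>2 * poly y (cos x))
      = t * (L\<^sup>2 * (sin x)\<^sup>2 - \<nu> * (\<nu> - 1)) * poly y (cos x)"
    using s by (simp add: field_simps)
  show ?thesis
    unfolding u_def mult_minus_left e q
    unfolding v_def[abs_def]
    by (rule has_real_derivative_sin_powr[OF x] has_real_derivative_poly_cos derivative_eq_intros refl)+
      (unfold e t_def[symmetric], use o c in \<open>simp, algebra\<close>)
qed

text \<open>For \<nu> = 1/2, integrating the derivative of
  \<open>- cos x * (poly y (cos x))\<^sup>2\<close> expresses the two squared end values through the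
  squared norm. The maximum of y^2 is then compared with the end values.\<close>

lemma legendre_bound:
  assumes \<nu>: "\<nu> = 1 / 2" and x: "\<bar>x\<bar> \<le> 1"
  shows "(poly y x)\<^sup>2 \<le> (2 * N + 1) * moment 0"
proof -
  have ends: "(poly y 1)\<^sup>2 + (poly y (-1))\<^sup>2 = (2 * N + 1) * moment 0"
  proof -
    have i1: "integrable Ipi (\<lambda>x. sin x powr (2 * \<nu>) * (poly y (cos x) * (cos x * poly (pderiv y) (cos x))))"
      using \<nu>_ge by (intro sin_powr_mult_integrable continuous_intros) auto
    have i2: "integrable Ipi (\<lambda>x. sin x powr (2 * \<nu> + 0) * (poly y (cos x))\<^sup>2)"
      using \<nu>_ge by (intro moment_integrable) simp
    have "(\<integral>x. sin x powr (2 * \<nu> + 0) * (poly y (cos x))\<^sup>2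
        + 2 * (sin x powr (2 * \<nu>) * (poly y (cos x) * (cos x * poly (pderiv y) (cos x)))) \<partial>Ipi)
      = - cos pi * (poly y (cos pi))\<^sup>2 - - cos 0 * (poly y (cos 0))\<^sup>2"
    proof (rule Ipi_FTC)
      show "continuous_on {0..pi} (\<lambda>x. - cos x * (poly y (cos x))\<^sup>2)"
        by (intro continuous_intros)
      fix x :: real assume x: "0 < x" "x < pi"
      have e: "sin x powr (2 * \<nu> + 0) = sin x" "sin x powr (2 * \<nu>) = sin x"
        using sin_in_0_pi[OF x] by (auto simp: \<nu>)
      show "((\<lambda>x. - cos x * (poly y (cos x))\<^sup>2) has_real_derivative
         sin x powr (2 * \<nu> + 0) * (poly y (cos x))\<^sup>2
        + 2 * (sin x powr (2 * \<nu>) * (poly y (cos x) * (cos x * poly (pderiv y) (cos x))))) (at x)"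
        unfolding e
        by (rule has_real_derivative_poly_cos derivative_eq_intros refl)+ (simp add: algebra_simps)
    qed (intro Bochner_Integration.integrable_add integrable_mult_right i1 i2)
    then show ?thesis
      by (simp only: integral_x_deriv[unfolded moment_def] moment_def Bochner_Integration.integral_add
        i2 integrable_mult_right[OF i1, of 2] integral_mult_right_zero) (simp add: algebra_simps)
  qed
  have "(poly y x)\<^sup>2 \<le> (poly y 1)\<^sup>2 + (poly y (-1))\<^sup>2"
  proof (cases "N = 0")
    case True
    then obtain c where "y = [:c:]" using degree_le by (auto elim: degree_eq_zeroE)
    then show ?thesis by simp
  next
    case False
    define c where "c = 1 / (real N * (real N + 1))"
    have c: "c > 0" "real N * (real N + 1) * c = 1" using False by (auto simp: c_def)
    \<comment> \<open>Sonin's function for Legendre's equation. The constant \<open>c\<close>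
      cancels the terms in y y', so that \<open>F\<close> grows away from 0 in both directions; at
      -1 and 1 it equals y^2. As \<open>c\<close> is a reciprocal of N(N + 1), degree 0 is treated
      apart.\<close>
    define F where "F x = (poly y x)\<^sup>2 + (1 - x\<^sup>2) * (poly (pderiv y) x)\<^sup>2 * c" for x
    have dF: "(F has_real_derivative 2 * x * (poly (pderiv y) x)\<^sup>2 * c) (at x)" for x
      unfolding F_def[abs_def]
      by (rule poly_DERIV derivative_eq_intros refl)+
        (use ode[of x] c(2) in \<open>simp add: \<nu>, algebra\<close>)
    have "(poly y x)\<^sup>2 \<le> F x"
      using x abs_square_le_1[of x] c by (simp add: F_def)
    also have "F x \<le> F 1 + F (-1)"
    proof (cases "x \<ge> 0")
      case True
      have "F x \<le> F 1"
      proof (rule DERIV_nonneg_imp_nondecreasing[of x 1 F])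
        show "x \<le> 1" using x by auto
        fix z assume "x \<le> z"
        then show "\<exists>d. (F has_real_derivative d) (at z) \<and> 0 \<le> d" using True
          by (intro exI[of _ "2 * z * (poly (pderiv y) z)\<^sup>2 * c"] conjI dF) (use c in auto)
      qed
      moreover have "F (-1) \<ge> 0" using c by (simp add: F_def)
      ultimately show ?thesis by simp
    next
      case x0: False
      have "F x \<le> F (-1)"
      proof (rule DERIV_nonpos_imp_nonincreasing[of "-1" x F])
        show "-1 \<le> x" using x by auto
        fix z assume "z \<le> x"
        then show "\<exists>d. (F has_real_derivative d) (at z) \<and> d \<le> 0" using x0
          by (intro exI[of _ "2 * z * (poly (pderiv y) z)\<^sup>2 * c"] conjI dF)
            (use c in \<open>auto simp: mult_nonpos_nonneg\<close>)
      qed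
      moreover have "F 1 \<ge> 0" by (simp add: F_def)
      ultimately show ?thesis by simp
    qed
    also have "\<dots> = (poly y 1)\<^sup>2 + (poly y (-1))\<^sup>2" by (simp add: F_def)
    finally show ?thesis .
  qed
  with ends show ?thesis by simp
qed

lemma integral_sin_squared: "(\<integral>x. (sin x)\<^sup>2 \<partial>Ipi) = pi / 2"
proof -
  have "(\<integral>x. (sin x)\<^sup>2 \<partial>Ipi) = (pi - sin pi * cos pi) / 2 - (0 - sin 0 * cos 0) / 2"
  proof (rule Ipi_FTC)
    show "continuous_on {0..pi} (\<lambda>x. (x - sin x * cos x) / 2)"
      by (intro continuous_intros) auto
    show "integrable Ipi (\<lambda>x. (sin x)\<^sup>2)"
      by (intro Ipi_integrable_continuous continuous_intros)
    show "((\<lambda>x. (x - sin x * cos x) / 2) has_real_derivative (sin x)\<^sup>2) (at x)" for x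
      by (auto intro!: derivative_eq_intros simp: power2_eq_square) (use sin_cos_squared_add[of x] in algebra)
  qed
  then show ?thesis by simp
qed

text \<open>Sonin's argument: \<open>u'\<^sup>2 + Qu\<^sup>2\<close> is minimal and \<open>u\<^sup>2 + u'\<^sup>2/Q\<close> is maximal
  at \<open>\<pi>/2\<close>, because \<open>Q\<close> decreases up to there and increases afterwards.\<close>

lemma u_squared_le:
  assumes \<nu>: "\<nu> \<le> 1" and x: "0 < x" "x < pi"
  shows "(u x)\<^sup>2 \<le> 6 * moment 0"
proof -
  define \<kappa> where "\<kappa> = \<nu> * (1 - \<nu>)"
  define Q where "Q x = L\<^sup>2 + \<kappa> / (sin x)\<^sup>2" for x
  define Q' where "Q' x = - 2 * \<kappa> * cos x / sin x ^ 3" for x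
  have \<kappa>: "0 \<le> \<kappa>" "\<kappa> \<le> 1 / 4"
    using \<nu> \<nu>_ge sum_squares_ge_zero[of "\<nu> - 1/2" 0] by (auto simp: \<kappa>_def algebra_simps)
  have L: "L\<^sup>2 \<ge> 1 / 4"
    using \<nu>_ge power_mono[of "1/2" L 2] by (simp add: power2_eq_square)
  have Qpos: "Q x > 0" for x
  proof -
    have "\<kappa> / (sin x)\<^sup>2 \<ge> 0" using \<kappa> by simp
    then show ?thesis using L unfolding Q_def by linarith
  qed
  have dv: "(v has_real_derivative - Q x * u x) (at x)" if "0 < x" "x < pi" for x
    using v_deriv[OF that] by (simp add: Q_def \<kappa>_def algebra_simps diff_divide_distrib)
  have dQ: "(Q has_real_derivative Q' x) (at x)" if "0 < x" "x < pi" for x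
  proof -
    have "sin x > 0" using sin_in_0_pi[OF that] by auto
    then show ?thesis
      unfolding Q_def[abs_def] Q'_def
      by (auto intro!: derivative_eq_intros simp: field_simps power2_eq_square power3_eq_cube)
  qed
  define E1 where "E1 x = (v x)\<^sup>2 + Q x * (u x)\<^sup>2" for x
  define E2 where "E2 x = (u x)\<^sup>2 + (v x)\<^sup>2 / Q x" for x
  have dE1: "(E1 has_real_derivative Q' x * (u x)\<^sup>2) (at x)" if "0 < x" "x < pi" for x
    unfolding E1_def[abs_def]
    by (rule derivative_eq_intros dv[OF that] dQ[OF that] u_deriv[OF that] refl)+
      (simp add: power2_eq_square algebra_simps)
  have dE2: "(E2 has_real_derivative - Q' x * (v x)\<^sup>2 / (Q x)\<^sup>2) (at x)" if "0 < x" "x < pi" for x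
    unfolding E2_def[abs_def] using Qpos[of x]
    by (auto intro!: derivative_eq_intros dv[OF that] dQ[OF that] u_deriv[OF that])
      (simp add: field_simps power2_eq_square)
  have Q'_neg: "Q' x \<le> 0" if "0 < x" "x \<le> pi / 2" for x
  proof -
    have "sin x > 0" "cos x \<ge> 0" using that by (auto intro: sin_gt_zero cos_ge_zero)
    then show ?thesis using \<kappa> by (auto simp: Q'_def intro!: divide_nonpos_pos)
  qed
  have Q'_pos: "Q' x \<ge> 0" if "pi / 2 \<le> x" "x < pi" for x
  proof -
    have "sin x > 0" using that pi_gt_zero by (intro sin_gt_zero) linarith+
    moreover have "cos x \<le> 0" using cos_ge_zero[of "pi - x"] that by simp
    ultimately show ?thesis using \<kappa> by (auto simp: Q'_def intro!: divide_nonpos_pos mult_nonneg_nonpos)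
  qed
  have E1_ge: "E1 (pi / 2) \<le> E1 x" if "0 < x" "x < pi" for x
    using that Q'_neg Q'_pos by (intro deriv_unimodal[OF dE1]) (auto simp: mult_nonpos_nonneg)
  have E2_le: "E2 x \<le> E2 (pi / 2)" if "0 < x" "x < pi" for x
  proof -
    have "- E2 (pi / 2) \<le> - E2 x"
      using that Q'_neg Q'_pos
      by (intro deriv_unimodal[OF DERIV_minus[OF dE2]]) (auto simp: mult_nonpos_nonneg divide_nonpos_nonneg)
    then show ?thesis by simp
  qed
  \<comment> \<open>\<open>G\<close> is sin^2 u u' - sin cos u^2; the second term cancels the mixed
    terms in u u' of the derivative. Merging the powers of the sine gives a form that is continuous
    at the poles, where \<open>v\<close> alone need not be. Integrating G' turns the lower bound on
    \<open>E1\<close> into a bound of \<open>E1 (pi / 2)\<close> by the squared norm.\<close>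
  define G where "G x = sin x powr (2 * \<nu> + 1) * (\<nu> * cos x * (poly y (cos x))\<^sup>2)
      - sin x powr (2 * \<nu> + 3) * (poly y (cos x) * poly (pderiv y) (cos x))
      - sin x powr (2 * \<nu> + 1) * (cos x * (poly y (cos x))\<^sup>2)" for x
  have G: "G x = (sin x)\<^sup>2 * u x * v x - sin x * cos x * (u x)\<^sup>2" if "x \<in> {0<..<pi}" for x
  proof -
    define t where "t = sin x powr (2 * \<nu>)"
    have s: "sin x > 0" using sin_in_0_pi that by auto
    have e: "sin x powr (2 * \<nu> + 1) = t * sin x" "sin x powr (2 * \<nu> + 3) = t * sin x ^ 3"
      "sin x powr \<nu> * sin x powr (\<nu> - 1) * sin x = t" "sin x powr \<nu> * sin x powr (\<nu> + 1) = t * sin x"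
      "(sin x powr \<nu>)\<^sup>2 = t"
      unfolding t_def using s by (auto simp: powr_add[symmetric] powr_add powr_diff power3_eq_cube power2_eq_square)
    show ?thesis
    proof -
      define a b c Y Y' where "a = sin x powr \<nu>" "b = sin x powr (\<nu> - 1)" "c = sin x powr (\<nu> + 1)"
        "Y = poly y (cos x)" "Y' = poly (pderiv y) (cos x)"
      have abc: "a * b * sin x = t" "a * c = t * sin x" "a\<^sup>2 = t"
        using e(3-5) by (simp_all add: a_b_c_Y_Y'_def)
      have "(sin x)\<^sup>2 * (a * Y) * (\<nu> * b * cos x * Y - c * Y') - sin x * cos x * (a * Y)\<^sup>2
        = sin x * (a * b * sin x) * \<nu> * cos x * Y\<^sup>2 - (sin x)\<^sup>2 * (a * c) * Y * Y' - sin x * cos x * a\<^sup>2 * Y\<^sup>2"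
        by (simp add: algebra_simps power2_eq_square)
      also have "\<dots> = t * sin x * (\<nu> * cos x * Y\<^sup>2) - t * sin x ^ 3 * (Y * Y') - t * sin x * (cos x * Y\<^sup>2)"
        unfolding abc by (simp add: algebra_simps power2_eq_square power3_eq_cube)
      finally show ?thesis
        unfolding G_def v_def u_def e(1,2) a_b_c_Y_Y'_def by simp
    qed
  qed
  have dG: "(G has_real_derivative
      (sin x)\<^sup>2 * E1 x - (2 * (sin x)\<^sup>2 * Q x + 1 - 2 * (sin x)\<^sup>2) * (u x)\<^sup>2) (at x)"
    if x: "0 < x" "x < pi" for x
  proof (rule has_field_derivative_transform_within_open)
    show "open {0<..<pi}" "x \<in> {0<..<pi}" using x by auto
    show "\<And>z. z \<in> {0<..<pi} \<Longrightarrow> (sin z)\<^sup>2 * u z * v z - sin z * cos z * (u z)\<^sup>2 = G z"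
      using G by simp
    have "((\<lambda>z. (sin z)\<^sup>2 * u z * v z - sin z * cos z * (u z)\<^sup>2) has_real_derivative
      (sin x)\<^sup>2 * (v x)\<^sup>2 - (sin x)\<^sup>2 * Q x * (u x)\<^sup>2 - ((cos x)\<^sup>2 - (sin x)\<^sup>2) * (u x)\<^sup>2) (at x)"
      by (rule derivative_eq_intros dv[OF x] u_deriv[OF x] refl)+
        (simp add: algebra_simps power2_eq_square)
    then show "((\<lambda>z. (sin z)\<^sup>2 * u z * v z - sin z * cos z * (u z)\<^sup>2) has_real_derivative
      (sin x)\<^sup>2 * E1 x - (2 * (sin x)\<^sup>2 * Q x + 1 - 2 * (sin x)\<^sup>2) * (u x)\<^sup>2) (at x)"
      by (rule DERIV_cong) (unfold E1_def cos_squared_eq, simp add: algebra_simps)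
  qed
  have s2: "integrable Ipi (\<lambda>x. (sin x)\<^sup>2)"
    by (intro Ipi_integrable_continuous continuous_intros)
  have iu: "integrable Ipi (\<lambda>x. (u x)\<^sup>2)"
    using u_squared_mult_integrable[of "\<lambda>_. 1"] by simp
  have "(\<integral>x. E1 (pi / 2) * (sin x)\<^sup>2 - (2 * L\<^sup>2 + 3 / 2) * (u x)\<^sup>2 \<partial>Ipi) \<le> G pi - G 0"
  proof (rule Ipi_FTC_le[where G = G])
    show "continuous_on {0..pi} G"
      unfolding G_def[abs_def] using \<nu>_ge
      by (intro continuous_on_diff continuous_on_mult continuous_on_sin_powr continuous_on_power
        continuous_on_const continuous_on_cos continuous_on_id continuous_on_poly_cos) auto
    show "integrable Ipi (\<lambda>x. E1 (pi / 2) * (sin x)\<^sup>2 - (2 * L\<^sup>2 + 3 / 2) * (u x)\<^sup>2)"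
      by (intro Bochner_Integration.integrable_diff integrable_mult_right s2 iu)
    fix x :: real assume x: "0 < x" "x < pi"
    show "(G has_real_derivative
      (sin x)\<^sup>2 * E1 x - (2 * (sin x)\<^sup>2 * Q x + 1 - 2 * (sin x)\<^sup>2) * (u x)\<^sup>2) (at x)"
      by (rule dG[OF x])
    have s: "0 < sin x" "sin x \<le> 1" using sin_in_0_pi[OF x] by auto
    \<comment> \<open>The constant 3/2 is 1 + 2\<kappa> with \<kappa> at most 1/4.\<close>
    have "2 * (sin x)\<^sup>2 * Q x = 2 * ((sin x)\<^sup>2 * L\<^sup>2) + 2 * \<kappa>"
      using s by (simp add: Q_def field_simps)
    moreover have "(sin x)\<^sup>2 * L\<^sup>2 \<le> 1 * L\<^sup>2"
      using s by (intro mult_right_mono power_le_one) auto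
    moreover have "0 \<le> (sin x)\<^sup>2" by simp
    ultimately have "2 * (sin x)\<^sup>2 * Q x + 1 - 2 * (sin x)\<^sup>2 \<le> 2 * L\<^sup>2 + 3 / 2"
      using \<kappa> by linarith
    then have "(2 * (sin x)\<^sup>2 * Q x + 1 - 2 * (sin x)\<^sup>2) * (u x)\<^sup>2 \<le> (2 * L\<^sup>2 + 3 / 2) * (u x)\<^sup>2"
      by (intro mult_right_mono) auto
    moreover have "E1 (pi / 2) * (sin x)\<^sup>2 \<le> (sin x)\<^sup>2 * E1 x"
      using mult_right_mono[OF E1_ge[OF x], of "(sin x)\<^sup>2"] by (simp add: mult.commute)
    ultimately show "E1 (pi / 2) * (sin x)\<^sup>2 - (2 * L\<^sup>2 + 3 / 2) * (u x)\<^sup>2 \<le>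
      (sin x)\<^sup>2 * E1 x - (2 * (sin x)\<^sup>2 * Q x + 1 - 2 * (sin x)\<^sup>2) * (u x)\<^sup>2"
      by linarith
  qed
  also have "G pi - G 0 = 0" using \<nu>_ge by (simp add: G_def)
  finally have *: "E1 (pi / 2) * (pi / 2) \<le> (2 * L\<^sup>2 + 3 / 2) * moment 0"
    using s2 iu by (simp add: moment_0 integral_sin_squared)
  have "(u x)\<^sup>2 \<le> E2 x" using Qpos[of x] by (simp add: E2_def)
  also have "\<dots> \<le> E2 (pi / 2)" by (rule E2_le[OF x])
  also have "\<dots> = E1 (pi / 2) / Q (pi / 2)"
    using Qpos[of "pi / 2"] by (simp add: E1_def E2_def field_simps)
  also have "\<dots> \<le> E1 (pi / 2) / L\<^sup>2"
    using \<kappa> L by (intro divide_left_mono mult_pos_pos) (auto simp: Q_def E1_def)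
  also have "\<dots> \<le> 6 * moment 0"
  proof -
    have E1: "0 \<le> E1 (pi / 2)" using Qpos[of "pi / 2"] by (simp add: E1_def)
    \<comment> \<open>As \<open>L\<^sup>2\<close> is at least 1/4, 3/2 is at most
      \<open>6 * L\<^sup>2\<close>. With pi > 3 the constant becomes 8 / (3/2) = 16/3, rounded up to
      6.\<close>
    have "E1 (pi / 2) * (3 / 2) \<le> E1 (pi / 2) * (pi / 2)"
      using E1 pi_gt3 by (intro mult_left_mono) auto
    also note *
    also have "(2 * L\<^sup>2 + 3 / 2) * moment 0 \<le> (8 * L\<^sup>2) * moment 0"
      using L moment_nonneg by (intro mult_right_mono) auto
    finally have "E1 (pi / 2) * (3 / 2) \<le> 8 * (moment 0 * L\<^sup>2)"
      by (simp add: mult_ac)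
    moreover have "0 \<le> moment 0 * L\<^sup>2"
      using moment_nonneg by simp
    ultimately have "E1 (pi / 2) \<le> 6 * moment 0 * L\<^sup>2"
      by linarith
    then show ?thesis using L moment_nonneg by (simp add: divide_le_eq)
  qed
  finally show ?thesis .
qed

end

section \<open>The multiplier bound for large order\<close>

text \<open>The primitive of \<open>(s + e) powr (- 2 * b)\<close> that vanishes at 0. For b = 1/2
  it would be a logarithm.\<close>

definition profile :: "real \<Rightarrow> real \<Rightarrow> real \<Rightarrow> real" where
  "profile b e s = ((s + e) powr (1 - 2 * b) - e powr (1 - 2 * b)) / (1 - 2 * b)"

text \<open>A bound for \<open>profile\<close> on [0,1], valid for e at most 1. For b > 1/2 and e =
  1/(L + 1) it is of order (L + 1)^(2b - 1).\<close>

definition profile_bound :: "real \<Rightarrow> real \<Rightarrow> real" where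
  "profile_bound b e = 2 / \<bar>1 - 2 * b\<bar> * (if b < 1 / 2 then 1 else e powr (1 - 2 * b))"

lemma powr_deriv_add:
  fixes e s p :: real
  assumes "e > 0" "s \<ge> 0"
  shows "((\<lambda>s. (s + e) powr p) has_real_derivative p * (s + e) powr (p - 1)) (at s)"
  using assms by (auto intro!: derivative_eq_intros simp: powr_diff)

lemma profile_deriv:
  assumes "b \<noteq> 1 / 2" "e > 0" "s \<ge> 0"
  shows "(profile b e has_real_derivative (s + e) powr (- 2 * b)) (at s)"
proof -
  have "((\<lambda>s. ((s + e) powr (1 - 2 * b) - e powr (1 - 2 * b)) / (1 - 2 * b)) has_real_derivative
      ((1 - 2 * b) * (s + e) powr (1 - 2 * b - 1) - 0) / (1 - 2 * b)) (at s)"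
    by (intro DERIV_cdivide DERIV_diff powr_deriv_add DERIV_const assms)
  then show ?thesis
    using assms by (simp add: profile_def[abs_def])
qed

lemma profile_0 [simp]: "profile b e 0 = 0"
  by (simp add: profile_def)

text \<open>A concave function vanishing at 0 satisfies s h'(s) <= h(s). This inequality gives the
  potential term in \<open>multiplier_bound\<close> its sign.\<close>

lemma profile_concave:
  assumes "b \<noteq> 1 / 2" "b \<ge> 0" "e > 0" "s \<ge> 0"
  shows "s * (s + e) powr (- 2 * b) \<le> profile b e s"
proof (cases "s = 0")
  case False
  then have "0 < s" using assms by simp
  then obtain z where z: "0 < z" "z < s" and
    eq: "profile b e s - profile b e 0 = (s - 0) * (z + e) powr (- 2 * b)"
    using MVT2[of 0 s "profile b e" "\<lambda>z. (z + e) powr (- 2 * b)"] profile_deriv assms by blast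
  have "(s + e) powr (- 2 * b) \<le> (z + e) powr (- 2 * b)"
    using z assms by (intro powr_mono2') auto
  then show ?thesis using eq \<open>0 < s\<close> by (simp add: mult_left_mono)
qed simp

lemma profile_le_bound:
  assumes "b \<noteq> 1 / 2" "0 \<le> b" "0 < e" "e \<le> 1" "0 \<le> s" "s \<le> 1"
  shows "profile b e s \<le> profile_bound b e"
proof (cases "b < 1 / 2")
  case True
  have "(s + e) powr (1 - 2 * b) \<le> 2 powr (1 - 2 * b)"
    using assms True by (intro powr_mono2) auto
  then have "(s + e) powr (1 - 2 * b) - e powr (1 - 2 * b) \<le> 2 powr (1 - 2 * b)"
    using powr_ge_zero[of e "1 - 2 * b"] by linarith
  also have "\<dots> \<le> 2 powr 1"
    using assms by (intro powr_mono) auto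
  finally show ?thesis
    using True by (simp add: profile_def profile_bound_def divide_right_mono)
next
  case False
  have "e powr (1 - 2 * b) - (s + e) powr (1 - 2 * b) \<le> 2 * e powr (1 - 2 * b)"
    using powr_ge_zero[of "s + e" "1 - 2 * b"] powr_ge_zero[of e "1 - 2 * b"] by linarith
  then have "(e powr (1 - 2 * b) - (s + e) powr (1 - 2 * b)) / (2 * b - 1) \<le> 2 * e powr (1 - 2 * b) / (2 * b - 1)"
    using False by (intro divide_right_mono) auto
  moreover have "profile b e s = (e powr (1 - 2 * b) - (s + e) powr (1 - 2 * b)) / (2 * b - 1)"
    unfolding profile_def by (metis minus_diff_eq minus_divide_divide)
  ultimately show ?thesis
    using False assms by (simp add: profile_bound_def)
qed

text \<open>The factor 2/|1 - 2b| in \<open>profile_bound\<close> is at least 2 on the range of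
  \<open>b\<close>. Both inequalities serve to absorb lower-order terms into
  \<open>profile_bound\<close>.\<close>

lemma powr_le_profile_bound:
  assumes "b \<noteq> 1 / 2" "0 \<le> b" "b < 1" "0 < e" "e \<le> 1"
  shows "e powr (1 - 2 * b) \<le> profile_bound b e" "1 \<le> profile_bound b e"
proof -
  have c: "1 \<le> 2 / \<bar>1 - 2 * b\<bar>"
    using assms by (simp add: le_divide_eq)
  show "e powr (1 - 2 * b) \<le> profile_bound b e"
  proof (cases "b < 1 / 2")
    case True
    then have "e powr (1 - 2 * b) \<le> 1" using assms by (intro powr_le1) auto
    with c have "e powr (1 - 2 * b) \<le> 2 / \<bar>1 - 2 * b\<bar>" by linarith
    then show ?thesis using True by (simp add: profile_bound_def)
  next
    case False
    then show ?thesis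
      using mult_right_mono[OF c, of "e powr (1 - 2 * b)"] by (simp add: profile_bound_def)
  qed
  show "1 \<le> profile_bound b e"
  proof (cases "b < 1 / 2")
    case True
    then show ?thesis using c by (simp add: profile_bound_def)
  next
    case False
    then have "1 \<le> e powr (1 - 2 * b)"
      using assms powr_mono2'[of "1 - 2 * b" e 1] by auto
    then have "1 * 1 \<le> 2 / \<bar>1 - 2 * b\<bar> * e powr (1 - 2 * b)"
      using c by (intro mult_mono) auto
    then show ?thesis using False by (simp add: profile_bound_def)
  qed
qed

lemma continuous_on_add_powr:
  fixes e :: real
  assumes "e > 0"
  shows "continuous_on {0..pi} (\<lambda>x. (sin x + e) powr p)"
proof (intro continuous_on_powr' continuous_intros ballI)
  fix x :: real assume "x \<in> {0..pi}"
  then have "sin x \<ge> 0" by (auto intro: sin_ge_zero)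
  then show "0 \<le> sin x + e \<and> (sin x + e = 0 \<longrightarrow> 0 < p)" using assms by auto
qed

lemma continuous_on_profile:
  assumes "e > 0"
  shows "continuous_on {0..pi} (\<lambda>x. profile b e (sin x))"
  unfolding profile_def divide_inverse
  by (intro continuous_on_mult continuous_on_diff continuous_on_add_powr continuous_on_const assms)

text \<open>For an increasing function \<open>h\<close> of \<open>sin x\<close>, the total derivative of \<open>cos x h(sin x)\<close>
  trades a bound on \<open>h\<close> for one on the integral of \<open>h'\<close>.\<close>

lemma integral_cos_squared_deriv:
  fixes h h' :: "real \<Rightarrow> real"
  assumes "continuous_on {0..1} h" "h 0 = 0"
    and deriv: "\<And>s. 0 < s \<Longrightarrow> s \<le> 1 \<Longrightarrow> (h has_real_derivative h' s) (at s)"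
    and bound: "\<And>s. 0 \<le> s \<Longrightarrow> s \<le> 1 \<Longrightarrow> h s \<le> B" and B: "B \<ge> 0"
    and int: "integrable Ipi (\<lambda>x. (cos x)\<^sup>2 * h' (sin x))"
  shows "(\<integral>x. (cos x)\<^sup>2 * h' (sin x) \<partial>Ipi) \<le> pi * B"
proof -
  have ch: "continuous_on {0..pi} (\<lambda>x. h (sin x))"
    by (rule continuous_on_compose2[OF assms(1)]) (auto intro!: continuous_intros simp: sin_ge_zero)
  have one: "integrable Ipi (\<lambda>x. B)"
    by (intro Ipi_integrable_continuous continuous_intros)
  have "(\<integral>x. (cos x)\<^sup>2 * h' (sin x) - B \<partial>Ipi) \<le> cos pi * h (sin pi) - cos 0 * h (sin 0)"
  proof (rule Ipi_FTC_le[where G = "\<lambda>x. cos x * h (sin x)"])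
    show "continuous_on {0..pi} (\<lambda>x. cos x * h (sin x))"
      by (intro continuous_on_mult ch continuous_intros)
    show "integrable Ipi (\<lambda>x. (cos x)\<^sup>2 * h' (sin x) - B)"
      by (intro Bochner_Integration.integrable_diff int one)
    fix x :: real assume x: "0 < x" "x < pi"
    have s: "0 < sin x" "sin x \<le> 1" using sin_in_0_pi[OF x] by auto
    have "((\<lambda>x. h (sin x)) has_real_derivative h' (sin x) * cos x) (at x)"
      by (rule DERIV_chain2[where f = h and g = sin, OF deriv[OF s]]) (auto intro!: derivative_eq_intros)
    then show "((\<lambda>x. cos x * h (sin x)) has_real_derivative
        (cos x)\<^sup>2 * h' (sin x) - sin x * h (sin x)) (at x)"
      by (auto intro!: derivative_eq_intros simp: power2_eq_square)
    have "sin x * h (sin x) \<le> sin x * B" using s bound by (intro mult_left_mono) auto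
    also have "\<dots> \<le> 1 * B" using s B by (intro mult_right_mono) auto
    finally show "(cos x)\<^sup>2 * h' (sin x) - B \<le> (cos x)\<^sup>2 * h' (sin x) - sin x * h (sin x)" by simp
  qed
  also have "\<dots> = 0" using assms(2) by simp
  finally show ?thesis
    using int one by (simp add: measure_restrict_space)
qed

context gegenbauer_solution
begin

text \<open>The multiplier identity: \<open>B' = (2f'Q + fQ' + f'''/2)u\<^sup>2\<close> for \<open>B = fu'\<^sup>2 + fQu\<^sup>2 - f'uu' + f''u\<^sup>2/2\<close>
  whenever \<open>u'' + Qu = 0\<close>, used with \<open>f = cos x h(sin x)\<close> for the concave profile \<open>h\<close>.\<close>

lemma multiplier_bound:
  assumes \<nu>: "\<nu> > 1" and b: "b \<noteq> 1 / 2" "0 \<le> b" and e: "0 < e" "e \<le> 1"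
  shows "(L\<^sup>2 - 1) * (\<integral>x. (cos x)\<^sup>2 * (sin x + e) powr (- 2 * b) * (u x)\<^sup>2 \<partial>Ipi)
    \<le> L\<^sup>2 * profile_bound b e * moment 0"
proof -
  \<comment> \<open>\<open>h1\<close>, \<open>h2\<close>, \<open>h3\<close> are the derivatives of
    the profile with respect to its argument, taken at sin x, whereas \<open>f1\<close>,
    \<open>f2\<close>, \<open>f3\<close> are the derivatives of \<open>f\<close> in x.\<close>
  define h where "h x = profile b e (sin x)" for x
  define h1 where "h1 x = (sin x + e) powr (- 2 * b)" for x
  define h2 where "h2 x = - 2 * b * (sin x + e) powr (- 2 * b - 1)" for x
  define h3 where "h3 x = - 2 * b * ((- 2 * b - 1) * (sin x + e) powr (- 2 * b - 1 - 1))" for x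
  define f where "f x = cos x * h x" for x
  define f1 where "f1 x = - sin x * h x + (cos x)\<^sup>2 * h1 x" for x
  define f2 where "f2 x = cos x * (- h x - 3 * sin x * h1 x + (cos x)\<^sup>2 * h2 x)" for x
  define f3 where "f3 x = sin x * h x + 3 * (sin x)\<^sup>2 * h1 x - sin x * (cos x)\<^sup>2 * h2 x
    + (cos x)\<^sup>2 * (- 4 * h1 x - 5 * sin x * h2 x + (cos x)\<^sup>2 * h3 x)" for x
  define m where "m = \<nu> * (\<nu> - 1)"
  define Q where "Q x = L\<^sup>2 - m / (sin x)\<^sup>2" for x
  define Q' where "Q' x = 2 * m * cos x / sin x ^ 3" for x
  have m: "m \<ge> 0" using \<nu> by (simp add: m_def)
  have L: "L\<^sup>2 \<ge> 1" using \<nu> power_mono[of 1 L 2] by simp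
  have cont: "continuous_on {0..pi} h" "continuous_on {0..pi} h1" "continuous_on {0..pi} h2"
    unfolding h_def[abs_def] h1_def[abs_def] h2_def[abs_def]
    by (intro continuous_on_profile continuous_on_mult continuous_on_add_powr continuous_on_const e)+
  \<comment> \<open>The singular part of f Q u^2 is written with the single power
    \<open>sin x powr (2 * \<nu> - 2)\<close>, which is continuous at the poles because \<nu> >
    1.\<close>
  define B where "B x = f x * (v x)\<^sup>2 + L\<^sup>2 * f x * (u x)\<^sup>2 - m * f x * sin x powr (2 * \<nu> - 2) * (poly y (cos x))\<^sup>2
    - f1 x * u x * v x + f2 x * (u x)\<^sup>2 / 2" for x
  define B' where "B' x = (2 * f1 x * Q x + f x * Q' x + f3 x / 2) * (u x)\<^sup>2" for x
  have contuv: "continuous_on {0..pi} u" "continuous_on {0..pi} v"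
    unfolding u_def[abs_def] v_def[abs_def] using \<nu>
    by (intro continuous_on_diff continuous_on_mult continuous_on_sin_powr
        continuous_on_const continuous_on_cos continuous_on_id continuous_on_poly_cos; simp)+
  have contB: "continuous_on {0..pi} B"
    unfolding B_def[abs_def] f_def f1_def f2_def divide_inverse using \<nu>
    by (intro continuous_on_diff continuous_on_add continuous_on_mult continuous_on_sin_powr continuous_on_power
        continuous_on_const continuous_on_cos continuous_on_sin continuous_on_id continuous_on_poly_cos
        continuous_on_minus contuv cont) auto
  have dB: "(B has_real_derivative B' x) (at x)" if x: "0 < x" "x < pi" for x
  proof (rule has_field_derivative_transform_within_open)
    let ?B = "\<lambda>x. f x * (v x)\<^sup>2 + f x * Q x * (u x)\<^sup>2 - f1 x * u x * v x + f2 x * (u x)\<^sup>2 / 2"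
    show "open {0<..<pi}" "x \<in> {0<..<pi}" using x by auto
    show "?B z = B z" if "z \<in> {0<..<pi}" for z
    proof -
      have s: "sin z > 0" using sin_in_0_pi that by auto
      have "(u z)\<^sup>2 / (sin z)\<^sup>2 = sin z powr (2 * \<nu> - 2) * (poly y (cos z))\<^sup>2"
        using s by (simp add: u_squared powr_diff)
      moreover have "f z * Q z * (u z)\<^sup>2 = L\<^sup>2 * f z * (u z)\<^sup>2 - m * f z * ((u z)\<^sup>2 / (sin z)\<^sup>2)"
        by (simp add: Q_def algebra_simps)
      ultimately show ?thesis by (simp add: B_def)
    qed
    have s: "0 < sin x" "sin x \<le> 1" using sin_in_0_pi[OF x] by auto
    have dsin: "(sin has_real_derivative cos x) (at x)" by (auto intro!: derivative_eq_intros)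
    have dh: "(h has_real_derivative h1 x * cos x) (at x)"
      unfolding h_def[abs_def] h1_def using s e
      by (intro DERIV_chain2[OF profile_deriv dsin] b) auto
    have dh1: "(h1 has_real_derivative h2 x * cos x) (at x)"
      unfolding h1_def[abs_def] h2_def using s e
      by (intro DERIV_chain2[OF powr_deriv_add dsin]) auto
    have dh2: "(h2 has_real_derivative h3 x * cos x) (at x)"
      unfolding h2_def[abs_def] h3_def mult.assoc[of "- 2 * b"] using s e
      by (intro DERIV_cmult DERIV_chain2[OF powr_deriv_add dsin]) auto
    have c2: "cos x * cos x = 1 - sin x * sin x"
      using sin_cos_squared_add[of x] by (simp add: power2_eq_square)
    have df: "(f has_real_derivative f1 x) (at x)"
      unfolding f_def[abs_def] f1_def
      by (rule derivative_eq_intros dh refl)+ (simp add: power2_eq_square)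
    have df1: "(f1 has_real_derivative f2 x) (at x)"
      unfolding f1_def[abs_def] f2_def
      by (rule derivative_eq_intros dh dh1 refl)+ (simp add: power2_eq_square algebra_simps)
    have df2: "(f2 has_real_derivative f3 x) (at x)"
      unfolding f2_def[abs_def] f3_def
      by (rule derivative_eq_intros dh dh1 dh2 refl)+ (simp add: power2_eq_square algebra_simps)
    have dQ: "(Q has_real_derivative Q' x) (at x)"
      unfolding Q_def[abs_def] Q'_def using s
      by (auto intro!: derivative_eq_intros simp: field_simps power2_eq_square power3_eq_cube)
    have dv: "(v has_real_derivative - Q x * u x) (at x)"
      using v_deriv[OF x] by (simp add: Q_def m_def)
    show "(?B has_real_derivative B' x) (at x)"
      unfolding B'_def
      by (rule derivative_eq_intros df df1 df2 dQ dv u_deriv[OF x] refl | simp)+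
        (simp add: power2_eq_square algebra_simps)
  qed
  let ?g = "\<lambda>x. 2 * (L\<^sup>2 - 1) * ((cos x)\<^sup>2 * h1 x * (u x)\<^sup>2) - 2 * L\<^sup>2 * profile_bound b e * (u x)\<^sup>2"
  have i1: "integrable Ipi (\<lambda>x. (cos x)\<^sup>2 * h1 x * (u x)\<^sup>2)"
    by (intro u_squared_mult_integrable continuous_on_mult cont continuous_intros)
  have i2: "integrable Ipi (\<lambda>x. (u x)\<^sup>2)"
    using u_squared_mult_integrable[of "\<lambda>_. 1"] by simp
  have "(\<integral>x. ?g x \<partial>Ipi) \<le> B pi - B 0"
  proof (rule Ipi_FTC_le[where G = B and g = B'])
    show "continuous_on {0..pi} B" by (rule contB)
    show "integrable Ipi ?g"
      by (intro Bochner_Integration.integrable_diff integrable_mult_right i1 i2)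
    fix x :: real assume x: "0 < x" "x < pi"
    show "(B has_real_derivative B' x) (at x)" by (rule dB[OF x])
    have s: "0 < sin x" "sin x \<le> 1" using sin_in_0_pi[OF x] by auto
    have h: "sin x * h1 x \<le> h x" "h x \<le> profile_bound b e"
      unfolding h_def h1_def using s e b
      by (intro profile_concave profile_le_bound; simp)+
    have hs: "0 \<le> h1 x" "h2 x \<le> 0" "0 \<le> h3 x"
    proof -
      have "h3 x = 2 * b * ((2 * b + 1) * (sin x + e) powr (- 2 * b - 1 - 1))"
        by (simp add: h3_def algebra_simps)
      then show "0 \<le> h3 x" using b by simp
    qed (use b in \<open>auto simp: h1_def h2_def mult_nonpos_nonneg\<close>)
    have h0: "0 \<le> h x" using h(1) hs(1) s by (meson order.trans mult_nonneg_nonneg less_imp_le)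
    \<comment> \<open>All terms of f''' but \<open>- 4 * (cos x)\<^sup>2 * h1 x\<close> are
      nonnegative. Half of this one, subtracted from twice \<open>L\<^sup>2\<close> times the main
      term, is the reason for the factor \<open>L\<^sup>2 - 1\<close>.\<close>
    have "f3 x = (sin x * h x + 3 * (sin x)\<^sup>2 * h1 x) + (sin x * (cos x)\<^sup>2 * - h2 x)
        + (cos x)\<^sup>2 * (5 * (sin x * - h2 x) + (cos x)\<^sup>2 * h3 x) - 4 * (cos x)\<^sup>2 * h1 x"
      by (simp add: f3_def algebra_simps)
    moreover have "0 \<le> (sin x * h x + 3 * (sin x)\<^sup>2 * h1 x) + (sin x * (cos x)\<^sup>2 * - h2 x)
        + (cos x)\<^sup>2 * (5 * (sin x * - h2 x) + (cos x)\<^sup>2 * h3 x)"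
      using s h0 hs by (intro add_nonneg_nonneg mult_nonneg_nonneg) auto
    ultimately have f3: "- 4 * (cos x)\<^sup>2 * h1 x \<le> f3 x" by linarith
    have "2 * f1 x * Q x + f x * Q' x = 2 * L\<^sup>2 * f1 x
       + 2 * m / sin x ^ 3 * ((cos x)\<^sup>2 * (h x - sin x * h1 x) + (sin x)\<^sup>2 * h x)"
      using s by (simp add: Q_def Q'_def f1_def f_def field_simps power2_eq_square power3_eq_cube)
    moreover have "0 \<le> 2 * m / sin x ^ 3 * ((cos x)\<^sup>2 * (h x - sin x * h1 x) + (sin x)\<^sup>2 * h x)"
      using s h h0 m by (intro mult_nonneg_nonneg add_nonneg_nonneg) auto
    moreover have "2 * L\<^sup>2 * f1 x = 2 * L\<^sup>2 * (cos x)\<^sup>2 * h1 x - 2 * L\<^sup>2 * (sin x * h x)"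
      by (simp add: f1_def algebra_simps)
    moreover have "L\<^sup>2 * (sin x * h x) \<le> L\<^sup>2 * (1 * profile_bound b e)"
      using s h h0 by (intro mult_left_mono mult_mono) auto
    ultimately have "2 * (L\<^sup>2 - 1) * ((cos x)\<^sup>2 * h1 x) - 2 * L\<^sup>2 * profile_bound b e
        \<le> 2 * f1 x * Q x + f x * Q' x + f3 x / 2"
      using f3 by (simp add: algebra_simps)
    then have "(2 * (L\<^sup>2 - 1) * ((cos x)\<^sup>2 * h1 x) - 2 * L\<^sup>2 * profile_bound b e) * (u x)\<^sup>2 \<le> B' x"
      unfolding B'_def by (intro mult_right_mono) auto
    then show "?g x \<le> B' x" by (simp add: algebra_simps)
  qed
  also have "B pi - B 0 = 0" using \<nu> by (simp add: B_def u_def v_def)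
  finally have "2 * (L\<^sup>2 - 1) * (\<integral>x. (cos x)\<^sup>2 * h1 x * (u x)\<^sup>2 \<partial>Ipi)
      \<le> 2 * L\<^sup>2 * profile_bound b e * moment 0"
    using i1 i2 by (simp add: moment_0)
  then have "(L\<^sup>2 - 1) * (\<integral>x. (cos x)\<^sup>2 * h1 x * (u x)\<^sup>2 \<partial>Ipi) \<le> L\<^sup>2 * profile_bound b e * moment 0"
    by linarith
  then show ?thesis by (simp add: h1_def)
qed

end

section \<open>Weighted moments of Gegenbauer polynomials\<close>

lemma square_mult_powr_le:
  fixes s e b :: real
  assumes "0 < s" "s \<le> 1" "0 \<le> e" "0 \<le> b" "b \<le> 1"
  shows "s\<^sup>2 * (s + e) powr (- 2 * b) \<le> 1"
proof -
  have "(s + e) powr (- 2 * b) \<le> s powr (- 2 * b)"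
    using assms by (intro powr_mono2') auto
  then have "s\<^sup>2 * (s + e) powr (- 2 * b) \<le> s\<^sup>2 * s powr (- 2 * b)"
    by (intro mult_left_mono) auto
  also have "\<dots> = s powr (2 - 2 * b)"
    using assms powr_add[of s 2 "- 2 * b"] by simp
  also have "\<dots> \<le> 1"
    using assms by (intro powr_le1) auto
  finally show ?thesis .
qed

text \<open>Split by cos^2 + sin^2 = 1: the first part is the integral of a total derivative up to a
  bounded term, and in the second sin^2 compensates the singularity. Each part is at most 4
  \<open>profile_bound b e\<close>, as pi < 4.\<close>

lemma integral_add_powr_le:
  assumes b: "b \<noteq> 1 / 2" "0 \<le> b" "b < 1" and e: "0 < e" "e \<le> 1"
  shows "(\<integral>x. (sin x + e) powr (- 2 * b) \<partial>Ipi) \<le> 8 * profile_bound b e"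
proof -
  let ?W = "\<lambda>x. (sin x + e) powr (- 2 * b)"
  have i1: "integrable Ipi (\<lambda>x. (cos x)\<^sup>2 * ?W x)"
    by (intro Ipi_integrable_continuous continuous_on_mult continuous_on_add_powr e continuous_intros)
  have i2: "integrable Ipi (\<lambda>x. (sin x)\<^sup>2 * ?W x)"
    by (intro Ipi_integrable_continuous continuous_on_mult continuous_on_add_powr e continuous_intros)
  have one: "integrable Ipi (\<lambda>x. 1 :: real)"
    by (intro Ipi_integrable_continuous continuous_intros)
  have H: "1 \<le> profile_bound b e" by (rule powr_le_profile_bound) (use assms in auto)
  have "(\<integral>x. ?W x \<partial>Ipi) = (\<integral>x. (cos x)\<^sup>2 * ?W x + (sin x)\<^sup>2 * ?W x \<partial>Ipi)"
    by (simp add: distrib_right[symmetric])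
  also have "\<dots> = (\<integral>x. (cos x)\<^sup>2 * ?W x \<partial>Ipi) + (\<integral>x. (sin x)\<^sup>2 * ?W x \<partial>Ipi)"
    by (rule Bochner_Integration.integral_add[OF i1 i2])
  also have "(\<integral>x. (cos x)\<^sup>2 * ?W x \<partial>Ipi) \<le> pi * profile_bound b e"
  proof (rule integral_cos_squared_deriv[where h = "profile b e"])
    show "continuous_on {0..1} (profile b e)"
      using profile_deriv[OF b(1) e(1)]
      by (intro DERIV_continuous_on[where D = "\<lambda>s. (s + e) powr (- 2 * b)"])
        (auto intro: has_field_derivative_at_within)
    show "(profile b e has_real_derivative (s + e) powr (- 2 * b)) (at s)" if "0 < s" for s
      using that by (intro profile_deriv b e) simp
    show "profile b e s \<le> profile_bound b e" if "0 \<le> s" "s \<le> 1" for s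
      using that by (intro profile_le_bound b e)
  qed (use H i1 in auto)
  also have "(\<integral>x. (sin x)\<^sup>2 * ?W x \<partial>Ipi) \<le> (\<integral>x. 1 \<partial>Ipi)"
  proof (rule integral_mono[OF i2 one])
    fix x assume "x \<in> space Ipi"
    then have "0 < sin x" "sin x \<le> 1" using sin_in_0_pi by (auto simp: space_restrict_space)
    then show "(sin x)\<^sup>2 * ?W x \<le> 1" using b e by (intro square_mult_powr_le) auto
  qed
  also have "(\<integral>x. 1 \<partial>Ipi) = pi"
    by (simp add: measure_restrict_space)
  also have "pi * profile_bound b e + pi \<le> pi * profile_bound b e + pi * profile_bound b e"
    using H by simp
  also have "\<dots> \<le> 4 * profile_bound b e + 4 * profile_bound b e"
    using H pi_less_4 by (intro add_mono mult_right_mono) auto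
  finally show ?thesis by simp
qed

text \<open>Here \<open>h = t\<^bsup>2-2b\<^esup> / (2 - 2b)\<close> with \<open>t = se / (s + e)\<close>.\<close>

lemma integral_cutoff_le:
  assumes b: "0 \<le> b" "b < 1" and e: "0 < e" "e \<le> 1"
  defines "T \<equiv> \<lambda>s. s powr (1 - 2 * b) * (e / (s + e)) powr (3 - 2 * b)"
  shows "integrable Ipi (\<lambda>x. T (sin x))"
    and "(\<integral>x. T (sin x) \<partial>Ipi) \<le> 8 / (1 - b) * e powr (2 - 2 * b)"
proof -
  have contT: "continuous_on {0..pi} (\<lambda>x. g x * (e / (sin x + e)) powr (3 - 2 * b))"
    if "continuous_on {0..pi} g" for g
  proof (intro continuous_on_mult that continuous_on_powr' continuous_on_divide continuous_intros ballI)
    fix x :: real assume "x \<in> {0..pi}"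
    then have "0 \<le> sin x" by (auto intro: sin_ge_zero)
    then show "sin x + e \<noteq> 0" "0 \<le> e / (sin x + e) \<and> (e / (sin x + e) = 0 \<longrightarrow> 0 < 3 - 2 * b)"
      using e by auto
  qed
  have i: "integrable Ipi (\<lambda>x. g x * T (sin x))" if "continuous_on {0..pi} g" for g
  proof -
    have "integrable Ipi (\<lambda>x. sin x powr (1 - 2 * b) * (g x * (e / (sin x + e)) powr (3 - 2 * b)))"
      using b by (intro sin_powr_mult_integrable contT that) auto
    then show ?thesis by (simp add: T_def mult_ac)
  qed
  show "integrable Ipi (\<lambda>x. T (sin x))" using i[of "\<lambda>_. 1"] by simp
  have i1: "integrable Ipi (\<lambda>x. (cos x)\<^sup>2 * T (sin x))" and i2: "integrable Ipi (\<lambda>x. (sin x)\<^sup>2 * T (sin x))"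
    by (intro i continuous_intros)+
  have one: "integrable Ipi (\<lambda>x. e powr (2 - 2 * b))"
    by (intro Ipi_integrable_continuous continuous_intros)
  \<comment> \<open>\<open>t\<close> is a smooth substitute for the minimum of \<open>s\<close> and
    \<open>e\<close>, with derivative (e/(s + e))^2. So T is comparable to s^(1 - 2b) below
    \<open>e\<close> and cut off above it, yet is an exact derivative.\<close>
  define t where "t s = s * e / (s + e)" for s
  have t: "0 \<le> t s" "t s \<le> e" if "0 \<le> s" for s
  proof -
    show "0 \<le> t s" using that e by (simp add: t_def)
    have "s * e \<le> e * (s + e)" using that e by (simp add: algebra_simps)
    then show "t s \<le> e" using that e by (simp add: t_def divide_le_eq)
  qed
  define h where "h s = t s powr (2 - 2 * b) / (2 - 2 * b)" for s
  have split: "(\<integral>x. T (sin x) \<partial>Ipi) = (\<integral>x. (cos x)\<^sup>2 * T (sin x) \<partial>Ipi) + (\<integral>x. (sin x)\<^sup>2 * T (sin x) \<partial>Ipi)"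
    by (subst Bochner_Integration.integral_add[OF i1 i2, symmetric]) (simp add: distrib_right[symmetric])
  have A: "(\<integral>x. (cos x)\<^sup>2 * T (sin x) \<partial>Ipi) \<le> pi * (e powr (2 - 2 * b) / (2 - 2 * b))"
  proof (rule integral_cos_squared_deriv[where h = h])
    show "continuous_on {0..1} h"
    proof -
      have "continuous_on {0..1} t"
        unfolding t_def[abs_def] using e by (intro continuous_on_divide continuous_intros) auto
      moreover have "\<forall>s\<in>{0..1}. 0 \<le> t s \<and> (t s = 0 \<longrightarrow> 0 < 2 - 2 * b)"
        using t b by auto
      ultimately show ?thesis
        unfolding h_def[abs_def] using b
        by (intro continuous_on_divide continuous_on_powr' continuous_on_const) auto
    qed
    show "h 0 = 0" by (simp add: h_def t_def)
    show "(h has_real_derivative T s) (at s)" if s: "0 < s" "s \<le> 1" for s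
    proof -
      have dt: "(t has_real_derivative (e / (s + e))\<^sup>2) (at s)"
        unfolding t_def[abs_def] using s e
        by (auto intro!: derivative_eq_intros simp: power2_eq_square divide_simps) (simp add: algebra_simps)
      have tp: "t s > 0" using s e by (simp add: t_def)
      have "((\<lambda>x. x powr (2 - 2 * b)) has_real_derivative (2 - 2 * b) * t s powr (2 - 2 * b - 1)) (at (t s))"
        using tp by (rule has_real_derivative_powr)
      from DERIV_chain2[OF this dt]
      have "(h has_real_derivative (2 - 2 * b) * t s powr (2 - 2 * b - 1) * (e / (s + e))\<^sup>2 / (2 - 2 * b)) (at s)"
        unfolding h_def[abs_def] by (intro DERIV_cdivide) simp
      moreover have "(2 - 2 * b) * t s powr (2 - 2 * b - 1) * (e / (s + e))\<^sup>2 / (2 - 2 * b) = T s"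
      proof -
        have "t s powr (1 - 2 * b) = s powr (1 - 2 * b) * (e / (s + e)) powr (1 - 2 * b)"
          using s e powr_mult[of s "e / (s + e)" "1 - 2 * b"] by (simp add: t_def)
        moreover have "(e / (s + e)) powr (1 - 2 * b) * (e / (s + e))\<^sup>2 = (e / (s + e)) powr (3 - 2 * b)"
          using s e powr_add[of "e / (s + e)" "1 - 2 * b" 2] by simp
        ultimately show ?thesis using b by (simp add: T_def mult.assoc)
      qed
      ultimately show ?thesis by simp
    qed
    show "h s \<le> e powr (2 - 2 * b) / (2 - 2 * b)" if "0 \<le> s" "s \<le> 1" for s
      unfolding h_def using t[OF that(1)] b by (intro divide_right_mono powr_mono2) auto
  qed (use b i1 in auto)
  have B: "(\<integral>x. (sin x)\<^sup>2 * T (sin x) \<partial>Ipi) \<le> (\<integral>x. e powr (2 - 2 * b) \<partial>Ipi)"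
  proof (rule integral_mono[OF i2 one])
    fix x assume "x \<in> space Ipi"
    then have s: "0 < sin x" "sin x \<le> 1" using sin_in_0_pi by (auto simp: space_restrict_space)
    have "(sin x)\<^sup>2 * sin x powr (1 - 2 * b) = sin x powr (3 - 2 * b)"
      using s powr_add[of "sin x" 2 "1 - 2 * b"] by simp
    then have "(sin x)\<^sup>2 * T (sin x) = t (sin x) powr (3 - 2 * b)"
      using s e powr_mult[of "sin x" "e / (sin x + e)" "3 - 2 * b"]
      by (simp add: T_def t_def mult.assoc[symmetric])
    also have "\<dots> \<le> e powr (3 - 2 * b)"
      using t[of "sin x"] s b by (intro powr_mono2) auto
    also have "\<dots> \<le> e powr (2 - 2 * b)"
      using e by (intro powr_mono') auto
    finally show "(sin x)\<^sup>2 * T (sin x) \<le> e powr (2 - 2 * b)" .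
  qed
  have "(\<integral>x. T (sin x) \<partial>Ipi) \<le> pi * (e powr (2 - 2 * b) / (2 - 2 * b)) + pi * e powr (2 - 2 * b)"
    using split A B by (simp add: measure_restrict_space)
  also have "\<dots> = pi * e powr (2 - 2 * b) * (1 / (2 - 2 * b) + 1)"
    by (simp add: algebra_simps)
  also have "\<dots> \<le> 4 * e powr (2 - 2 * b) * (2 / (1 - b))"
  proof (intro mult_mono)
    show "1 / (2 - 2 * b) + 1 \<le> 2 / (1 - b)"
    proof -
      define r where "r = 1 / (1 - b)"
      have "2 - 2 * b = 2 * (1 - b)" by simp
      then have "1 / (2 - 2 * b) = r / 2" by (simp add: r_def)
      moreover have "1 \<le> r" using b by (simp add: r_def le_divide_eq)
      moreover have "2 / (1 - b) = 2 * r" by (simp add: r_def)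
      ultimately show ?thesis by simp
    qed
  qed (use b pi_less_4 in auto)
  finally show "(\<integral>x. T (sin x) \<partial>Ipi) \<le> 8 / (1 - b) * e powr (2 - 2 * b)"
    by simp
qed

context gegenbauer_solution
begin

text \<open>For \<nu> <= 1 the pointwise bound with constant 6 meets the integral of the weight with
  constant 8, hence 48. For larger \<nu> the gap \<delta> gives L^2 - 1 >= \<delta>, so that
  L^2/(L^2 - 1) <= 1 + 1/\<delta>; the rest of the constant is slack.\<close>

lemma weighted_bound:
  assumes b: "b \<noteq> 1 / 2" "0 \<le> b" "b < 1" and e: "0 < e" "e \<le> 1"
    and \<delta>: "\<delta> > 0" and \<nu>: "\<nu> \<le> 1 \<or> 1 + \<delta> \<le> \<nu>"
  shows "(\<integral>x. (sin x + e) powr (- 2 * b) * (u x)\<^sup>2 \<partial>Ipi) \<le> (48 + 1 / \<delta>) * profile_bound b e * moment 0"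
proof -
  let ?W = "\<lambda>x. (sin x + e) powr (- 2 * b)"
  have iW: "integrable Ipi (\<lambda>x. ?W x * (u x)\<^sup>2)"
    by (intro u_squared_mult_integrable continuous_on_add_powr e)
  have H: "1 \<le> profile_bound b e" by (rule powr_le_profile_bound) (use assms in auto)
  have HJ: "0 \<le> profile_bound b e * moment 0" using H moment_nonneg by simp
  show ?thesis
  proof (cases "\<nu> \<le> 1")
    case True
    have "(\<integral>x. ?W x * (u x)\<^sup>2 \<partial>Ipi) \<le> (\<integral>x. ?W x * (6 * moment 0) \<partial>Ipi)"
    proof (rule integral_mono[OF iW])
      show "integrable Ipi (\<lambda>x. ?W x * (6 * moment 0))"
        by (intro Ipi_integrable_continuous continuous_on_mult continuous_on_add_powr e continuous_on_const)
      fix x assume "x \<in> space Ipi"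
      then show "?W x * (u x)\<^sup>2 \<le> ?W x * (6 * moment 0)"
        using u_squared_le[OF True] by (intro mult_left_mono) (auto simp: space_restrict_space)
    qed
    also have "\<dots> = (\<integral>x. ?W x \<partial>Ipi) * (6 * moment 0)" by simp
    also have "\<dots> \<le> 8 * profile_bound b e * (6 * moment 0)"
      using moment_nonneg by (intro mult_right_mono integral_add_powr_le b e) auto
    also have "\<dots> \<le> (48 + 1 / \<delta>) * (profile_bound b e * moment 0)"
      using HJ \<delta> by (simp add: distrib_right)
    finally show ?thesis by (simp add: mult.assoc)
  next
    case False
    then have \<nu>: "\<nu> > 1" "\<nu> \<ge> 1 + \<delta>" using \<nu> by auto
    have "(1 + \<delta>)\<^sup>2 \<le> L\<^sup>2" using \<nu> \<delta> by (intro power_mono) auto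
    then have L: "\<delta> \<le> L\<^sup>2 - 1" using \<delta> by (simp add: power2_eq_square algebra_simps) (smt (verit) mult_pos_pos)
    have i1: "integrable Ipi (\<lambda>x. (cos x)\<^sup>2 * ?W x * (u x)\<^sup>2)"
      by (intro u_squared_mult_integrable continuous_on_mult continuous_on_add_powr e continuous_intros)
    have i2: "integrable Ipi (\<lambda>x. (u x)\<^sup>2)"
      using u_squared_mult_integrable[of "\<lambda>_. 1"] by simp
    have "(\<integral>x. ?W x * (u x)\<^sup>2 \<partial>Ipi) \<le> (\<integral>x. (cos x)\<^sup>2 * ?W x * (u x)\<^sup>2 + (u x)\<^sup>2 \<partial>Ipi)"
    proof (rule integral_mono[OF iW Bochner_Integration.integrable_add[OF i1 i2]])
      fix x assume "x \<in> space Ipi"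
      then have "0 < sin x" "sin x \<le> 1" using sin_in_0_pi by (auto simp: space_restrict_space)
      then have "(sin x)\<^sup>2 * ?W x \<le> 1" using b e by (intro square_mult_powr_le) auto
      then have "?W x \<le> (cos x)\<^sup>2 * ?W x + 1"
        by (simp add: cos_squared_eq algebra_simps)
      then show "?W x * (u x)\<^sup>2 \<le> (cos x)\<^sup>2 * ?W x * (u x)\<^sup>2 + (u x)\<^sup>2"
        using mult_right_mono[of "?W x" "(cos x)\<^sup>2 * ?W x + 1" "(u x)\<^sup>2"] by (simp add: distrib_right)
    qed
    also have "\<dots> = (\<integral>x. (cos x)\<^sup>2 * ?W x * (u x)\<^sup>2 \<partial>Ipi) + moment 0"
      using Bochner_Integration.integral_add[OF i1 i2] by (simp add: moment_0)
    also have "(\<integral>x. (cos x)\<^sup>2 * ?W x * (u x)\<^sup>2 \<partial>Ipi) \<le> (1 + 1 / \<delta>) * (profile_bound b e * moment 0)"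
    proof -
      have "(\<integral>x. (cos x)\<^sup>2 * ?W x * (u x)\<^sup>2 \<partial>Ipi) \<le> L\<^sup>2 / (L\<^sup>2 - 1) * (profile_bound b e * moment 0)"
        using multiplier_bound[OF \<nu>(1) b(1,2) e] L \<delta> by (simp add: field_simps)
      also have "L\<^sup>2 / (L\<^sup>2 - 1) = 1 + 1 / (L\<^sup>2 - 1)"
        using L \<delta> by (simp add: field_simps)
      also have "(1 + 1 / (L\<^sup>2 - 1)) * (profile_bound b e * moment 0) \<le> (1 + 1 / \<delta>) * (profile_bound b e * moment 0)"
        using L \<delta> HJ by (intro mult_right_mono add_left_mono divide_left_mono) auto
      finally show ?thesis .
    qed
    also have "(1 + 1 / \<delta>) * (profile_bound b e * moment 0) + moment 0
      \<le> (1 + 1 / \<delta>) * (profile_bound b e * moment 0) + 47 * (profile_bound b e * moment 0)"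
      using mult_right_mono[OF H moment_nonneg[of 0]] HJ by simp
    also have "\<dots> = (48 + 1 / \<delta>) * profile_bound b e * moment 0"
      by (simp add: algebra_simps)
    finally show ?thesis by simp
  qed
qed

lemma moment_bound:
  assumes b: "b \<noteq> 1 / 2" "0 \<le> b" "b < 1"
    and \<delta>: "\<delta> > 0" and \<nu>: "\<nu> \<le> 1 \<or> 1 + \<delta> \<le> \<nu>" and \<nu>': "\<nu> = 1 / 2 \<or> 1 / 2 + \<delta> \<le> \<nu>"
  shows "moment (- 2 * b) \<le> (200 + 10 / \<delta> + 128 / (1 - b)) * profile_bound b (1 / (L + 1)) * moment 0"
proof -
  define e where "e = 1 / (L + 1)"
  have L: "L > 0" using \<nu>_ge by simp
  have e: "0 < e" "e \<le> 1" and Le: "L * e \<le> 1"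
    using L by (auto simp: e_def)
  let ?W = "\<lambda>x. (sin x + e) powr (- 2 * b)"
  define H where "H = profile_bound b e"
  have H: "e powr (1 - 2 * b) \<le> H" "1 \<le> H"
    unfolding H_def by (rule powr_le_profile_bound; use b e in simp)+
  have HJ: "0 \<le> H * moment 0" using H moment_nonneg by simp
  have Le': "L * e powr (2 - 2 * b) \<le> H"
  proof -
    have "L * e powr (2 - 2 * b) = (L * e) * e powr (1 - 2 * b)"
      using e powr_add[of e 1 "1 - 2 * b"] by simp
    also have "\<dots> \<le> 1 * e powr (1 - 2 * b)" using Le by (intro mult_right_mono) auto
    finally show ?thesis using H by simp
  qed
  have iW: "integrable Ipi (\<lambda>x. ?W x * (u x)\<^sup>2)"
    by (intro u_squared_mult_integrable continuous_on_add_powr e)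
  have iJ: "integrable Ipi (\<lambda>x. sin x powr (2 * \<nu> + - 2 * b) * (poly y (cos x))\<^sup>2)"
    using \<nu>_ge b by (intro moment_integrable) auto
  have WJ: "(\<integral>x. 4 * (?W x * (u x)\<^sup>2) \<partial>Ipi) \<le> (192 + 4 / \<delta>) * (H * moment 0)"
  proof -
    have "(\<integral>x. 4 * (?W x * (u x)\<^sup>2) \<partial>Ipi) = 4 * (\<integral>x. ?W x * (u x)\<^sup>2 \<partial>Ipi)" by simp
    also have "\<dots> \<le> 4 * ((48 + 1 / \<delta>) * H * moment 0)"
      using weighted_bound[OF b e \<delta> \<nu>] by (simp only: H_def mult_le_cancel_left_pos zero_less_numeral)
    also have "\<dots> = (192 + 4 / \<delta>) * (H * moment 0)" by (simp add: algebra_simps)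
    finally show ?thesis .
  qed
  have powr_eq: "sin x powr (2 * \<nu> + - 2 * b) * (poly y (cos x))\<^sup>2 = sin x powr (- 2 * b) * (u x)\<^sup>2" for x
    unfolding u_squared powr_add by (simp only: mult_ac)
  \<comment> \<open>Away from the poles \<open>s + e\<close> is at most \<open>2 * s\<close>, and
    the factor 4 bounds 2^(2b).\<close>
  have big: "s powr (- 2 * b) \<le> 4 * (s + e) powr (- 2 * b)" if s: "e \<le> s" for s
  proof -
    have "(2 * s) powr (- 2 * b) \<le> (s + e) powr (- 2 * b)"
      using s e b by (intro powr_mono2') auto
    moreover have "(2 * s) powr (- 2 * b) = 2 powr (- 2 * b) * s powr (- 2 * b)"
      using s e by (simp add: powr_mult)
    moreover have "1 / 4 * s powr (- 2 * b) \<le> 2 powr (- 2 * b) * s powr (- 2 * b)"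
    proof (rule mult_right_mono)
      have "1 / 4 = 2 powr (- 2 :: real)" by (simp add: powr_neg_numeral)
      also have "\<dots> \<le> 2 powr (- 2 * b)" using b by (intro powr_mono) auto
      finally show "1 / 4 \<le> 2 powr (- 2 * b)" .
    qed simp
    ultimately show ?thesis by linarith
  qed
  have "moment (- 2 * b) \<le> (192 + 4 / \<delta>) * (H * moment 0) + (4 / \<delta> + 128 / (1 - b)) * (H * moment 0)"
  proof (cases "\<nu> = 1 / 2")
    case False
    then have \<nu>': "\<nu> \<ge> 1 / 2 + \<delta>" "\<nu> > 1 / 2" using \<nu>' \<delta> by auto
    let ?g = "\<lambda>x. e powr (2 - 2 * b) * (sin x powr (2 * \<nu> + - 2) * (poly y (cos x))\<^sup>2)"
    have ig: "integrable Ipi ?g"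
      using \<nu>' by (intro integrable_mult_right moment_integrable) auto
    have "moment (- 2 * b) \<le> (\<integral>x. 4 * (?W x * (u x)\<^sup>2) + ?g x \<partial>Ipi)"
      unfolding moment_def[of "- 2 * b"]
    proof (rule integral_mono[OF iJ Bochner_Integration.integrable_add[OF integrable_mult_right[OF iW] ig]])
      fix x assume "x \<in> space Ipi"
      then have s: "0 < sin x" "sin x \<le> 1" using sin_in_0_pi by (auto simp: space_restrict_space)
      have g: "?g x = (e powr (2 - 2 * b) * sin x powr (- 2)) * (u x)\<^sup>2"
        unfolding u_squared powr_add by (simp only: mult_ac)
      have "sin x powr (- 2 * b) \<le> 4 * ?W x + e powr (2 - 2 * b) * sin x powr (- 2)"
      proof (cases "e \<le> sin x")
        case True
        show ?thesis using big[OF True] by (simp add: add_increasing2)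
      next
        case False
        \<comment> \<open>Close to a pole the exponent 2 - 2b is positive, so one may pass from sin
          x to the larger \<open>e\<close>, at the price of the stronger singularity sin^(-2), whose
          moment is known.\<close>
        have "sin x powr (- 2 * b) = sin x powr (2 - 2 * b) * sin x powr (- 2)"
          by (simp add: powr_add[symmetric])
        also have "\<dots> \<le> e powr (2 - 2 * b) * sin x powr (- 2)"
          using False s b by (intro mult_right_mono powr_mono2) auto
        finally show ?thesis by (simp add: add_increasing)
      qed
      from mult_right_mono[OF this, of "(u x)\<^sup>2"]
      show "sin x powr (2 * \<nu> + - 2 * b) * (poly y (cos x))\<^sup>2 \<le> 4 * (?W x * (u x)\<^sup>2) + ?g x"
        unfolding powr_eq g by (simp add: distrib_right mult.assoc)
    qed
    also have "\<dots> = (\<integral>x. 4 * (?W x * (u x)\<^sup>2) \<partial>Ipi) + e powr (2 - 2 * b) * moment (- 2)"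
      by (subst Bochner_Integration.integral_add[OF integrable_mult_right[OF iW] ig]) (simp add: moment_def)
    also have "e powr (2 - 2 * b) * moment (- 2) \<le> (4 / \<delta> + 128 / (1 - b)) * (H * moment 0)"
    proof -
      have "moment (- 2) = 2 * L * moment 0 / (2 * \<nu> - 1)"
        using moment_minus_2[OF \<nu>'(2)] \<nu>'(2) by (simp add: field_simps)
      also have "\<dots> \<le> 2 * L * moment 0 / \<delta>"
        using \<nu>' \<delta> L moment_nonneg[of 0] by (intro divide_left_mono) auto
      finally have "e powr (2 - 2 * b) * moment (- 2) \<le> e powr (2 - 2 * b) * (2 * L * moment 0 / \<delta>)"
        by (intro mult_left_mono) auto
      also have "\<dots> = (2 / \<delta>) * (L * e powr (2 - 2 * b) * moment 0)" by simp
      also have "\<dots> \<le> (4 / \<delta> + 128 / (1 - b)) * (H * moment 0)"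
        using \<delta> b HJ Le' moment_nonneg[of 0] L e
        by (intro mult_mono mult_right_mono) (auto simp: add_increasing2 divide_right_mono intro!: add_nonneg_nonneg)
      finally show ?thesis .
    qed
    finally show ?thesis using WJ by linarith
  next
    case True
    define T where "T s = s powr (1 - 2 * b) * (e / (s + e)) powr (3 - 2 * b)" for s
    have T: "integrable Ipi (\<lambda>x. T (sin x))" "(\<integral>x. T (sin x) \<partial>Ipi) \<le> 8 / (1 - b) * e powr (2 - 2 * b)"
      unfolding T_def by (rule integral_cutoff_le[OF b(2,3) e])+
    \<comment> \<open>Here u^2 is sin x times y^2, and \<open>legendre_bound\<close> gives y^2 <= 2
      L \<open>moment 0\<close>, since 2N + 1 = 2L for \<nu> = 1/2. The remaining factor 8 of 16 is
      lost in comparing a power of the sine with \<open>T\<close>.\<close>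
    let ?g = "\<lambda>x. 16 * L * moment 0 * T (sin x)"
    have ig: "integrable Ipi ?g" by (intro integrable_mult_right T)
    have "moment (- 2 * b) \<le> (\<integral>x. 4 * (?W x * (u x)\<^sup>2) + ?g x \<partial>Ipi)"
      unfolding moment_def[of "- 2 * b"]
    proof (rule integral_mono[OF iJ Bochner_Integration.integrable_add[OF integrable_mult_right[OF iW] ig]])
      fix x assume "x \<in> space Ipi"
      then have s: "0 < sin x" "sin x \<le> 1" using sin_in_0_pi by (auto simp: space_restrict_space)
      have T0: "0 \<le> T (sin x)" by (simp add: T_def)
      have g0: "0 \<le> ?g x" using T0 L moment_nonneg[of 0] by simp
      have "sin x powr (- 2 * b) * (u x)\<^sup>2 \<le> 4 * (?W x * (u x)\<^sup>2) + ?g x"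
      proof (cases "e \<le> sin x")
        case True
        show ?thesis using mult_right_mono[OF big[OF True], of "(u x)\<^sup>2"] g0 by simp
      next
        case False
        have "(u x)\<^sup>2 = sin x * (poly y (cos x))\<^sup>2"
          using s unfolding u_squared by (simp add: \<open>\<nu> = 1 / 2\<close>)
        also have "\<dots> \<le> sin x * (2 * L * moment 0)"
          using legendre_bound[OF \<open>\<nu> = 1 / 2\<close>, of "cos x"] s
          by (intro mult_left_mono) (auto simp: \<open>\<nu> = 1 / 2\<close> algebra_simps)
        finally have "sin x powr (- 2 * b) * (u x)\<^sup>2 \<le> sin x powr (- 2 * b) * (sin x * (2 * L * moment 0))"
          by (intro mult_left_mono) auto
        also have "\<dots> = sin x powr (1 - 2 * b) * (2 * L * moment 0)"
          using s powr_add[of "sin x" 1 "- 2 * b"] by simp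
        also have "sin x powr (1 - 2 * b) \<le> 8 * T (sin x)"
        proof -
          \<comment> \<open>For sin x < e the quotient e/(sin x + e) is at least 1/2, and its
            exponent is at most 3.\<close>
          have "1 / 8 = (1 / 2 :: real) powr 3" by (simp add: power3_eq_cube)
          also have "\<dots> \<le> (1 / 2) powr (3 - 2 * b)"
            using b by (intro powr_mono') auto
          also have "\<dots> \<le> (e / (sin x + e)) powr (3 - 2 * b)"
            using False s e b by (intro powr_mono2) (auto simp: field_simps)
          finally have "sin x powr (1 - 2 * b) * (1 / 8) \<le> T (sin x)"
            unfolding T_def by (intro mult_left_mono) auto
          then show ?thesis by simp
        qed
        finally have "sin x powr (- 2 * b) * (u x)\<^sup>2 \<le> ?g x"
          using L moment_nonneg[of 0] by (simp add: mult_right_mono mult_ac)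
        then show ?thesis by (simp add: add_increasing)
      qed
      then show "sin x powr (2 * \<nu> + - 2 * b) * (poly y (cos x))\<^sup>2 \<le> 4 * (?W x * (u x)\<^sup>2) + ?g x"
        unfolding powr_eq .
    qed
    also have "\<dots> = (\<integral>x. 4 * (?W x * (u x)\<^sup>2) \<partial>Ipi) + 16 * L * moment 0 * (\<integral>x. T (sin x) \<partial>Ipi)"
      by (subst Bochner_Integration.integral_add[OF integrable_mult_right[OF iW] ig]) simp
    also have "16 * L * moment 0 * (\<integral>x. T (sin x) \<partial>Ipi) \<le> (4 / \<delta> + 128 / (1 - b)) * (H * moment 0)"
    proof -
      have "16 * L * moment 0 * (\<integral>x. T (sin x) \<partial>Ipi) \<le> 16 * L * moment 0 * (8 / (1 - b) * e powr (2 - 2 * b))"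
        using L moment_nonneg[of 0] by (intro mult_left_mono T) auto
      also have "\<dots> = 128 / (1 - b) * (L * e powr (2 - 2 * b) * moment 0)" by simp
      also have "\<dots> \<le> (4 / \<delta> + 128 / (1 - b)) * (H * moment 0)"
        using \<delta> b HJ Le' moment_nonneg[of 0] L e
        by (intro mult_mono mult_right_mono) (auto intro!: add_nonneg_nonneg)
      finally show ?thesis .
    qed
    finally show ?thesis using WJ by linarith
  qed
  also have "\<dots> = (192 + 8 / \<delta> + 128 / (1 - b)) * (H * moment 0)"
    by (simp add: algebra_simps)
  also have "\<dots> \<le> (200 + 10 / \<delta> + 128 / (1 - b)) * (H * moment 0)"
    using HJ \<delta> b by (intro mult_right_mono add_mono divide_right_mono) auto
  finally show ?thesis
    by (simp add: H_def e_def mult.assoc)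
qed

end

section \<open>Orthogonality of spherical harmonics\<close>

lemma real_polynomial_directional_derivative:
  assumes "real_polynomial_function f"
  shows "\<exists>g. real_polynomial_function g \<and>
    (\<forall>x. ((\<lambda>s. f (x + s *\<^sub>R e)) has_real_derivative g x) (at 0))"
  using assms
proof (induction rule: real_polynomial_function.induct)
  case (linear f)
  have "((\<lambda>s. f (x + s *\<^sub>R e)) has_real_derivative f e) (at 0)" for x
    unfolding linear_add[OF bounded_linear.linear[OF linear]] linear_scale[OF bounded_linear.linear[OF linear]]
    by (auto intro!: derivative_eq_intros)
  then show ?case by (intro exI[of _ "\<lambda>_. f e"]) auto
next
  case (const c)
  show ?case by (intro exI[of _ "\<lambda>_. 0"]) (auto intro: real_polynomial_function.intros(2))
next
  case (add f g)
  then obtain f' g' where "real_polynomial_function f'" "real_polynomial_function g'"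
    "\<And>x. ((\<lambda>s. f (x + s *\<^sub>R e)) has_real_derivative f' x) (at 0)"
    "\<And>x. ((\<lambda>s. g (x + s *\<^sub>R e)) has_real_derivative g' x) (at 0)"
    by auto
  then show ?case
    by (intro exI[of _ "\<lambda>x. f' x + g' x"]) (auto intro!: derivative_eq_intros)
next
  case (mult f g)
  then obtain f' g' where "real_polynomial_function f'" "real_polynomial_function g'"
    "\<And>x. ((\<lambda>s. f (x + s *\<^sub>R e)) has_real_derivative f' x) (at 0)"
    "\<And>x. ((\<lambda>s. g (x + s *\<^sub>R e)) has_real_derivative g' x) (at 0)"
    by auto
  with mult.hyps show ?case
    by (intro exI[of _ "\<lambda>x. f' x * g x + f x * g' x"]) (auto intro!: derivative_eq_intros)
qed

definition partial_deriv :: "'n \<Rightarrow> (real ^ 'n \<Rightarrow> complex) \<Rightarrow> real ^ 'n \<Rightarrow> complex" where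
  "partial_deriv i p x = vector_derivative (\<lambda>s. p (x + s *\<^sub>R axis i 1)) (at 0)"

lemma polynomial_function_Re_Im:
  fixes p :: "'a::euclidean_space \<Rightarrow> complex"
  shows "polynomial_function p \<longleftrightarrow>
    real_polynomial_function (\<lambda>x. Re (p x)) \<and> real_polynomial_function (\<lambda>x. Im (p x))"
  by (subst polynomial_function_iff_Basis_inner) (auto simp: Basis_complex_def inner_complex_def)

lemma
  fixes p :: "real ^ 'n \<Rightarrow> complex"
  assumes "polynomial_function p"
  shows polynomial_function_partial_deriv: "polynomial_function (partial_deriv i p)"
    and has_vector_derivative_partial:
      "((\<lambda>s. p (x + s *\<^sub>R axis i 1)) has_vector_derivative partial_deriv i p (x + t *\<^sub>R axis i 1)) (at t)"
proof -
  have "real_polynomial_function (\<lambda>x. Re (p x))" "real_polynomial_function (\<lambda>x. Im (p x))"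
    using assms unfolding polynomial_function_Re_Im by auto
  from this[THEN real_polynomial_directional_derivative, of "axis i 1"]
  obtain g h where gh: "real_polynomial_function g" "real_polynomial_function h"
    "\<And>x. ((\<lambda>s. Re (p (x + s *\<^sub>R axis i 1))) has_real_derivative g x) (at 0)"
    "\<And>x. ((\<lambda>s. Im (p (x + s *\<^sub>R axis i 1))) has_real_derivative h x) (at 0)"
    by blast
  have d: "((\<lambda>s. p (x + s *\<^sub>R axis i 1)) has_vector_derivative Complex (g x) (h x)) (at 0)" for x
    using gh(3,4)[of x] by (simp add: has_vector_derivative_complex_iff)
  then have eq: "partial_deriv i p = (\<lambda>x. Complex (g x) (h x))"
    by (auto simp: partial_deriv_def vector_derivative_at)
  show "polynomial_function (partial_deriv i p)"
    unfolding eq polynomial_function_Re_Im using gh by simp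
  \<comment> \<open>\<open>partial_deriv\<close> differentiates at parameter 0; moving the base
    point by t and shifting the parameter gives the derivative at every parameter.\<close>
  let ?G = "\<lambda>s. p ((x + t *\<^sub>R axis i 1) + s *\<^sub>R axis i 1)"
  have "(?G has_vector_derivative partial_deriv i p (x + t *\<^sub>R axis i 1)) (at ((\<lambda>s. s - t) t))"
    using d[of "x + t *\<^sub>R axis i 1"] by (simp add: eq)
  moreover have "((\<lambda>s. s - t) has_vector_derivative 1) (at t)"
    by (auto intro!: derivative_eq_intros)
  ultimately have "(?G \<circ> (\<lambda>s. s - t) has_vector_derivative 1 *\<^sub>R partial_deriv i p (x + t *\<^sub>R axis i 1)) (at t)"
    by (intro vector_diff_chain_at)
  moreover have "?G \<circ> (\<lambda>s. s - t) = (\<lambda>s. p (x + s *\<^sub>R axis i 1))"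
    by (simp add: o_def algebra_simps)
  ultimately show "((\<lambda>s. p (x + s *\<^sub>R axis i 1)) has_vector_derivative partial_deriv i p (x + t *\<^sub>R axis i 1)) (at t)"
    by simp
qed

lemma laplacian_partial_deriv:
  assumes "polynomial_function p"
  shows "laplacian p x = (\<Sum>i\<in>UNIV. partial_deriv i (partial_deriv i p) x)"
proof -
  have "vector_derivative (\<lambda>s. p (x + s *\<^sub>R axis i 1)) (at t) = partial_deriv i p (x + t *\<^sub>R axis i 1)" for i t
    using has_vector_derivative_partial[OF assms] by (rule vector_derivative_at)
  then show ?thesis
    by (simp add: laplacian_def partial_deriv_def[of _ "partial_deriv _ p"])
qed

lemma partial_deriv_mult:
  assumes "polynomial_function p" "polynomial_function q"
  shows "partial_deriv i (\<lambda>x. p x * q x) x = partial_deriv i p x * q x + p x * partial_deriv i q x"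
proof -
  have "((\<lambda>s. p (x + s *\<^sub>R axis i 1) * q (x + s *\<^sub>R axis i 1)) has_vector_derivative
      p x * partial_deriv i q x + partial_deriv i p x * q x) (at 0)"
    using has_vector_derivative_mult[OF has_vector_derivative_partial[OF assms(1), of x i 0]
        has_vector_derivative_partial[OF assms(2), of x i 0]] by simp
  then show ?thesis
    by (simp add: partial_deriv_def[of _ "\<lambda>x. p x * q x"] vector_derivative_at add.commute)
qed

lemma partial_deriv_diff:
  assumes "polynomial_function p" "polynomial_function q"
  shows "partial_deriv i (\<lambda>x. p x - q x) x = partial_deriv i p x - partial_deriv i q x"
proof -
  have "((\<lambda>s. p (x + s *\<^sub>R axis i 1) - q (x + s *\<^sub>R axis i 1)) has_vector_derivative
      partial_deriv i p x - partial_deriv i q x) (at 0)"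
    using has_vector_derivative_diff[OF has_vector_derivative_partial[OF assms(1), of x i 0]
        has_vector_derivative_partial[OF assms(2), of x i 0]] by simp
  then show ?thesis
    by (simp add: partial_deriv_def[of _ "\<lambda>x. p x - q x"] vector_derivative_at)
qed

lemma polynomial_function_mult_complex:
  fixes p q :: "'a::euclidean_space \<Rightarrow> complex"
  assumes "polynomial_function p" "polynomial_function q"
  shows "polynomial_function (\<lambda>x. p x * q x)"
  using assms unfolding polynomial_function_Re_Im by auto

lemma polynomial_function_cnj:
  fixes p :: "'a::euclidean_space \<Rightarrow> complex"
  assumes "polynomial_function p"
  shows "polynomial_function (\<lambda>x. cnj (p x))"
  using assms unfolding polynomial_function_Re_Im by auto

lemma partial_deriv_cnj:
  assumes "polynomial_function p"
  shows "partial_deriv i (\<lambda>x. cnj (p x)) = (\<lambda>x. cnj (partial_deriv i p x))"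
proof
  fix x
  have "((\<lambda>s. cnj (p (x + s *\<^sub>R axis i 1))) has_vector_derivative cnj (partial_deriv i p x)) (at 0)"
    using has_vector_derivative_cnj[OF has_vector_derivative_partial[OF assms, of x i 0]] by simp
  then show "partial_deriv i (\<lambda>x. cnj (p x)) x = cnj (partial_deriv i p x)"
    by (simp add: partial_deriv_def[of _ "\<lambda>x. cnj (p x)"] vector_derivative_at)
qed

text \<open>Both sides are the derivative of p(t x) at t = 1, once by the chain rule and once by
  homogeneity.\<close>

lemma euler_homogeneous:
  fixes p :: "real ^ 'n \<Rightarrow> complex"
  assumes p: "polynomial_function p" and hom: "\<And>t x. p (t *\<^sub>R x) = of_real (t ^ l) * p x"
  shows "(\<Sum>i\<in>UNIV. of_real (x $ i) * partial_deriv i p x) = of_nat l * p x"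
proof -
  obtain D where D: "(p has_derivative D) (at x)"
    using differentiable_at_polynomial_function[OF p] by (auto simp: differentiable_def)
  interpret D: bounded_linear D using D by (rule has_derivative_bounded_linear)
  have line: "((\<lambda>s. p (f s)) has_vector_derivative D v) (at a)"
    if "(f has_vector_derivative v) (at a)" "f a = x" for f a v
  proof -
    have "(p has_derivative D) (at (f a))" using D that by simp
    from has_derivative_compose[OF that(1)[unfolded has_vector_derivative_def] this]
    show ?thesis by (simp add: has_vector_derivative_def D.scaleR)
  qed
  have "partial_deriv i p x = D (axis i 1)" for i
    unfolding partial_deriv_def
    by (rule vector_derivative_at, rule line) (auto intro!: derivative_eq_intros)
  then have "(\<Sum>i\<in>UNIV. of_real (x $ i) * partial_deriv i p x) = (\<Sum>i\<in>UNIV. D (x $ i *\<^sub>R axis i 1))"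
    by (simp only: D.scaleR scaleR_conv_of_real[where 'a = complex])
  also have "\<dots> = D x"
    by (simp only: D.sum[symmetric] basis_expansion scalar_mult_eq_scaleR[symmetric])
  also have "D x = of_nat l * p x"
  proof (rule vector_derivative_unique_at)
    show "((\<lambda>t. p (t *\<^sub>R x)) has_vector_derivative D x) (at 1)"
      by (rule line) (auto intro!: derivative_eq_intros)
    show "((\<lambda>t. p (t *\<^sub>R x)) has_vector_derivative of_nat l * p x) (at 1)"
    proof -
      have "((\<lambda>t. t ^ l) has_real_derivative real l) (at 1)"
        by (auto intro!: derivative_eq_intros)
      then have "((\<lambda>t. complex_of_real (t ^ l)) has_vector_derivative of_real (real l)) (at 1)"
        by (intro has_vector_derivative_of_real) (simp add: has_real_derivative_iff_has_vector_derivative)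
      then have "((\<lambda>t. complex_of_real (t ^ l) * p x) has_vector_derivative of_real (real l) * p x) (at 1)"
        by (rule bounded_linear.has_vector_derivative[OF bounded_linear_mult_left])
      then show ?thesis by (simp only: hom of_real_of_nat_eq)
    qed
  qed
  finally show ?thesis .
qed

section \<open>Integration by parts in space\<close>

lemma lborel_integral_translate:
  fixes f :: "'a::euclidean_space \<Rightarrow> 'b::{banach, second_countable_topology}"
  assumes [measurable]: "f \<in> borel_measurable borel"
  shows "(\<integral>x. f (x + c) \<partial>lborel) = (\<integral>x. f x \<partial>lborel)"
proof -
  have "(\<integral>x. f x \<partial>lborel) = (\<integral>x. f x \<partial>distr lborel borel ((+) c))"
    by (simp add: lborel_distr_plus)
  also have "\<dots> = (\<integral>x. f (c + x) \<partial>lborel)"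
    by (rule integral_distr) auto
  finally show ?thesis by (simp add: add.commute)
qed

text \<open>The integral over \<open>s \<in> [0,1]\<close> of the translates of \<open>\<Psi>\<close> by \<open>s e\<close> is a difference of two
  translates of \<open>\<Phi>\<close>.\<close>

lemma integral_directional_derivative_zero:
  fixes \<Phi> \<Psi> :: "'a::euclidean_space \<Rightarrow> complex"
  assumes cont: "continuous_on UNIV \<Phi>" "continuous_on UNIV \<Psi>"
    and supp: "\<And>x. 1 \<le> norm x \<Longrightarrow> \<Phi> x = 0" "\<And>x. 1 \<le> norm x \<Longrightarrow> \<Psi> x = 0"
    and deriv: "\<And>x t. ((\<lambda>s. \<Phi> (x + s *\<^sub>R e)) has_vector_derivative \<Psi> (x + t *\<^sub>R e)) (at t)"
    and e: "norm e \<le> 1"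
  shows "(\<integral>x. \<Psi> x \<partial>lborel) = 0"
proof -
  have [measurable]: "\<Phi> \<in> borel_measurable borel" "\<Psi> \<in> borel_measurable borel"
    using cont by (auto intro: borel_measurable_continuous_onI)
  define f where "f s x = indicator {0..1} s *\<^sub>R \<Psi> (x + s *\<^sub>R e)" for s :: real and x
  have int\<Phi>: "integrable lborel \<Phi>"
  proof -
    have "integrable lborel (\<lambda>x. indicator (cball 0 1) x *\<^sub>R \<Phi> x)"
      by (intro borel_integrable_compact continuous_on_subset[OF cont(1)]) auto
    moreover have "(\<lambda>x. indicator (cball 0 1) x *\<^sub>R \<Phi> x) = \<Phi>"
      using supp(1) by (auto simp: indicator_def not_le)
    ultimately show ?thesis by simp
  qed
  have "integrable (lborel \<Otimes>\<^sub>M lborel) (case_prod f)"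
  proof -
    \<comment> \<open>The functions live in the unit ball and the translations have length at most
      1, so radius 2 contains all translated supports.\<close>
    have "integrable lborel (\<lambda>z. indicator ({0..1} \<times> cball 0 2) z *\<^sub>R \<Psi> (snd z + fst z *\<^sub>R e))"
      by (intro borel_integrable_compact compact_Times compact_cball compact_Icc
          continuous_on_compose2[OF cont(2)] continuous_intros) auto
    moreover have "(\<lambda>z. indicator ({0..1} \<times> cball 0 2) z *\<^sub>R \<Psi> (snd z + fst z *\<^sub>R e)) = case_prod f"
    proof
      fix z :: "real \<times> 'a"
      obtain s x where z: "z = (s, x)" by (cases z)
      have "\<Psi> (x + s *\<^sub>R e) = 0" if "0 \<le> s" "s \<le> 1" "\<not> norm x \<le> 2"
      proof (rule supp(2))
        have "norm (s *\<^sub>R e) \<le> 1" using that e by (simp add: mult_le_one)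
        then show "1 \<le> norm (x + s *\<^sub>R e)"
          using norm_triangle_ineq4[of "x + s *\<^sub>R e" "s *\<^sub>R e"] that by simp
      qed
      then show "indicator ({0..1} \<times> cball 0 2) z *\<^sub>R \<Psi> (snd z + fst z *\<^sub>R e) = case_prod f z"
        by (auto simp: z f_def indicator_def)
    qed
    ultimately show ?thesis by (simp add: lborel_prod)
  qed
  then have fub: "(\<integral>x. (\<integral>s. f s x \<partial>lborel) \<partial>lborel) = (\<integral>s. (\<integral>x. f s x \<partial>lborel) \<partial>lborel)"
    by (rule lborel_pair.Fubini_integral)
  have inner_x: "(\<integral>x. f s x \<partial>lborel) = indicator {0..1} s *\<^sub>R (\<integral>x. \<Psi> x \<partial>lborel)" for s
    unfolding f_def by (simp add: lborel_integral_translate)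
  have inner_s: "(\<integral>s. f s x \<partial>lborel) = \<Phi> (x + e) - \<Phi> x" for x
  proof -
    have "(\<integral>s. indicator {0..1} s *\<^sub>R \<Psi> (x + s *\<^sub>R e) \<partial>lborel) = \<Phi> (x + 1 *\<^sub>R e) - \<Phi> (x + 0 *\<^sub>R e)"
      by (intro integral_FTC_Icc has_vector_derivative_at_within[OF deriv]
          continuous_on_compose2[OF cont(2)] continuous_intros) auto
    then show ?thesis by (simp add: f_def)
  qed
  have "(\<integral>x. \<Psi> x \<partial>lborel) = (\<integral>s. indicator {0..1} s *\<^sub>R (\<integral>x. \<Psi> x \<partial>lborel) \<partial>(lborel :: real measure))"
    by (subst integral_scaleR_left) auto
  also have "\<dots> = (\<integral>x. \<Phi> (x + e) - \<Phi> x \<partial>lborel)"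
    using fub by (simp only: inner_x inner_s)
  also have "\<dots> = 0"
  proof -
    have "integrable lborel (\<lambda>x. \<Phi> (x + e))"
    proof -
      have "integrable (distr lborel borel ((+) e)) \<Phi>" using int\<Phi> by (simp add: lborel_distr_plus)
      then show ?thesis by (subst (asm) integrable_distr_eq) (auto simp: add.commute)
    qed
    then show ?thesis using int\<Phi> by (simp add: lborel_integral_translate)
  qed
  finally show ?thesis .
qed

text \<open>Squaring smooths the corner of the positive part, which is why the weight on the ball
  enters Green's formula squared.\<close>

lemma max_0_square_has_derivative:
  "((\<lambda>t. (max 0 t)\<^sup>2) has_real_derivative 2 * max 0 t) (at (t::real))"
proof (cases "t = 0")
  case True
  have "((\<lambda>t. (max 0 t)\<^sup>2) has_real_derivative 0) (at (0::real))"
    unfolding DERIV_def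
  proof (rule Lim_null_comparison)
    have "norm (((max 0 (0 + h))\<^sup>2 - (max 0 0)\<^sup>2) / h) \<le> \<bar>h\<bar>" for h :: real
      by (cases "h > 0") (auto simp: power2_eq_square)
    then show "\<forall>\<^sub>F h :: real in at 0. norm (((max 0 (0 + h))\<^sup>2 - (max 0 0)\<^sup>2) / h) \<le> \<bar>h\<bar>"
      by (intro always_eventually allI)
    show "((\<lambda>h::real. \<bar>h\<bar>) \<longlongrightarrow> 0) (at 0)"
      by (auto intro!: tendsto_eq_intros)
  qed
  then show ?thesis using True by simp
next
  case False
  show ?thesis
  proof (cases "t > 0")
    case True
    have "((\<lambda>t. t\<^sup>2) has_real_derivative 2 * t) (at t)"
      by (auto intro!: derivative_eq_intros)
    then have "((\<lambda>t. (max 0 t)\<^sup>2) has_real_derivative 2 * t) (at t)"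
      by (rule has_field_derivative_transform_within_open[where S = "{0<..}"]) (use True in auto)
    then show ?thesis using True by simp
  next
    case f: False
    have "((\<lambda>t. 0) has_real_derivative 0) (at t)" by simp
    then have "((\<lambda>t. (max 0 t)\<^sup>2) has_real_derivative 0) (at t)"
      by (rule has_field_derivative_transform_within_open[where S = "{..<0}"]) (use f False in auto)
    then show ?thesis using f by simp
  qed
qed

text \<open>The integrand is the i-th partial derivative of \<open>(w x)\<^sup>2 * F x\<close>,
  which is continuously differentiable and vanishes outside the unit ball.\<close>

lemma integral_weighted_divergence:
  fixes F :: "real ^ 'n \<Rightarrow> complex"
  assumes F: "polynomial_function F"
  defines "w \<equiv> \<lambda>x :: real ^ 'n. max 0 (1 - (norm x)\<^sup>2)"
  shows "(\<integral>x. of_real ((w x)\<^sup>2) * partial_deriv i F x - of_real (4 * w x * x $ i) * F x \<partial>lborel) = 0"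
proof (rule integral_directional_derivative_zero[where \<Phi> = "\<lambda>x. of_real ((w x)\<^sup>2) * F x" and e = "axis i 1"])
  have c: "continuous_on UNIV w" unfolding w_def by (intro continuous_intros)
  have cF: "continuous_on UNIV F" "continuous_on UNIV (partial_deriv i F)"
    using F polynomial_function_partial_deriv[OF F] by (auto intro: continuous_on_polymonial_function)
  show "continuous_on UNIV (\<lambda>x. of_real ((w x)\<^sup>2) * F x)"
    by (intro continuous_intros c cF)
  show "continuous_on UNIV (\<lambda>x. of_real ((w x)\<^sup>2) * partial_deriv i F x - of_real (4 * w x * x $ i) * F x)"
    by (intro continuous_intros c cF)
  have w0: "w x = 0" if "1 \<le> norm x" for x
    using that power_mono[of 1 "norm x" 2] by (simp add: w_def)
  show "of_real ((w x)\<^sup>2) * F x = 0" "of_real ((w x)\<^sup>2) * partial_deriv i F x - of_real (4 * w x * x $ i) * F x = 0"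
    if "1 \<le> norm x" for x
    using w0[OF that] by simp_all
  show "norm (axis i 1 :: real ^ 'n) \<le> 1" by simp
  fix x :: "real ^ 'n" and t :: real
  let ?z = "x + t *\<^sub>R axis i 1"
  have "((\<lambda>s. 1 - (norm (x + s *\<^sub>R axis i 1))\<^sup>2) has_real_derivative - 2 * ?z $ i) (at t)"
  proof -
    have "(norm (x + s *\<^sub>R axis i 1))\<^sup>2 = (norm x)\<^sup>2 + 2 * s * x $ i + s\<^sup>2" for s
      unfolding power2_norm_eq_inner
      by (simp add: inner_add_left inner_add_right inner_axis inner_axis' power2_eq_square algebra_simps)
    then show ?thesis by (auto intro!: derivative_eq_intros)
  qed
  then have "((\<lambda>s. (w (x + s *\<^sub>R axis i 1))\<^sup>2) has_real_derivative 2 * w ?z * (- 2 * ?z $ i)) (at t)"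
    unfolding w_def by (rule DERIV_chain2[where f = "\<lambda>t. (max 0 t)\<^sup>2", OF max_0_square_has_derivative])
  then have "((\<lambda>s. complex_of_real ((w (x + s *\<^sub>R axis i 1))\<^sup>2)) has_vector_derivative of_real (2 * w ?z * (- 2 * ?z $ i))) (at t)"
    by (intro has_vector_derivative_of_real) (simp add: has_real_derivative_iff_has_vector_derivative)
  from has_vector_derivative_mult[OF this has_vector_derivative_partial[OF F]]
  show "((\<lambda>s. of_real ((w (x + s *\<^sub>R axis i 1))\<^sup>2) * F (x + s *\<^sub>R axis i 1)) has_vector_derivative
      of_real ((w ?z)\<^sup>2) * partial_deriv i F ?z - of_real (4 * w ?z * ?z $ i) * F ?z) (at t)"
    by (rule has_vector_derivative_eq_rhs) (simp add: algebra_simps)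
qed

lemma integrable_weight_mult:
  fixes G :: "real ^ 'n \<Rightarrow> complex" and w :: "real ^ 'n \<Rightarrow> real"
  assumes "continuous_on UNIV G" "continuous_on UNIV w" "\<And>x. 1 \<le> norm x \<Longrightarrow> w x = 0"
  shows "integrable lborel (\<lambda>x. of_real (w x) * G x)"
proof -
  have "integrable lborel (\<lambda>x. indicator (cball 0 1) x *\<^sub>R (of_real (w x) * G x))"
    by (intro borel_integrable_compact continuous_intros)
      (auto intro: continuous_on_subset[OF assms(1)] continuous_on_subset[OF assms(2)])
  moreover have "(\<lambda>x. indicator (cball 0 1) x *\<^sub>R (of_real (w x) * G x)) = (\<lambda>x. of_real (w x) * G x)"
    using assms(3) by (auto simp: indicator_def not_le)
  ultimately show ?thesis by simp
qed

text \<open>Green's formula with the weight \<open>(1 - |x|\<^sup>2)\<^sub>+\<^sup>2\<close>, which replaces the boundary term by an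
  integral over the ball.\<close>

lemma harmonic_weighted_orthogonal:
  fixes p q :: "real ^ 'n \<Rightarrow> complex"
  assumes p: "polynomial_function p" "\<And>t x. p (t *\<^sub>R x) = of_real (t ^ a) * p x" "\<And>x. laplacian p x = 0"
    and q: "polynomial_function q" "\<And>t x. q (t *\<^sub>R x) = of_real (t ^ b) * q x" "\<And>x. laplacian q x = 0"
    and "a \<noteq> b"
  shows "(\<integral>x. of_real (max 0 (1 - (norm x)\<^sup>2)) * (p x * q x) \<partial>lborel) = 0"
proof -
  define w :: "real ^ 'n \<Rightarrow> real" where "w x = max 0 (1 - (norm x)\<^sup>2)" for x
  have cw: "continuous_on UNIV w" unfolding w_def by (intro continuous_intros)
  have w0: "w x = 0" if "1 \<le> norm x" for x
    using that power_mono[of 1 "norm x" 2] by (simp add: w_def)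
  \<comment> \<open>The field F = q grad p - p grad q is divergence free because both functions are
    harmonic, and by Euler's relation x . F = (a - b) p q. Only the derivative of the weight
    survives, which leaves -4(a - b) times the wanted integral.\<close>
  define F where "F i x = partial_deriv i p x * q x - p x * partial_deriv i q x" for i x
  note pf = polynomial_function_partial_deriv polynomial_function_mult_complex polynomial_function_diff p(1) q(1)
  have F: "polynomial_function (F i)" for i
    unfolding F_def[abs_def] by (intro pf)
  have dF: "partial_deriv i (F i) x = partial_deriv i (partial_deriv i p) x * q x - p x * partial_deriv i (partial_deriv i q) x"
    for i x
    unfolding F_def[abs_def] by (subst partial_deriv_diff, (intro pf)+) (simp add: partial_deriv_mult pf)
  let ?I = "\<lambda>i x. of_real ((w x)\<^sup>2) * partial_deriv i (F i) x - of_real (4 * w x * x $ i) * F i x"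
  have int: "integrable lborel (?I i)" for i
    by (intro Bochner_Integration.integrable_diff integrable_weight_mult continuous_on_polymonial_function
        polynomial_function_partial_deriv F continuous_intros cw) (auto simp: w0)
  have sum_eq: "(\<Sum>i\<in>UNIV. ?I i x) = - (4 * (of_nat a - of_nat b)) * (of_real (w x) * (p x * q x))" for x
  proof -
    have 1: "(\<Sum>i\<in>UNIV. partial_deriv i (F i) x) = 0"
      using p(3)[of x] q(3)[of x]
      by (simp add: dF sum_subtractf sum_distrib_left[symmetric] sum_distrib_right[symmetric]
          laplacian_partial_deriv[OF p(1)] laplacian_partial_deriv[OF q(1)])
    have 2: "(\<Sum>i\<in>UNIV. of_real (x $ i) * F i x) = (of_nat a - of_nat b) * (p x * q x)"
    proof -
      have "(\<Sum>i\<in>UNIV. of_real (x $ i) * F i x) = (\<Sum>i\<in>UNIV. of_real (x $ i) * partial_deriv i p x) * q x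
          - p x * (\<Sum>i\<in>UNIV. of_real (x $ i) * partial_deriv i q x)"
        by (simp add: F_def sum_subtractf[symmetric] sum_distrib_left sum_distrib_right algebra_simps)
      also have "\<dots> = (of_nat a - of_nat b) * (p x * q x)"
        unfolding euler_homogeneous[OF p(1,2)] euler_homogeneous[OF q(1,2)] by (simp add: algebra_simps)
      finally show ?thesis .
    qed
    have "(\<Sum>i\<in>UNIV. ?I i x) = of_real ((w x)\<^sup>2) * (\<Sum>i\<in>UNIV. partial_deriv i (F i) x)
        - 4 * of_real (w x) * (\<Sum>i\<in>UNIV. of_real (x $ i) * F i x)"
      by (simp add: sum_subtractf sum_distrib_left mult_ac)
    then show ?thesis unfolding 1 2 by (simp add: algebra_simps)
  qed
  have "0 = (\<Sum>i\<in>UNIV. \<integral>x. ?I i x \<partial>lborel)"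
    using integral_weighted_divergence[OF F] by (simp add: w_def)
  also have "\<dots> = (\<integral>x. (\<Sum>i\<in>UNIV. ?I i x) \<partial>lborel)"
    using int by (subst Bochner_Integration.integral_sum) auto
  also have "\<dots> = (\<integral>x. - (4 * (of_nat a - of_nat b)) * (of_real (w x) * (p x * q x)) \<partial>lborel)"
    by (simp only: sum_eq)
  finally have "- (4 * (of_nat a - of_nat b)) * (\<integral>x. of_real (w x) * (p x * q x) \<partial>lborel) = (0 :: complex)"
    by simp
  moreover have "(of_nat a - of_nat b :: complex) \<noteq> 0" using \<open>a \<noteq> b\<close> by simp
  ultimately show ?thesis by (simp add: w_def)
qed

section \<open>From integrals over the ball to integrals over the sphere\<close>

lemma lborel_integral_scale:
  fixes f :: "'a::euclidean_space \<Rightarrow> complex"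
  assumes [measurable]: "f \<in> borel_measurable borel" and s: "s > 0"
  shows "(\<integral>x. f x \<partial>lborel) = s ^ DIM('a) *\<^sub>R (\<integral>x. f (s *\<^sub>R x) \<partial>lborel)"
proof -
  have "(\<integral>x. f x \<partial>lborel) = (\<integral>x. f x \<partial>density (distr lborel borel (\<lambda>x. 0 + s *\<^sub>R x)) (\<lambda>_. \<bar>s\<bar> ^ DIM('a)))"
    using s by (intro arg_cong[where f = "\<lambda>M. integral\<^sup>L M f"] lborel_affine) simp
  also have "\<dots> = (\<integral>x. \<bar>s\<bar> ^ DIM('a) *\<^sub>R f x \<partial>distr lborel borel (\<lambda>x. 0 + s *\<^sub>R x))"
    by (rule integral_density) auto
  also have "\<dots> = (\<integral>x. \<bar>s\<bar> ^ DIM('a) *\<^sub>R f (s *\<^sub>R x) \<partial>lborel)"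
    by (subst integral_distr) auto
  finally show ?thesis using s by simp
qed

lemma integral_ball_scale:
  fixes g :: "real ^ 'n \<Rightarrow> complex"
  assumes [measurable]: "g \<in> borel_measurable borel" and hom: "\<And>t x. t > 0 \<Longrightarrow> g (t *\<^sub>R x) = g x" and s: "s > 0"
  shows "(\<integral>x. indicator (ball 0 s) x *\<^sub>R g x \<partial>lborel) = s ^ CARD('n) *\<^sub>R (\<integral>x. indicator (ball 0 1) x *\<^sub>R g x \<partial>lborel)"
proof -
  have "indicator (ball 0 s) (s *\<^sub>R x) = (indicator (ball 0 1) x :: real)" for x :: "real ^ 'n"
    using s by (auto simp: indicator_def)
  moreover have "(\<lambda>x. indicator (ball 0 s) x *\<^sub>R g x) \<in> borel_measurable borel"
    by (intro borel_measurable_scaleR borel_measurable_indicator assms(1)) auto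
  ultimately show ?thesis
    by (subst lborel_integral_scale[OF _ s]) (auto simp: hom s)
qed

text \<open>The radial weight \<open>r\<^sup>a - r\<^bsup>a+2\<^esup>\<close> is written as minus the integral of its derivative over \<open>[r,1]\<close>.\<close>

lemma integral_radial_weight:
  fixes g :: "real ^ 'n \<Rightarrow> complex"
  assumes [measurable]: "g \<in> borel_measurable borel" and hom: "\<And>t x. t > 0 \<Longrightarrow> g (t *\<^sub>R x) = g x"
    and bound: "\<And>x. norm (g x) \<le> B"
  shows "\<exists>\<kappa>>0. (\<integral>x. (indicator (ball 0 1) x * (norm x ^ a - norm x ^ (a + 2))) *\<^sub>R g x \<partial>lborel)
    = \<kappa> *\<^sub>R (\<integral>x. indicator (ball 0 1) x *\<^sub>R g x \<partial>lborel)"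
proof -
  define n where "n = CARD('n)"
  have n: "n > 0" by (simp add: n_def)
  define H where "H = (\<integral>x. indicator (ball 0 1) x *\<^sub>R g x \<partial>lborel)"
  \<comment> \<open>The derivative of s^a - s^(a + 2), which vanishes at s = 1. For a = 0 the
    truncated exponent \<open>a - 1\<close> is harmless, as its coefficient is 0.\<close>
  define \<rho>' where "\<rho>' s = real a * s ^ (a - 1) - (real a + 2) * s ^ (a + 1)" for s :: real
  have [measurable]: "\<rho>' \<in> borel_measurable borel"
    unfolding \<rho>'_def[abs_def] by (intro borel_measurable_continuous_onI continuous_intros)
  define f where "f s x = (indicator {0..1} s * \<rho>' s * (if norm x < s then 1 else 0)) *\<^sub>R g x" for s :: real and x :: "real ^ 'n"
  have B: "0 \<le> B" using bound[of 0] norm_ge_zero order.trans by blast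
  have "integrable (lborel \<Otimes>\<^sub>M lborel) (case_prod f)"
  proof (rule Bochner_Integration.integrable_bound)
    have "emeasure lborel ({0..1::real} \<times> cball (0 :: real ^ 'n) 1) < \<infinity>"
      by (intro emeasure_bounded_finite bounded_Times) auto
    then have "integrable lborel (indicator ({0..1::real} \<times> cball (0 :: real ^ 'n) 1) :: _ \<Rightarrow> real)"
      by (intro integrable_real_indicator) (auto intro!: borel_closed closed_Times)
    then show "integrable (lborel \<Otimes>\<^sub>M lborel) (\<lambda>z. (real a + (real a + 2)) * B * indicator ({0..1::real} \<times> cball (0 :: real ^ 'n) 1) z)"
      by (simp add: lborel_prod)
    show "case_prod f \<in> borel_measurable (lborel \<Otimes>\<^sub>M lborel)"
    proof -
      have [measurable]: "(\<lambda>z. \<rho>' (fst z)) \<in> borel_measurable (lborel \<Otimes>\<^sub>M (lborel :: (real ^ 'n) measure))"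
        "(\<lambda>z. g (snd z)) \<in> borel_measurable ((lborel :: real measure) \<Otimes>\<^sub>M lborel)"
        "(\<lambda>z. indicator {0..1} (fst z) :: real) \<in> borel_measurable ((lborel :: real measure) \<Otimes>\<^sub>M (lborel :: (real ^ 'n) measure))"
        by (rule measurable_compose[OF measurable_fst] measurable_compose[OF measurable_snd];
            auto intro!: borel_measurable_indicator)+
      have "{z \<in> space ((lborel :: real measure) \<Otimes>\<^sub>M (lborel :: (real ^ 'n) measure)). norm (snd z) < fst z}
          \<in> sets (lborel \<Otimes>\<^sub>M lborel)"
        by (intro borel_measurable_less borel_measurable_norm measurable_compose[OF measurable_snd]
            measurable_compose[OF measurable_fst]) auto
      then have "(\<lambda>z. (indicator {0..1} (fst z) * \<rho>' (fst z) * (if norm (snd z) < fst z then 1 else 0)) *\<^sub>R g (snd z))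
          \<in> borel_measurable (lborel \<Otimes>\<^sub>M lborel)"
        by (intro borel_measurable_scaleR borel_measurable_times measurable_If) auto
      then show ?thesis by (simp add: f_def split_beta')
    qed
    have "norm (f s x) \<le> (real a + (real a + 2)) * B * indicator ({0..1} \<times> cball 0 1) (s, x)" for s x
    proof (cases "0 \<le> s \<and> s \<le> 1 \<and> norm x < s")
      case True
      have "\<bar>\<rho>' s\<bar> \<le> \<bar>real a * s ^ (a - 1)\<bar> + \<bar>(real a + 2) * s ^ (a + 1)\<bar>"
        unfolding \<rho>'_def by (rule abs_triangle_ineq4)
      also have "\<dots> \<le> real a * 1 + (real a + 2) * 1"
        using True power_le_one[of s "a - 1"] power_le_one[of s "a + 1"]
        by (intro add_mono) (auto simp: abs_mult intro!: mult_left_le)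
      finally have "\<bar>\<rho>' s\<bar> * norm (g x) \<le> (real a + (real a + 2)) * B"
        using bound[of x] by (intro mult_mono) auto
      then show ?thesis using True by (auto simp: f_def indicator_def)
    next
      case False
      then have "f s x = 0" by (auto simp: f_def indicator_def)
      then show ?thesis using B by simp
    qed
    then show "AE z in lborel \<Otimes>\<^sub>M lborel. norm (case_prod f z)
        \<le> norm ((real a + (real a + 2)) * B * indicator ({0..1} \<times> cball 0 1) z)"
      using B by (intro AE_I2) (auto simp: split_beta abs_mult)
  qed
  then have fub: "(\<integral>x. (\<integral>s. f s x \<partial>lborel) \<partial>lborel) = (\<integral>s. (\<integral>x. f s x \<partial>lborel) \<partial>lborel)"
    by (rule lborel_pair.Fubini_integral)
  have inner_x: "(\<integral>x. f s x \<partial>lborel) = (indicator {0..1} s * (\<rho>' s * s ^ n)) *\<^sub>R H" for s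
  proof (cases "0 < s \<and> s \<le> 1")
    case True
    have "(\<integral>x. f s x \<partial>lborel) = (\<integral>x. \<rho>' s *\<^sub>R (indicator (ball 0 s) x *\<^sub>R g x) \<partial>lborel)"
      using True by (intro Bochner_Integration.integral_cong) (auto simp: f_def indicator_def)
    also have "\<dots> = \<rho>' s *\<^sub>R (s ^ n *\<^sub>R H)"
    proof -
      have "(\<integral>x. indicator (ball 0 s) x *\<^sub>R g x \<partial>lborel) = s ^ n *\<^sub>R H"
        unfolding n_def H_def using True by (intro integral_ball_scale assms(1) hom) auto
      then show ?thesis by (simp only: integral_scaleR_right)
    qed
    also have "\<dots> = (indicator {0..1} s * (\<rho>' s * s ^ n)) *\<^sub>R H"
      using True by simp
    finally show ?thesis .
  next
    case False
    then consider "s \<notin> {0..1}" | "s = 0" by fastforce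
    then show ?thesis
    proof cases
      case 1
      then have "f s = (\<lambda>x. 0)" by (simp add: f_def[abs_def])
      then show ?thesis using 1 by simp
    next
      case 2
      then have "f s = (\<lambda>x. 0)" by (simp add: f_def[abs_def])
      then show ?thesis using 2 n by simp
    qed
  qed
  have inner_s: "(\<integral>s. f s x \<partial>lborel) = - ((indicator (ball 0 1) x * (norm x ^ a - norm x ^ (a + 2))) *\<^sub>R g x)" for x
  proof (cases "norm x < 1")
    case True
    define r where "r = norm x"
    have r: "0 \<le> r" "r < 1" using True by (auto simp: r_def)
    have "(\<integral>s. f s x \<partial>lborel) = (\<integral>s. (\<rho>' s * indicator {r..1} s) *\<^sub>R g x \<partial>lborel)"
      unfolding f_def using AE_lborel_singleton[of r] r
      by (intro integral_cong_AE) (auto simp: r_def[symmetric] indicator_def)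
    also have "\<dots> = (\<integral>s. \<rho>' s * indicator {r..1} s \<partial>lborel) *\<^sub>R g x"
    proof -
      have "integrable lborel (\<lambda>s. indicator {r..1} s *\<^sub>R \<rho>' s)"
        unfolding \<rho>'_def by (intro borel_integrable_compact continuous_intros) auto
      then show ?thesis by (subst integral_scaleR_left) (auto simp: mult.commute)
    qed
    also have "(\<integral>s. \<rho>' s * indicator {r..1} s \<partial>lborel) = (1 ^ a - 1 ^ (a + 2)) - (r ^ a - r ^ (a + 2))"
    proof (rule integral_FTC_Icc_real)
      show "((\<lambda>s. s ^ a - s ^ (a + 2)) has_real_derivative \<rho>' s) (at s)" for s
        using DERIV_diff[OF DERIV_pow[of a s] DERIV_pow[of "a + 2" s]]
        by (simp add: \<rho>'_def add.commute)
      show "isCont \<rho>' s" for s unfolding \<rho>'_def[abs_def] by (intro continuous_intros)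
    qed (use r in auto)
    finally show ?thesis using True by (simp add: r_def scaleR_minus_left[symmetric] del: scaleR_minus_left)
  next
    case False
    then have "f s x = 0" for s by (auto simp: f_def indicator_def)
    then show ?thesis using False by simp
  qed
  \<comment> \<open>Minus the integral of \<open>\<rho>' s * s ^ n\<close> over [0,1]. It is
    positive because a/(a + n) is strictly increasing in a.\<close>
  define \<kappa> where "\<kappa> = (real a + 2) / real (a + n + 2) - real a / real (a + n)"
  have "\<kappa> > 0"
  proof -
    have "real a / (a + n) < (real a + 2) / (a + n + 2)"
    proof -
      have "real a * (2 + (real a + real n)) < (real a + real n) * (real a + 2)"
        using n by (simp add: algebra_simps)
      then show ?thesis using n by (simp add: divide_less_eq less_divide_eq add_pos_pos add_nonneg_pos mult.commute)
    qed
    then show ?thesis by (simp add: \<kappa>_def)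
  qed
  moreover have "(\<integral>s. (indicator {0..1} s * (\<rho>' s * s ^ n)) *\<^sub>R H \<partial>lborel) = - (\<kappa> *\<^sub>R H)"
  proof -
    let ?F = "\<lambda>s :: real. real a * s ^ (a + n) / real (a + n) - (real a + 2) * s ^ (a + n + 2) / real (a + n + 2)"
    have "(\<integral>s. (\<rho>' s * s ^ n) * indicator {0..1} s \<partial>lborel) = ?F 1 - ?F 0"
    proof (rule integral_FTC_Icc_real)
      show "(?F has_real_derivative \<rho>' s * s ^ n) (at s)" for s
      proof -
        have "(?F has_real_derivative real a * (real (a + n) * s ^ (a + n - 1)) / real (a + n)
            - (real a + 2) * (real (a + n + 2) * s ^ (a + n + 2 - 1)) / real (a + n + 2)) (at s)"
          using DERIV_diff[OF DERIV_cdivide[OF DERIV_cmult[OF DERIV_pow[of "a + n" s], of "real a"], of "real (a + n)"]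
            DERIV_cdivide[OF DERIV_cmult[OF DERIV_pow[of "a + n + 2" s], of "real a + 2"], of "real (a + n + 2)"]]
          by (simp only: One_nat_def)
        moreover have "real a * (real (a + n) * s ^ (a + n - 1)) / real (a + n) = real a * (s ^ (a - 1) * s ^ n)"
          using n by (cases a) (auto simp: power_add)
        moreover have "(real a + 2) * (real (a + n + 2) * s ^ (a + n + 2 - 1)) / real (a + n + 2) = (real a + 2) * s ^ (a + 1) * s ^ n"
          by (simp add: power_add)
        ultimately show ?thesis by (simp only: \<rho>'_def left_diff_distrib mult.assoc)
      qed
      show "isCont (\<lambda>s. \<rho>' s * s ^ n) s" for s unfolding \<rho>'_def[abs_def] by (intro continuous_intros)
    qed auto
    moreover have "?F 1 - ?F 0 = - \<kappa>" using n by (simp add: \<kappa>_def)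
    moreover have "integrable lborel (\<lambda>s. indicator {0..1} s *\<^sub>R (\<rho>' s * s ^ n))"
      unfolding \<rho>'_def by (intro borel_integrable_compact continuous_intros) auto
    ultimately show ?thesis by (subst integral_scaleR_left) (auto simp: mult_ac)
  qed
  ultimately show ?thesis
    using fub by (intro exI[of _ \<kappa>]) (simp add: inner_x inner_s H_def[symmetric])
qed

lemma space_sphere_measure [simp]: "space sphere_measure = sphere 0 1"
  by (simp add: sphere_measure_def space_scale_measure space_restrict_space)

lemma sets_sphere_measure: "sets sphere_measure = sets (restrict_space borel (sphere 0 1))"
  by (simp add: sphere_measure_def)

lemma measurable_sgn_sphere:
  "sgn \<in> measurable (restrict_space lborel (ball 0 1 - {0 :: real ^ 'n})) (restrict_space borel (sphere 0 1))"
proof (rule measurable_restrict_space2)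
  show "sgn \<in> space (restrict_space lborel (ball 0 1 - {0})) \<rightarrow> sphere 0 1"
    by (auto simp: space_restrict_space norm_sgn)
  have "(sgn :: real ^ 'n \<Rightarrow> _) \<in> borel_measurable borel"
    unfolding sgn_div_norm[abs_def] by measurable
  then show "sgn \<in> borel_measurable (restrict_space lborel (ball 0 1 - {0 :: real ^ 'n}))"
    by (intro measurable_restrict_space1) simp
qed

lemma sphere_integral:
  fixes F :: "real ^ 'n \<Rightarrow> complex"
  assumes "F \<in> borel_measurable sphere_measure"
  shows "(\<integral>\<omega>. F \<omega> \<partial>sphere_measure) = CARD('n) *\<^sub>R (\<integral>x. indicator (ball 0 1 - {0}) x *\<^sub>R F (sgn x) \<partial>lborel)"
proof -
  let ?N = "distr (restrict_space lborel (ball 0 1 - {0 :: real ^ 'n})) (restrict_space borel (sphere 0 1)) sgn"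
  have "sphere_measure = density ?N (\<lambda>_. ennreal (CARD('n)))"
    unfolding sphere_measure_def
    by (rule measure_eqI) (auto simp: emeasure_density_const ennreal_of_nat_eq_real_of_nat)
  moreover have F: "F \<in> borel_measurable ?N"
    using assms by (simp add: measurable_def sets_sphere_measure space_restrict_space)
  moreover have "(\<integral>\<omega>. F \<omega> \<partial>density ?N (\<lambda>_. ennreal (CARD('n)))) = (\<integral>\<omega>. real CARD('n) *\<^sub>R F \<omega> \<partial>?N)"
    by (rule integral_density[OF F]) auto
  ultimately have "(\<integral>\<omega>. F \<omega> \<partial>sphere_measure) = (\<integral>\<omega>. real CARD('n) *\<^sub>R F \<omega> \<partial>?N)"
    by (simp only:)
  also have "\<dots> = real CARD('n) *\<^sub>R (\<integral>\<omega>. F \<omega> \<partial>?N)" by simp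
  also have "(\<integral>\<omega>. F \<omega> \<partial>?N) = (\<integral>x. F (sgn x) \<partial>restrict_space lborel (ball 0 1 - {0}))"
    using F by (intro integral_distr measurable_sgn_sphere) simp
  also have "\<dots> = (\<integral>x. indicator (ball 0 1 - {0}) x *\<^sub>R F (sgn x) \<partial>lborel)"
    by (rule integral_restrict_space) simp
  finally show ?thesis by simp
qed

lemma finite_measure_sphere: "finite_measure (sphere_measure :: (real ^ 'n) measure)"
proof (rule finite_measureI)
  let ?R = "restrict_space lborel (ball 0 1 - {0 :: real ^ 'n})"
  have "emeasure ?R (space ?R) = emeasure lborel (ball 0 1 - {0 :: real ^ 'n})"
    by (simp add: emeasure_restrict_space space_restrict_space)
  also have "\<dots> < \<infinity>" by (intro emeasure_bounded_finite) auto
  finally have "emeasure ?R (space ?R) < \<infinity>" .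
  moreover have "emeasure (sphere_measure :: (real ^ 'n) measure) (sphere 0 1) = of_nat CARD('n) * emeasure ?R (space ?R)"
  proof -
    have "sgn -` sphere 0 1 \<inter> space ?R = space ?R"
      by (auto simp: space_restrict_space norm_sgn)
    moreover have "(sphere 0 1 :: (real ^ 'n) set) \<in> sets (restrict_space borel (sphere 0 1))"
      by (simp add: sets_restrict_space_iff)
    ultimately show ?thesis
      by (simp add: sphere_measure_def emeasure_distr[OF measurable_sgn_sphere])
  qed
  ultimately show "emeasure (sphere_measure :: (real ^ 'n) measure) (space sphere_measure) \<noteq> \<infinity>"
    by (simp add: ennreal_mult_eq_top_iff)
qed

text \<open>The product of p and the conjugate of the second polynomial is |x|^(a + b) times a
  function \<open>g\<close> of the direction. Its weighted integral over the ball vanishes and is a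
  positive multiple of the integral of \<open>g\<close> over the ball; that integral, times the
  dimension, is the one over the sphere, since the surface measure is defined through cones.\<close>

lemma spherical_harmonics_orthogonal:
  fixes Y Y' :: "real ^ 'n \<Rightarrow> complex"
  assumes "Y \<in> spherical_harmonics a" "Y' \<in> spherical_harmonics b" "a \<noteq> b"
  shows "(\<integral>\<omega>. Y \<omega> * cnj (Y' \<omega>) \<partial>sphere_measure) = 0"
proof -
  obtain p where p: "polynomial_function p" "\<And>t x. p (t *\<^sub>R x) = of_real (t ^ a) * p x"
      "\<And>x. laplacian p x = 0" "\<And>\<omega>. norm \<omega> = 1 \<Longrightarrow> Y \<omega> = p \<omega>"
    using assms(1) by (auto simp: spherical_harmonics_def)
  obtain q' where q': "polynomial_function q'" "\<And>t x. q' (t *\<^sub>R x) = of_real (t ^ b) * q' x"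
      "\<And>x. laplacian q' x = 0" "\<And>\<omega>. norm \<omega> = 1 \<Longrightarrow> Y' \<omega> = q' \<omega>"
    using assms(2) by (auto simp: spherical_harmonics_def)
  define q where "q x = cnj (q' x)" for x
  have q: "polynomial_function q" "q (t *\<^sub>R x) = of_real (t ^ b) * q x" "laplacian q x = 0" for t x
  proof -
    show 1: "polynomial_function q" unfolding q_def[abs_def] by (rule polynomial_function_cnj[OF q'(1)])
    show "q (t *\<^sub>R x) = of_real (t ^ b) * q x" by (simp add: q_def q'(2))
    have "laplacian q x = cnj (laplacian q' x)"
      unfolding laplacian_partial_deriv[OF 1] laplacian_partial_deriv[OF q'(1)]
      by (simp add: q_def[abs_def] partial_deriv_cnj q'(1) polynomial_function_partial_deriv)
    then show "laplacian q x = 0" by (simp add: q'(3))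
  qed
  define h where "h x = p x * q x" for x
  define g where "g x = h (sgn x)" for x
  have ch: "continuous_on UNIV h"
    unfolding h_def[abs_def] using p(1) q(1)
    by (intro continuous_on_polymonial_function polynomial_function_mult_complex)
  have "(sgn :: real ^ 'n \<Rightarrow> _) \<in> borel_measurable borel"
    unfolding sgn_div_norm[abs_def] by measurable
  then have g [measurable]: "g \<in> borel_measurable borel"
    unfolding g_def[abs_def] using borel_measurable_continuous_onI[OF ch] by (rule measurable_compose)
  have ghom: "g (t *\<^sub>R x) = g x" if "t > 0" for t x
    using that by (simp add: g_def sgn_scaleR)
  have "bounded (h ` cball 0 1)"
    by (intro compact_imp_bounded compact_continuous_image continuous_on_subset[OF ch]) auto
  then obtain B where B: "\<And>x. x \<in> cball 0 1 \<Longrightarrow> norm (h x) \<le> B"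
    unfolding bounded_iff by fastforce
  have gB: "norm (g x) \<le> B" for x
    unfolding g_def by (rule B) (simp add: norm_sgn)
  have hg: "h x = of_real (norm x ^ (a + b)) * g x" if "x \<noteq> 0" for x
  proof -
    have x: "x = norm x *\<^sub>R sgn x" using that by (simp add: sgn_div_norm)
    have "h (norm x *\<^sub>R sgn x) = of_real (norm x ^ (a + b)) * g x"
      by (simp add: h_def g_def p(2) q(2) power_add)
    then show ?thesis using x by simp
  qed
  have "(\<integral>x. (indicator (ball 0 1) x * (norm x ^ (a + b) - norm x ^ (a + b + 2))) *\<^sub>R g x \<partial>lborel)
     = (\<integral>x. of_real (max 0 (1 - (norm x)\<^sup>2)) * h x \<partial>lborel)"
  proof (rule Bochner_Integration.integral_cong_AE)
    show "AE x in lborel. (indicator (ball 0 1) x * (norm x ^ (a + b) - norm x ^ (a + b + 2))) *\<^sub>R g x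
        = of_real (max 0 (1 - (norm x)\<^sup>2)) * h x"
      using AE_lborel_singleton[of 0]
    proof eventually_elim
      case (elim x)
      show ?case
      proof (cases "norm x < 1")
        case True
        then have "(norm x)\<^sup>2 \<le> 1" by (simp add: abs_square_le_1)
        then show ?thesis
          using True by (simp add: hg[OF elim] scaleR_conv_of_real power_add power2_eq_square algebra_simps)
      next
        case False
        then have "1 \<le> (norm x)\<^sup>2" using power_mono[of 1 "norm x" 2] by simp
        then show ?thesis using False by simp
      qed
    qed
    show "(\<lambda>x. of_real (max 0 (1 - (norm x)\<^sup>2)) * h x) \<in> borel_measurable lborel"
      using borel_measurable_continuous_onI[OF ch] by measurable
    show "(\<lambda>x. (indicator (ball 0 1) x * (norm x ^ (a + b) - norm x ^ (a + b + 2))) *\<^sub>R g x)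
        \<in> borel_measurable lborel"
      using g by (intro borel_measurable_scaleR borel_measurable_times borel_measurable_indicator
          borel_measurable_diff) auto
  qed
  also have "\<dots> = 0"
    unfolding h_def by (rule harmonic_weighted_orthogonal[OF p(1-3) q assms(3)])
  finally have "(\<integral>x. indicator (ball 0 1) x *\<^sub>R g x \<partial>lborel) = 0"
    using integral_radial_weight[OF g ghom gB, of "a + b"] by auto
  moreover have "(\<integral>x. indicator (ball 0 1 - {0}) x *\<^sub>R g x \<partial>lborel) = (\<integral>x. indicator (ball 0 1) x *\<^sub>R g x \<partial>lborel)"
    using AE_lborel_singleton[of 0]
    by (intro Bochner_Integration.integral_cong_AE) (auto simp: indicator_def elim: eventually_mono)
  moreover have "(\<integral>\<omega>. Y \<omega> * cnj (Y' \<omega>) \<partial>sphere_measure) = (\<integral>\<omega>. h \<omega> \<partial>sphere_measure)"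
    by (intro Bochner_Integration.integral_cong) (auto simp: h_def q_def p(4) q'(4))
  moreover have "h \<in> borel_measurable sphere_measure"
    using borel_measurable_continuous_onI[OF ch]
    by (simp add: measurable_cong_sets[OF sets_sphere_measure refl] measurable_restrict_space1)
  ultimately show ?thesis
    by (simp add: sphere_integral g_def)
qed

section \<open>Separated functions on the Grushin sphere\<close>

lemma L2_iff: "f \<in> L2 M \<longleftrightarrow> f \<in> borel_measurable M \<and> integrable M (\<lambda>z. (cmod (f z))\<^sup>2)"
  by (simp add: L2_def)

lemma L2_cmult:
  assumes "f \<in> L2 M"
  shows "(\<lambda>z. c * f z) \<in> L2 M"
  using assms by (auto simp: L2_iff norm_mult power_mult_distrib)

lemma L2_add:
  assumes f: "f \<in> L2 M" and g: "g \<in> L2 M"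
  shows "(\<lambda>z. f z + g z) \<in> L2 M"
  unfolding L2_iff
proof
  show m: "(\<lambda>z. f z + g z) \<in> borel_measurable M"
    using f g by (auto simp: L2_iff)
  have "integrable M (\<lambda>z. 2 * (cmod (f z))\<^sup>2 + 2 * (cmod (g z))\<^sup>2)"
    using f g by (auto simp: L2_iff)
  then show "integrable M (\<lambda>z. (cmod (f z + g z))\<^sup>2)"
  proof (rule Bochner_Integration.integrable_bound)
    have "(cmod (f z + g z))\<^sup>2 \<le> 2 * (cmod (f z))\<^sup>2 + 2 * (cmod (g z))\<^sup>2" for z
    proof -
      have "(cmod (f z + g z))\<^sup>2 \<le> (cmod (f z) + cmod (g z))\<^sup>2"
        by (intro power_mono norm_triangle_ineq) auto
      also have "\<dots> \<le> 2 * (cmod (f z))\<^sup>2 + 2 * (cmod (g z))\<^sup>2"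
        using sum_squares_bound[of "cmod (f z)" "cmod (g z)"] by (simp add: power2_sum)
      finally show ?thesis .
    qed
    then show "AE z in M. norm ((cmod (f z + g z))\<^sup>2) \<le> norm (2 * (cmod (f z))\<^sup>2 + 2 * (cmod (g z))\<^sup>2)"
      by simp
    show "(\<lambda>z. (cmod (f z + g z))\<^sup>2) \<in> borel_measurable M"
      using m by measurable
  qed
qed

lemma L2_sum:
  assumes "finite I" "\<And>i. i \<in> I \<Longrightarrow> f i \<in> L2 M"
  shows "(\<lambda>z. \<Sum>i\<in>I. f i z) \<in> L2 M"
  using assms
proof (induction I rule: finite_induct)
  case empty
  show ?case by (simp add: L2_iff)
next
  case (insert i I)
  then show ?case using L2_add[of "f i" M] by simp
qed

lemma L2_norm_inner: "(\<integral>z. f z * cnj (f z) \<partial>M) = of_real (\<integral>z. (cmod (f z))\<^sup>2 \<partial>M)"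
  by (simp add: complex_norm_square[symmetric] flip: integral_complex_of_real)

lemma nn_integral_L2:
  assumes "f \<in> L2 M"
  shows "(\<integral>\<^sup>+z. ennreal ((cmod (f z))\<^sup>2) \<partial>M) = ennreal (\<integral>z. (cmod (f z))\<^sup>2 \<partial>M)"
  using assms by (intro nn_integral_eq_integral) (auto simp: L2_iff)

text \<open>With \<open>S\<close> the sum on the left, the bound comes from expanding \<open>\<parallel>g - S/B\<parallel>\<^sup>2 \<ge> 0\<close>.\<close>

lemma orthogonal_expansion_bound:
  fixes F :: "'i \<Rightarrow> 'a \<Rightarrow> complex"
  assumes fin: "finite I" and F: "\<And>i. i \<in> I \<Longrightarrow> F i \<in> L2 M"
    and orth: "\<And>i j. i \<in> I \<Longrightarrow> j \<in> I \<Longrightarrow> i \<noteq> j \<Longrightarrow> (\<integral>z. F i z * cnj (F j z) \<partial>M) = 0"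
    and norm: "\<And>i. i \<in> I \<Longrightarrow> (\<integral>z. (cmod (F i z))\<^sup>2 \<partial>M) \<le> B" and B: "B > 0"
    and g: "g \<in> L2 M"
  defines "c \<equiv> \<lambda>i. \<integral>z. g z * cnj (F i z) \<partial>M"
  shows "(\<integral>\<^sup>+z. ennreal ((cmod (\<Sum>i\<in>I. c i * F i z))\<^sup>2) \<partial>M)
    \<le> ennreal (B\<^sup>2) * (\<integral>\<^sup>+z. ennreal ((cmod (g z))\<^sup>2) \<partial>M)"
proof -
  define S where "S z = (\<Sum>i\<in>I. c i * F i z)" for z
  define b where "b i = (\<integral>z. (cmod (F i z))\<^sup>2 \<partial>M)" for i
  define N where "N = (\<Sum>i\<in>I. (cmod (c i))\<^sup>2)"
  define T where "T = (\<Sum>i\<in>I. (cmod (c i))\<^sup>2 * b i)"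
  define G where "G = (\<integral>z. (cmod (g z))\<^sup>2 \<partial>M)"
  have S: "S \<in> L2 M"
    unfolding S_def[abs_def] by (intro L2_sum L2_cmult F fin)
  have gS: "(\<integral>z. g z * cnj (S z) \<partial>M) = of_real N"
  proof -
    have "(\<integral>z. g z * cnj (S z) \<partial>M) = (\<integral>z. (\<Sum>i\<in>I. cnj (c i) * (g z * cnj (F i z))) \<partial>M)"
      by (simp add: S_def sum_distrib_left mult_ac)
    also have "\<dots> = (\<Sum>i\<in>I. cnj (c i) * c i)"
      unfolding c_def by (subst Bochner_Integration.integral_sum) (auto intro!: L2_mult_integrable F g)
    also have "\<dots> = of_real N"
      unfolding N_def of_real_sum by (intro sum.cong refl) (simp only: complex_norm_square mult.commute)
    finally show ?thesis .
  qed
  have SS: "(\<integral>z. S z * cnj (S z) \<partial>M) = of_real T"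
  proof -
    have int: "integrable M (\<lambda>z. F i z * cnj (F j z))" if "i \<in> I" "j \<in> I" for i j
      using that by (intro L2_mult_integrable F)
    have "(\<integral>z. S z * cnj (S z) \<partial>M) = (\<integral>z. (\<Sum>i\<in>I. \<Sum>j\<in>I. c i * cnj (c j) * (F i z * cnj (F j z))) \<partial>M)"
      by (simp add: S_def sum_product mult_ac)
    also have "\<dots> = (\<Sum>i\<in>I. \<Sum>j\<in>I. c i * cnj (c j) * (\<integral>z. F i z * cnj (F j z) \<partial>M))"
      using int by (subst Bochner_Integration.integral_sum)
        (auto intro!: Bochner_Integration.integrable_sum simp: Bochner_Integration.integral_sum)
    also have "\<dots> = (\<Sum>i\<in>I. \<Sum>j\<in>I. if i = j then c i * cnj (c i) * of_real (b i) else 0)"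
      by (intro sum.cong refl) (auto simp: orth b_def L2_norm_inner)
    also have "\<dots> = (\<Sum>i\<in>I. c i * cnj (c i) * of_real (b i))"
      using fin by simp
    also have "\<dots> = of_real T"
      by (simp only: T_def of_real_sum of_real_mult complex_norm_square)
    finally show ?thesis .
  qed
  have "0 \<le> G - 2 * N / B + T / B\<^sup>2"
  proof -
    have D: "(\<lambda>z. g z + of_real (- 1 / B) * S z) \<in> L2 M"
      by (intro L2_add L2_cmult g S)
    have i: "integrable M (\<lambda>z. g z * cnj (g z))" "integrable M (\<lambda>z. g z * cnj (S z))"
      "integrable M (\<lambda>z. S z * cnj (g z))" "integrable M (\<lambda>z. S z * cnj (S z))"
      by (intro L2_mult_integrable g S)+
    have Sg: "(\<integral>z. S z * cnj (g z) \<partial>M) = of_real N"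
    proof -
      have "(\<integral>z. S z * cnj (g z) \<partial>M) = (\<integral>z. cnj (g z * cnj (S z)) \<partial>M)" by (simp add: mult.commute)
      also have "\<dots> = cnj (\<integral>z. g z * cnj (S z) \<partial>M)" by (rule Bochner_Integration.integral_cnj)
      finally show ?thesis using gS by simp
    qed
    have "of_real (\<integral>z. (cmod (g z + of_real (- 1 / B) * S z))\<^sup>2 \<partial>M)
      = (\<integral>z. (g z + of_real (- 1 / B) * S z) * cnj (g z + of_real (- 1 / B) * S z) \<partial>M)"
      by (rule L2_norm_inner[symmetric])
    also have "\<dots> = (\<integral>z. g z * cnj (g z) + of_real (- 1 / B) * (g z * cnj (S z))
        + of_real (- 1 / B) * (S z * cnj (g z)) + of_real (1 / B\<^sup>2) * (S z * cnj (S z)) \<partial>M)"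
      by (intro Bochner_Integration.integral_cong refl) (simp add: algebra_simps power2_eq_square)
    also have "\<dots> = of_real G + of_real (- 1 / B) * of_real N + of_real (- 1 / B) * of_real N + of_real (1 / B\<^sup>2) * of_real T"
      using i L2_norm_inner[of M g] by (simp add: gS SS Sg G_def)
    also have "\<dots> = of_real (G - 2 * N / B + T / B\<^sup>2)"
      by simp
    finally have "(\<integral>z. (cmod (g z + of_real (- 1 / B) * S z))\<^sup>2 \<partial>M) = G - 2 * N / B + T / B\<^sup>2"
      by (simp only: of_real_eq_iff)
    moreover have "0 \<le> (\<integral>z. (cmod (g z + of_real (- 1 / B) * S z))\<^sup>2 \<partial>M)"
      by (intro Bochner_Integration.integral_nonneg) simp
    ultimately show ?thesis by linarith
  qed
  moreover have TB: "T \<le> B * N"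
  proof -
    have "T \<le> (\<Sum>i\<in>I. B * (cmod (c i))\<^sup>2)"
      unfolding T_def mult.commute[of B] by (intro sum_mono mult_left_mono) (auto simp: b_def norm)
    then show ?thesis by (simp add: N_def sum_distrib_left)
  qed
  moreover have "T / B\<^sup>2 \<le> N / B"
    using divide_right_mono[OF TB, of "B\<^sup>2"] B by (simp add: power2_eq_square)
  moreover have "2 * N / B = N / B + N / B" by simp
  ultimately have "N / B \<le> G" by linarith
  then have "B * N \<le> B\<^sup>2 * G"
    using B mult_left_mono[of "N / B" G "B\<^sup>2"] by (simp add: power2_eq_square)
  with TB have "T \<le> B\<^sup>2 * G" by linarith
  moreover have "(\<integral>z. (cmod (S z))\<^sup>2 \<partial>M) = T"
    using SS unfolding L2_norm_inner by (simp only: of_real_eq_iff)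
  ultimately show ?thesis
    using nn_integral_L2[OF S] nn_integral_L2[OF g]
    by (simp add: S_def G_def flip: ennreal_mult')
qed

lemma (in pair_sigma_finite)
  fixes f :: "'a \<Rightarrow> 'c::{real_normed_field, banach, second_countable_topology}"
  assumes f: "integrable M1 f" and g: "integrable M2 g"
  shows integrable_product: "integrable (M1 \<Otimes>\<^sub>M M2) (\<lambda>z. f (fst z) * g (snd z))"
    and integral_product: "(\<integral>z. f (fst z) * g (snd z) \<partial>(M1 \<Otimes>\<^sub>M M2)) = (\<integral>x. f x \<partial>M1) * (\<integral>y. g y \<partial>M2)"
proof -
  have [measurable]: "f \<in> borel_measurable M1" "g \<in> borel_measurable M2"
    using f g by auto
  have "integrable (M1 \<Otimes>\<^sub>M M2) (case_prod (\<lambda>x y. f x * g y))"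
  proof (rule Fubini_integrable)
    show "case_prod (\<lambda>x y. f x * g y) \<in> borel_measurable (M1 \<Otimes>\<^sub>M M2)" by measurable
    show "integrable M1 (\<lambda>x. \<integral>y. norm (case (x, y) of (x, y) \<Rightarrow> f x * g y) \<partial>M2)"
      using f by (simp add: norm_mult)
    show "AE x in M1. integrable M2 (\<lambda>y. case (x, y) of (x, y) \<Rightarrow> f x * g y)"
      using g by simp
  qed
  then show i: "integrable (M1 \<Otimes>\<^sub>M M2) (\<lambda>z. f (fst z) * g (snd z))"
    by (simp add: split_beta')
  show "(\<integral>z. f (fst z) * g (snd z) \<partial>(M1 \<Otimes>\<^sub>M M2)) = (\<integral>x. f x \<partial>M1) * (\<integral>y. g y \<partial>M2)"
    using integral_fst'[OF i] f g by simp
qed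

section \<open>Polar coordinates and the measure on the Grushin sphere\<close>

lemma grushin_norm_point:
  assumes "0 < \<phi>" "\<phi> < pi" "norm \<omega> = 1"
  shows "grushin_norm \<alpha> (grushin_point \<alpha> (\<phi>, \<omega>)) = 1"
proof -
  have s: "0 < sin \<phi>" using assms by (intro sin_gt_zero)
  have "(sin \<phi> powr (1 / (real \<alpha> + 1))) ^ (2 * (\<alpha> + 1)) = (sin \<phi>)\<^sup>2"
  proof -
    have "(sin \<phi> powr (1 / (real \<alpha> + 1))) ^ (2 * (\<alpha> + 1)) = sin \<phi> powr (1 / (real \<alpha> + 1) * real (2 * (\<alpha> + 1)))"
      using s by (subst powr_realpow[symmetric]) (simp_all only: powr_powr powr_gt_zero)
    also have "1 / (real \<alpha> + 1) * real (2 * (\<alpha> + 1)) = 2"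
      by (simp add: field_simps)
    finally show ?thesis using s by simp
  qed
  then show ?thesis
    using assms s by (simp add: grushin_norm_def grushin_point_def power_divide)
qed

lemma grushin_angle_point:
  assumes "0 < \<phi>" "\<phi> < pi" "norm \<omega> = 1"
  shows "grushin_angle \<alpha> (grushin_point \<alpha> (\<phi>, \<omega>)) = \<phi>"
  using assms by (simp add: grushin_angle_def grushin_norm_point) (simp add: grushin_point_def arccos_cos)

lemma grushin_dir_point:
  assumes "0 < \<phi>" "\<phi> < pi" "norm \<omega> = 1"
  shows "grushin_dir (grushin_point \<alpha> (\<phi>, \<omega>)) = \<omega>"
proof -
  have "0 < sin \<phi>" using assms by (intro sin_gt_zero)
  then show ?thesis
    using assms by (simp add: grushin_dir_def grushin_point_def sgn_scaleR sgn_div_norm)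
qed

lemma space_Grushin_measure: "space (Grushin_measure \<alpha>) = Grushin_sphere \<alpha>"
  by (simp add: Grushin_measure_def space_restrict_space)

lemma sets_Grushin_measure: "sets (Grushin_measure \<alpha>) = sets (restrict_space borel (Grushin_sphere \<alpha>))"
  by (simp add: Grushin_measure_def)

lemma grushin_point_measurable:
  "grushin_point \<alpha> \<in> measurable (Ipi \<Otimes>\<^sub>M (sphere_measure :: (real ^ 'n) measure))
     (restrict_space borel (Grushin_sphere \<alpha>))"
proof (rule measurable_restrict_space2)
  show "grushin_point \<alpha> \<in> space (Ipi \<Otimes>\<^sub>M sphere_measure) \<rightarrow> Grushin_sphere \<alpha>"
    by (auto simp: space_pair_measure space_restrict_space Grushin_sphere_def grushin_norm_point)
  have [measurable]: "(\<lambda>x. x) \<in> borel_measurable Ipi"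
    by (intro measurable_restrict_space1) simp
  have "(\<lambda>x. x) \<in> borel_measurable (restrict_space borel (sphere (0 :: real ^ 'n) 1))"
    by (intro measurable_restrict_space1) simp
  then have [measurable]: "(\<lambda>x. x) \<in> borel_measurable (sphere_measure :: (real ^ 'n) measure)"
    by (simp add: measurable_cong_sets[OF sets_sphere_measure refl])
  have [measurable]: "fst \<in> borel_measurable (Ipi \<Otimes>\<^sub>M (sphere_measure :: (real ^ 'n) measure))"
    "snd \<in> borel_measurable (Ipi \<Otimes>\<^sub>M (sphere_measure :: (real ^ 'n) measure))"
    by (rule measurable_compose[OF measurable_fst, of "\<lambda>x. x", simplified]
        measurable_compose[OF measurable_snd, of "\<lambda>x. x", simplified]; measurable)+
  have [measurable]: "(sin :: real \<Rightarrow> real) \<in> borel_measurable borel" "(cos :: real \<Rightarrow> real) \<in> borel_measurable borel"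
    by (intro borel_measurable_continuous_onI continuous_intros)+
  have "(\<lambda>z. ((sin (fst z) powr (1 / (real \<alpha> + 1))) *\<^sub>R snd z, cos (fst z) / (real \<alpha> + 1)))
      \<in> borel_measurable (Ipi \<Otimes>\<^sub>M (sphere_measure :: (real ^ 'n) measure))"
    by measurable
  then show "grushin_point \<alpha> \<in> borel_measurable (Ipi \<Otimes>\<^sub>M (sphere_measure :: (real ^ 'n) measure))"
    by (simp add: grushin_point_def split_beta')
qed

lemma pair_sigma_finite_Ipi_sphere: "pair_sigma_finite Ipi (sphere_measure :: (real ^ 'n) measure)"
proof -
  have "finite_measure Ipi"
    by (rule finite_measureI) (simp add: emeasure_restrict_space space_restrict_space)
  then have "sigma_finite_measure Ipi" by (rule finite_measure.axioms(1))
  moreover have "sigma_finite_measure (sphere_measure :: (real ^ 'n) measure)"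
    using finite_measure_sphere by (rule finite_measure.axioms(1))
  ultimately show ?thesis by (simp add: pair_sigma_finite_def)
qed

definition weight_exponent :: "nat \<Rightarrow> 'n::finite itself \<Rightarrow> real" where
  "weight_exponent \<alpha> _ = (real CARD('n) - 2) / (real \<alpha> + 1) + 1"

lemma
  fixes F :: "(real ^ 'n) \<times> real \<Rightarrow> 'b::{banach, second_countable_topology}"
  assumes F: "F \<in> borel_measurable (Grushin_measure \<alpha>)"
  shows Grushin_integrable: "integrable (Grushin_measure \<alpha>) F \<longleftrightarrow>
      integrable (Ipi \<Otimes>\<^sub>M sphere_measure)
        (\<lambda>z. sin (fst z) powr weight_exponent \<alpha> TYPE('n) *\<^sub>R F (grushin_point \<alpha> z))"
    and Grushin_integral: "(\<integral>z. F z \<partial>Grushin_measure \<alpha>) =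
      (\<integral>z. sin (fst z) powr weight_exponent \<alpha> TYPE('n) *\<^sub>R F (grushin_point \<alpha> z) \<partial>(Ipi \<Otimes>\<^sub>M sphere_measure))"
proof -
  let ?M = "Ipi \<Otimes>\<^sub>M (sphere_measure :: (real ^ 'n) measure)"
  let ?w = "\<lambda>z :: real \<times> (real ^ 'n). sin (fst z) powr weight_exponent \<alpha> TYPE('n)"
  have eq: "Grushin_measure \<alpha> = distr (density ?M (\<lambda>z. ennreal (?w z)))
      (restrict_space borel (Grushin_sphere \<alpha>)) (grushin_point \<alpha>)"
    by (simp add: Grushin_measure_def weight_exponent_def split_beta')
  have F': "F \<in> borel_measurable (restrict_space borel (Grushin_sphere \<alpha>))"
    using F by (simp add: measurable_cong_sets[OF sets_Grushin_measure refl])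
  have gp: "grushin_point \<alpha> \<in> measurable (density ?M (\<lambda>z. ennreal (?w z))) (restrict_space borel (Grushin_sphere \<alpha>))"
    using grushin_point_measurable by simp
  have w: "?w \<in> borel_measurable ?M"
  proof -
    have "(\<lambda>x. sin x powr weight_exponent \<alpha> TYPE('n)) \<in> borel_measurable Ipi"
      by (intro Ipi_measurable continuous_intros)
    then show ?thesis by (rule measurable_compose[OF measurable_fst])
  qed
  have Fp: "(\<lambda>z. F (grushin_point \<alpha> z)) \<in> borel_measurable ?M"
    by (rule measurable_compose[OF grushin_point_measurable F'])
  show "integrable (Grushin_measure \<alpha>) F \<longleftrightarrow> integrable ?M (\<lambda>z. ?w z *\<^sub>R F (grushin_point \<alpha> z))"
    unfolding eq integrable_distr_eq[OF gp F'] by (rule integrable_density[OF Fp w]) simp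
  show "(\<integral>z. F z \<partial>Grushin_measure \<alpha>) = (\<integral>z. ?w z *\<^sub>R F (grushin_point \<alpha> z) \<partial>?M)"
    unfolding eq integral_distr[OF gp F'] by (rule integral_density[OF Fp w]) simp
qed

text \<open>The exponent is a separate parameter so that multiplication by a power of the sine of
  the angle stays within the class.\<close>

definition separated ::
    "nat \<Rightarrow> real \<Rightarrow> real poly \<Rightarrow> (real ^ 'n \<Rightarrow> complex) \<Rightarrow> (real ^ 'n) \<times> real \<Rightarrow> complex" where
  "separated \<alpha> p y Z z = of_real (sin (grushin_angle \<alpha> z) powr p * poly y (cos (grushin_angle \<alpha> z))) * Z (grushin_dir z)"

lemma separated_point:
  assumes "z \<in> space (Ipi \<Otimes>\<^sub>M sphere_measure)"
  shows "separated \<alpha> p y Z (grushin_point \<alpha> z) = of_real (sin (fst z) powr p * poly y (cos (fst z))) * Z (snd z)"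
  using assms by (cases z) (auto simp: space_pair_measure space_restrict_space separated_def
    grushin_angle_point grushin_dir_point)

lemma grushin_angle_measurable: "grushin_angle \<alpha> \<in> borel_measurable (Grushin_measure \<alpha>)"
proof -
  have "continuous_on (Grushin_sphere \<alpha>) (\<lambda>z :: (real ^ 'n) \<times> real. arccos ((real \<alpha> + 1) * snd z))"
  proof (intro continuous_on_arccos' continuous_intros ballI)
    fix z :: "(real ^ 'n) \<times> real" assume "z \<in> Grushin_sphere \<alpha>"
    \<comment> \<open>\<open>X\<close> is the power 2(\<alpha> + 1) of the Grushin norm, hence 1 on
      the sphere; this keeps the argument of \<open>arccos\<close> in [-1,1].\<close>
    define X where "X = norm (fst z) ^ (2 * (\<alpha> + 1)) + ((real \<alpha> + 1) * snd z)\<^sup>2"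
    have X: "0 \<le> X" by (simp add: X_def)
    have "X powr (1 / (2 * (real \<alpha> + 1))) = 1"
      using \<open>z \<in> Grushin_sphere \<alpha>\<close> by (simp add: Grushin_sphere_def grushin_norm_def X_def power_mult_distrib)
    then have "X powr (1 / (2 * (real \<alpha> + 1)) * (2 * (real \<alpha> + 1))) = 1"
      by (simp only: powr_powr[symmetric] powr_one_eq_one)
    then have "X = 1" using X by simp
    have "((real \<alpha> + 1) * snd z)\<^sup>2 \<le> 1"
      using \<open>X = 1\<close> zero_le_power[OF norm_ge_zero, of "fst z" "2 * (\<alpha> + 1)"] unfolding X_def by linarith
    then have "\<bar>(real \<alpha> + 1) * snd z\<bar> \<le> 1" by (simp only: abs_square_le_1)
    then show "-1 \<le> (real \<alpha> + 1) * snd z \<and> (real \<alpha> + 1) * snd z \<le> 1" by linarith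
  qed
  from borel_measurable_continuous_on_restrict[OF this]
  have "(\<lambda>z :: (real ^ 'n) \<times> real. arccos ((real \<alpha> + 1) * snd z)) \<in> borel_measurable (Grushin_measure \<alpha>)"
    by (simp add: measurable_cong_sets[OF sets_Grushin_measure refl])
  then show ?thesis
    by (rule measurable_cong[THEN iffD1, rotated])
      (simp add: space_Grushin_measure Grushin_sphere_def grushin_angle_def)
qed

text \<open>At the poles the direction is \<open>sgn 0 = 0\<close>, a point off the sphere where
  \<open>Z\<close> is arbitrary. The value \<open>Z 0\<close> is therefore split off as a constant
  on {0}.\<close>

lemma measurable_dir:
  fixes Z :: "real ^ 'n \<Rightarrow> complex"
  assumes "Z \<in> borel_measurable sphere_measure"
  shows "(\<lambda>z. Z (grushin_dir z)) \<in> borel_measurable (Grushin_measure \<alpha>)"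
proof -
  have "Z \<in> borel_measurable (restrict_space borel (sphere 0 1))"
    using assms by (simp add: measurable_cong_sets[OF sets_sphere_measure refl])
  then have Z: "(\<lambda>x. indicator (sphere 0 1) x *\<^sub>R Z x) \<in> borel_measurable borel"
    by (subst (asm) borel_measurable_restrict_space_iff) auto
  have s: "(sgn :: real ^ 'n \<Rightarrow> _) \<in> borel_measurable borel"
    unfolding sgn_div_norm[abs_def] by measurable
  have "(\<lambda>x. indicator (sphere 0 1) (sgn x) *\<^sub>R Z (sgn x) + indicator {0} x *\<^sub>R Z 0) \<in> borel_measurable borel"
    by (intro borel_measurable_add measurable_compose[OF s Z] borel_measurable_scaleR borel_measurable_indicator) auto
  moreover have "(\<lambda>x. indicator (sphere 0 1) (sgn x) *\<^sub>R Z (sgn x) + indicator {0} x *\<^sub>R Z 0) = (\<lambda>x. Z (sgn x))"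
    by (auto simp: indicator_def norm_sgn)
  ultimately have "(\<lambda>x. Z (sgn x)) \<in> borel_measurable borel" by simp
  moreover have "(fst :: (real ^ 'n) \<times> real \<Rightarrow> _) \<in> borel_measurable borel"
    by (intro borel_measurable_continuous_onI continuous_intros)
  ultimately have "(\<lambda>z :: (real ^ 'n) \<times> real. Z (sgn (fst z))) \<in> borel_measurable borel"
    by (rule measurable_compose[rotated])
  then show ?thesis
    by (simp add: grushin_dir_def measurable_cong_sets[OF sets_Grushin_measure refl] measurable_restrict_space1)
qed

lemma separated_measurable:
  assumes "Z \<in> borel_measurable sphere_measure"
  shows "separated \<alpha> p y Z \<in> borel_measurable (Grushin_measure \<alpha>)"
proof -
  have "(\<lambda>x. sin x powr p) \<in> borel_measurable borel"
    by (intro powr_real_measurable borel_measurable_continuous_onI continuous_intros)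
  moreover have "(\<lambda>x. poly y (cos x)) \<in> borel_measurable borel"
    by (intro borel_measurable_continuous_onI continuous_intros)
  ultimately have "(\<lambda>x. complex_of_real (sin x powr p * poly y (cos x))) \<in> borel_measurable borel"
    by measurable
  from measurable_compose[OF grushin_angle_measurable this] show ?thesis
    unfolding separated_def[abs_def] by (intro borel_measurable_times measurable_dir assms)
qed

text \<open>In polar coordinates the measure is a product, so Fubini separates the factors. The
  exponents of both functions and of the measure add up, and integrability depends on their sum
  only.\<close>

lemma separated_inner:
  fixes Z Z' :: "real ^ 'n \<Rightarrow> complex"
  assumes Z: "Z \<in> L2 sphere_measure" "Z' \<in> L2 sphere_measure"
    and p: "p + p' + weight_exponent \<alpha> TYPE('n) > -1"
  shows "(\<integral>z. separated \<alpha> p y Z z * cnj (separated \<alpha> p' y' Z' z) \<partial>Grushin_measure \<alpha>) =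
    of_real (\<integral>x. sin x powr (p + p' + weight_exponent \<alpha> TYPE('n)) * (poly y (cos x) * poly y' (cos x)) \<partial>Ipi)
      * (\<integral>\<omega>. Z \<omega> * cnj (Z' \<omega>) \<partial>sphere_measure)"
proof -
  interpret pair_sigma_finite Ipi "sphere_measure :: (real ^ 'n) measure"
    by (rule pair_sigma_finite_Ipi_sphere)
  let ?f = "\<lambda>x. sin x powr (p + p' + weight_exponent \<alpha> TYPE('n)) * (poly y (cos x) * poly y' (cos x))"
  have f: "integrable Ipi ?f"
    using p by (intro sin_powr_mult_integrable continuous_intros)
  have m: "(\<lambda>z. separated \<alpha> p y Z z * cnj (separated \<alpha> p' y' Z' z)) \<in> borel_measurable (Grushin_measure \<alpha>)"
    using Z by (intro borel_measurable_times separated_measurable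
      measurable_compose[OF separated_measurable borel_measurable_continuous_onI[OF continuous_on_cnj[OF continuous_on_id]]])
      (auto simp: L2_iff)
  have "(\<integral>z. separated \<alpha> p y Z z * cnj (separated \<alpha> p' y' Z' z) \<partial>Grushin_measure \<alpha>) =
    (\<integral>z. of_real (?f (fst z)) * (Z (snd z) * cnj (Z' (snd z))) \<partial>(Ipi \<Otimes>\<^sub>M sphere_measure))"
    unfolding Grushin_integral[OF m]
    by (intro Bochner_Integration.integral_cong refl)
      (simp add: separated_point scaleR_conv_of_real powr_add mult_ac)
  also have "\<dots> = (\<integral>x. complex_of_real (?f x) \<partial>Ipi) * (\<integral>\<omega>. Z \<omega> * cnj (Z' \<omega>) \<partial>sphere_measure)"
    using f Z by (intro integral_product integrable_of_real L2_mult_integrable)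
  finally show ?thesis by (simp only: integral_complex_of_real)
qed

lemma separated_L2:
  fixes Z :: "real ^ 'n \<Rightarrow> complex"
  assumes Z: "Z \<in> L2 sphere_measure" and p: "2 * p + weight_exponent \<alpha> TYPE('n) > -1"
  shows "separated \<alpha> p y Z \<in> L2 (Grushin_measure \<alpha>)"
proof -
  interpret pair_sigma_finite Ipi "sphere_measure :: (real ^ 'n) measure"
    by (rule pair_sigma_finite_Ipi_sphere)
  have m: "separated \<alpha> p y Z \<in> borel_measurable (Grushin_measure \<alpha>)"
    using Z by (intro separated_measurable) (simp add: L2_iff)
  then have m2: "(\<lambda>z. (cmod (separated \<alpha> p y Z z))\<^sup>2) \<in> borel_measurable (Grushin_measure \<alpha>)"
    by measurable
  have "integrable Ipi (\<lambda>x. sin x powr (2 * p + weight_exponent \<alpha> TYPE('n)) * (poly y (cos x))\<^sup>2)"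
    using p by (intro sin_powr_mult_integrable continuous_intros)
  then have "integrable (Ipi \<Otimes>\<^sub>M sphere_measure)
      (\<lambda>z. (sin (fst z) powr (2 * p + weight_exponent \<alpha> TYPE('n)) * (poly y (cos (fst z)))\<^sup>2) * (cmod (Z (snd z)))\<^sup>2)"
    using Z by (intro integrable_product) (simp_all add: L2_iff)
  then have "integrable (Ipi \<Otimes>\<^sub>M sphere_measure)
      (\<lambda>z. sin (fst z) powr weight_exponent \<alpha> TYPE('n) *\<^sub>R (cmod (separated \<alpha> p y Z (grushin_point \<alpha> z)))\<^sup>2)"
  proof (rule Bochner_Integration.integrable_cong[THEN iffD1, OF refl, rotated])
    fix z assume z: "z \<in> space (Ipi \<Otimes>\<^sub>M (sphere_measure :: (real ^ 'n) measure))"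
    have "sin (fst z) powr (2 * p) = (sin (fst z) powr p)\<^sup>2"
      by (simp add: power2_eq_square flip: powr_add)
    then show "(sin (fst z) powr (2 * p + weight_exponent \<alpha> TYPE('n)) * (poly y (cos (fst z)))\<^sup>2) * (cmod (Z (snd z)))\<^sup>2
      = sin (fst z) powr weight_exponent \<alpha> TYPE('n) *\<^sub>R (cmod (separated \<alpha> p y Z (grushin_point \<alpha> z)))\<^sup>2"
      by (simp add: separated_point[OF z] norm_mult power_mult_distrib powr_add mult_ac)
  qed
  with m m2 show ?thesis
    unfolding L2_iff by (simp add: Grushin_integrable[OF m2])
qed

section \<open>The projections\<close>

lemma gegenbauer_solution_gegenbauer_poly:
  assumes "\<nu> \<ge> 1 / 2"
  shows "gegenbauer_solution (gegenbauer_poly N \<nu>) N \<nu>"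
  using assms gegenbauer_ode[of \<nu>] degree_gegenbauer_poly by unfold_locales auto

definition gegenbauer_moment :: "nat \<Rightarrow> real \<Rightarrow> real \<Rightarrow> real" where
  "gegenbauer_moment N \<nu> p = (\<integral>x. sin x powr (2 * \<nu> + p) * (poly (gegenbauer_poly N \<nu>) (cos x))\<^sup>2 \<partial>Ipi)"

lemma gegenbauer_moment_integrable:
  assumes "2 * \<nu> + p > -1"
  shows "integrable Ipi (\<lambda>x. sin x powr (2 * \<nu> + p) * (poly (gegenbauer_poly N \<nu>) (cos x))\<^sup>2)"
  using assms by (intro sin_powr_mult_integrable continuous_intros)

lemma gegenbauer_moment_bound:
  assumes "\<beta> \<noteq> 1 / 2" "0 \<le> \<beta>" "\<beta> < 1" "\<delta> > 0" "\<nu> \<ge> 1 / 2"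
    and "\<nu> \<le> 1 \<or> 1 + \<delta> \<le> \<nu>" "\<nu> = 1 / 2 \<or> 1 / 2 + \<delta> \<le> \<nu>"
  shows "gegenbauer_moment N \<nu> (- 2 * \<beta>) \<le>
    (200 + 10 / \<delta> + 128 / (1 - \<beta>)) * profile_bound \<beta> (1 / (real N + \<nu> + 1)) * gegenbauer_moment N \<nu> 0"
proof -
  interpret gegenbauer_solution "gegenbauer_poly N \<nu>" N \<nu>
    using assms(5) by (rule gegenbauer_solution_gegenbauer_poly)
  show ?thesis
    using moment_bound[OF assms(1-4,6,7)] unfolding moment_def gegenbauer_moment_def .
qed

text \<open>Since sin x <= 1, a weight may be replaced by a more singular one; this steps over the
  excluded exponent 1/2 in the bound for \<open>grushin_psi\<close>.\<close>

lemma gegenbauer_moment_mono: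
  assumes "\<beta> \<le> \<beta>'" "\<beta>' < 1" "\<nu> \<ge> 1 / 2"
  shows "gegenbauer_moment N \<nu> (- 2 * \<beta>) \<le> gegenbauer_moment N \<nu> (- 2 * \<beta>')"
  unfolding gegenbauer_moment_def
proof (rule integral_mono)
  fix x assume "x \<in> space Ipi"
  then have "0 < sin x" "sin x \<le> 1" using sin_in_0_pi by (auto simp: space_restrict_space)
  then show "sin x powr (2 * \<nu> + - 2 * \<beta>) * (poly (gegenbauer_poly N \<nu>) (cos x))\<^sup>2
    \<le> sin x powr (2 * \<nu> + - 2 * \<beta>') * (poly (gegenbauer_poly N \<nu>) (cos x))\<^sup>2"
    using assms by (intro mult_right_mono powr_mono') auto
qed (rule gegenbauer_moment_integrable; use assms in simp)+

text \<open>A nonzero polynomial has finitely many roots and cos is injective on (0, pi), so the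
  integrand cannot vanish almost everywhere.\<close>

lemma gegenbauer_moment_0_pos:
  assumes "\<nu> \<ge> 1 / 2"
  shows "gegenbauer_moment N \<nu> 0 > 0"
proof -
  let ?f = "\<lambda>x. sin x powr (2 * \<nu> + 0) * (poly (gegenbauer_poly N \<nu>) (cos x))\<^sup>2"
  have i: "integrable Ipi ?f" using assms by (intro gegenbauer_moment_integrable) simp
  have "gegenbauer_moment N \<nu> 0 \<noteq> 0"
  proof
    assume "gegenbauer_moment N \<nu> 0 = 0"
    then have "AE x in Ipi. ?f x = 0"
      unfolding gegenbauer_moment_def using i by (subst (asm) integral_nonneg_eq_0_iff_AE) auto
    then have ae: "AE x in lborel. x \<in> {0<..<pi} \<longrightarrow> ?f x = 0"
      by (subst (asm) AE_restrict_space_iff) auto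
    define Z where "Z = {x \<in> {0<..<pi}. poly (gegenbauer_poly N \<nu>) (cos x) = 0}"
    have "finite {c. poly (gegenbauer_poly N \<nu>) c = 0}"
      using gegenbauer_poly_nonzero[of \<nu> N] assms by (intro poly_roots_finite) auto
    then have "finite (cos ` Z)" by (rule finite_subset[rotated]) (auto simp: Z_def)
    moreover have "inj_on cos Z"
      by (rule inj_onI, rule cos_inj_pi) (auto simp: Z_def)
    ultimately have "finite Z" by (rule finite_imageD)
    then have "AE x in lborel. x \<notin> Z"
      by (intro AE_not_in finite_imp_null_set_lborel)
    with ae have "AE x in lborel. x \<notin> {0<..<pi}"
    proof eventually_elim
      case (elim x)
      then show ?case using sin_gt_zero[of x] by (auto simp: Z_def)
    qed
    then have "{0<..<pi} \<in> null_sets lborel"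
      by (subst AE_iff_null_sets) auto
    then show False by (auto simp: null_sets_def)
  qed
  moreover have "gegenbauer_moment N \<nu> 0 \<ge> 0"
    unfolding gegenbauer_moment_def by (intro Bochner_Integration.integral_nonneg) simp
  ultimately show ?thesis by simp
qed

definition harmonic_order :: "nat \<Rightarrow> 'n::finite itself \<Rightarrow> nat \<Rightarrow> real" where
  "harmonic_order \<alpha> _ l = (2 * real l + real CARD('n) - 2) / (2 * (real \<alpha> + 1)) + 1 / 2"

lemma harmonic_order_ge: "CARD('n::finite) \<ge> 2 \<Longrightarrow> harmonic_order \<alpha> TYPE('n) l \<ge> 1 / 2"
  by (simp add: harmonic_order_def)

text \<open>The squared angular factor of the harmonic and the density of the measure combine to
  exactly sin^(2\<nu>). Hence the squared norm of the radial part is the moment of order 0.\<close>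

lemma harmonic_order_exponent:
  "2 * harmonic_order \<alpha> TYPE('n) l = 2 * (real l / (real \<alpha> + 1)) + weight_exponent \<alpha> TYPE('n::finite)"
proof -
  have "2 * ((2 * a + b - 2) / (2 * D) + 1 / 2) = 2 * (a / D) + ((b - 2) / D + 1)" for a b D :: real
    by (simp add: add_divide_distrib diff_divide_distrib)
  then show ?thesis
    unfolding harmonic_order_def weight_exponent_def .
qed

definition radial_moment :: "nat \<Rightarrow> 'n::finite itself \<Rightarrow> nat \<Rightarrow> nat \<Rightarrow> real \<Rightarrow> real" where
  "radial_moment \<alpha> n k l = gegenbauer_moment ((k - l) div (\<alpha> + 1)) (harmonic_order \<alpha> n l)"

lemma grushin_harmonic_separated:
  "grushin_harmonic \<alpha> Y k l p = separated \<alpha> (real l / (real \<alpha> + 1))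
     (gegenbauer_poly ((k - l) div (\<alpha> + 1)) (harmonic_order \<alpha> TYPE('n) l)) (Y l p :: real ^ 'n \<Rightarrow> complex)"
  by (rule ext) (simp add: grushin_harmonic_def separated_def poly_gegenbauer_poly harmonic_order_def)

lemma finite_grushin_index: "finite (grushin_index \<alpha> d k)"
proof (rule finite_subset)
  show "grushin_index \<alpha> d k \<subseteq> (SIGMA l:{..k}. {..d l})"
    by (auto simp: grushin_index_def)
qed auto

text \<open>After normalization the squared norm of a weighted basis element is a ratio of moments.
  The weight leaves the factor \<open>Y l p\<close> untouched, so orthogonality survives and
  \<open>orthogonal_expansion_bound\<close> applies.\<close>

lemma weighted_projection_bound:
  fixes Y :: "nat \<Rightarrow> nat \<Rightarrow> real ^ 'n \<Rightarrow> complex"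
  assumes n: "CARD('n) \<ge> 2" and Y: "spherical_harmonics_basis d Y"
    and \<beta>: "\<beta> < 1" and B: "B > 0"
    and moments: "\<And>l. l \<le> k \<Longrightarrow>
      radial_moment \<alpha> TYPE('n) k l (- 2 * \<beta>)
      \<le> B * radial_moment \<alpha> TYPE('n) k l 0"
    and g: "g \<in> L2 (Grushin_measure \<alpha>)"
  shows "(\<integral>\<^sup>+z. ennreal ((cmod (of_real (sin (grushin_angle \<alpha> z) powr (-\<beta>)) *
      grushin_proj \<alpha> d Y k (\<lambda>\<zeta>. of_real (sin (grushin_angle \<alpha> \<zeta>) powr (-\<beta>)) * g \<zeta>) z))\<^sup>2)
      \<partial>Grushin_measure \<alpha>)
    \<le> ennreal (B\<^sup>2) * (\<integral>\<^sup>+z. ennreal ((cmod (g z))\<^sup>2) \<partial>Grushin_measure \<alpha>)"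
proof -
  let ?M = "Grushin_measure \<alpha> :: ((real ^ 'n) \<times> real) measure"
  define w :: "(real ^ 'n) \<times> real \<Rightarrow> real" where "w z = sin (grushin_angle \<alpha> z) powr (-\<beta>)" for z
  define I where "I = grushin_index \<alpha> d k"
  have finI: "finite I" unfolding I_def by (rule finite_grushin_index)
  define N where "N l = (k - l) div (\<alpha> + 1)" for l
  define \<nu> where "\<nu> l = harmonic_order \<alpha> TYPE('n) l" for l
  define P where "P l = gegenbauer_poly (N l) (\<nu> l)" for l
  define m where "m l = gegenbauer_moment (N l) (\<nu> l) 0" for l
  have \<nu>: "\<nu> l \<ge> 1 / 2" for l unfolding \<nu>_def using n by (rule harmonic_order_ge)
  have m: "m l > 0" for l unfolding m_def by (rule gegenbauer_moment_0_pos[OF \<nu>])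
  define q where "q l = real l / (real \<alpha> + 1)" for l :: nat
  have q: "2 * q l + weight_exponent \<alpha> TYPE('n) = 2 * \<nu> l" for l
    unfolding q_def \<nu>_def by (rule harmonic_order_exponent[symmetric])
  have YL2: "Y l p \<in> L2 sphere_measure" and Ysph: "Y l p \<in> spherical_harmonics l" if "(l, p) \<in> I" for l p
    using Y that by (auto simp: spherical_harmonics_basis_def orthonormal_basis_def I_def grushin_index_def)
  have Yorth: "(\<integral>\<omega>. Y l p \<omega> * cnj (Y l' p' \<omega>) \<partial>sphere_measure) = (if l = l' \<and> p = p' then 1 else 0)"
    if "(l, p) \<in> I" "(l', p') \<in> I" for l p l' p'
  proof (cases "l = l'")
    case True
    then show ?thesis
      using Y that by (auto simp: spherical_harmonics_basis_def orthonormal_basis_def I_def grushin_index_def)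
  next
    case False
    then show ?thesis using spherical_harmonics_orthogonal[OF Ysph[OF that(1)] Ysph[OF that(2)]] by simp
  qed
  \<comment> \<open>The harmonic with index \<open>i\<close> times the sine of the angle to the
    power -r: r = 0 is unweighted, r = \<beta> weighted.\<close>
  define H where "H r i = separated \<alpha> (q (fst i) - r) (P (fst i)) (Y (fst i) (snd i))" for r and i :: "nat \<times> nat"
  have HL2: "H r i \<in> L2 ?M" if "i \<in> I" "r < 1" for r i
    unfolding H_def
  proof (rule separated_L2)
    show "Y (fst i) (snd i) \<in> L2 sphere_measure" using YL2 that by (cases i) auto
    show "2 * (q (fst i) - r) + weight_exponent \<alpha> TYPE('n) > -1"
      using q[of "fst i"] \<nu>[of "fst i"] that(2) by simp
  qed
  have Hinner: "(\<integral>z. H r i z * cnj (H r j z) \<partial>?M) = (if i = j then of_real (gegenbauer_moment (N (fst i)) (\<nu> (fst i)) (- 2 * r)) else 0)"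
    if ij: "i \<in> I" "j \<in> I" and r: "r < 1" for r i j
  proof -
    obtain l p l' p' where i: "i = (l, p)" and j: "j = (l', p')" by (cases i; cases j)
    have eq: "(\<integral>z. H r i z * cnj (H r j z) \<partial>?M) =
      of_real (\<integral>x. sin x powr ((q l - r) + (q l' - r) + weight_exponent \<alpha> TYPE('n)) * (poly (P l) (cos x) * poly (P l') (cos x)) \<partial>Ipi)
        * (\<integral>\<omega>. Y l p \<omega> * cnj (Y l' p' \<omega>) \<partial>sphere_measure)"
      unfolding H_def i j fst_conv snd_conv
    proof (rule separated_inner)
      show "Y l p \<in> L2 sphere_measure" "Y l' p' \<in> L2 sphere_measure" using YL2 ij i j by auto
      show "(q l - r) + (q l' - r) + weight_exponent \<alpha> TYPE('n) > -1"
        using q[of l] q[of l'] \<nu>[of l] \<nu>[of l'] r by simp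
    qed
    have e: "(q l - r) + (q l - r) + weight_exponent \<alpha> TYPE('n) = 2 * \<nu> l + - 2 * r"
      using q[of l] by simp
    show ?thesis
    proof (cases "i = j")
      case True
      then have "l' = l" "p' = p" by (simp_all add: i j)
      then show ?thesis
        using eq Yorth[of l p l p] ij
        by (simp only: e i j fst_conv P_def gegenbauer_moment_def power2_eq_square) simp
    next
      case False
      then show ?thesis using eq Yorth[of l p l' p'] ij by (auto simp: i j)
    qed
  qed
  obtain h where h: "bij_betw h {1..card I} I"
    using ex_bij_betw_nat_finite_1[OF finI] by blast
  have hI: "h j \<in> I" if "j \<in> {1..card I}" for j
    using h that by (auto simp: bij_betw_def)
  have hinj: "h i = h j \<longleftrightarrow> i = j" if "i \<in> {1..card I}" "j \<in> {1..card I}" for i j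
    by (rule inj_on_eq_iff[OF bij_betw_imp_inj_on[OF h] that])
  define M where "M j = sqrt (m (fst (h j)))" for j
  have M: "M j > 0" "M j * M j = m (fst (h j))" for j
    using m[of "fst (h j)"] by (auto simp: M_def)
  \<comment> \<open>The normalization is that of the unweighted case for every \<open>r\<close>, so
    \<open>E 0\<close> is the orthonormal basis and the squared norm of \<open>E \<beta> j\<close>
    is the ratio bounded by \<open>B\<close>.\<close>
  define E where "E r j z = of_real (1 / M j) * H r (h j) z" for r j z
  have EL2: "E r j \<in> L2 ?M" if "j \<in> {1..card I}" "r < 1" for r j
    unfolding E_def[abs_def] by (intro L2_cmult HL2 hI that)
  have Einner: "(\<integral>z. E r i z * cnj (E r j z) \<partial>?M)
      = (if i = j then of_real (gegenbauer_moment (N (fst (h j))) (\<nu> (fst (h j))) (- 2 * r) / m (fst (h j))) else 0)"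
    if ij: "i \<in> {1..card I}" "j \<in> {1..card I}" and r: "r < 1" for r i j
  proof -
    have "(\<integral>z. E r i z * cnj (E r j z) \<partial>?M) = (\<integral>z. of_real (1 / (M i * M j)) * (H r (h i) z * cnj (H r (h j) z)) \<partial>?M)"
      by (simp add: E_def mult_ac)
    also have "\<dots> = of_real (1 / (M i * M j)) * (\<integral>z. H r (h i) z * cnj (H r (h j) z) \<partial>?M)"
      by (rule integral_mult_right_zero)
    also have "\<dots> = (if i = j then of_real (gegenbauer_moment (N (fst (h j))) (\<nu> (fst (h j))) (- 2 * r) / m (fst (h j))) else 0)"
    proof (cases "i = j")
      case True
      have "complex_of_real (1 / (M j * M j)) * of_real (gegenbauer_moment (N (fst (h j))) (\<nu> (fst (h j))) (- 2 * r))
        = of_real (gegenbauer_moment (N (fst (h j))) (\<nu> (fst (h j))) (- 2 * r) / m (fst (h j)))"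
        unfolding M(2) by simp
      then show ?thesis
        using Hinner[OF hI[OF ij(1)] hI[OF ij(2)] r] hinj[OF ij] True by simp
    next
      case False
      then show ?thesis using Hinner[OF hI[OF ij(1)] hI[OF ij(2)] r] hinj[OF ij] by simp
    qed
    finally show ?thesis .
  qed
  define e where "e = E 0"
  define F where "F = E \<beta>"
  \<comment> \<open>This holds at the poles too: there the sine is 0, and
    \<open>0 powr p = 0\<close> makes both sides vanish.\<close>
  have wF: "of_real (w z) * e j z = F j z" for j z
    by (simp add: e_def F_def E_def H_def separated_def w_def powr_diff powr_minus divide_inverse mult_ac)
  have harm: "grushin_harmonic \<alpha> Y k (fst i) (snd i) = H 0 i" for i
    by (simp add: grushin_harmonic_separated H_def q_def P_def N_def \<nu>_def)
  have basis: "orthonormal_basis ?M (grushin_space \<alpha> d Y k) (card I) e"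
    unfolding orthonormal_basis_def
  proof (intro conjI ballI)
    fix j assume j: "j \<in> {1..card I}"
    have "e j \<in> grushin_space \<alpha> d Y k"
    proof -
      define c where "c l p = (if (l, p) = h j then complex_of_real (1 / M j) else 0)" for l p
      have "(\<Sum>(l, p)\<in>I. c l p * grushin_harmonic \<alpha> Y k l p z) = e j z" for z
      proof -
        have "(\<Sum>(l, p)\<in>I. c l p * grushin_harmonic \<alpha> Y k l p z) = (\<Sum>i\<in>I. if i = h j then of_real (1 / M j) * H 0 i z else 0)"
          by (intro sum.cong refl) (simp add: c_def harm[symmetric] split_beta')
        then show ?thesis using finI hI[OF j] by (simp add: e_def E_def)
      qed
      then show ?thesis unfolding grushin_space_def I_def by (auto intro!: exI[of _ c])
    qed
    moreover have "e j \<in> L2 ?M"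
      unfolding e_def by (intro EL2 j) simp
    ultimately show "e j \<in> grushin_space \<alpha> d Y k \<inter> L2 ?M" by simp
  next
    fix i j assume ij: "i \<in> {1..card I}" "j \<in> {1..card I}"
    show "(\<integral>z. e i z * cnj (e j z) \<partial>?M) = (if i = j then 1 else 0)"
      using Einner[OF ij, of 0] m[of "fst (h j)"] by (auto simp: e_def m_def)
  next
    fix f assume "f \<in> grushin_space \<alpha> d Y k"
    then obtain c where f: "f = (\<lambda>z. \<Sum>(l, p)\<in>I. c l p * grushin_harmonic \<alpha> Y k l p z)"
      unfolding grushin_space_def I_def by blast
    have "f z = (\<Sum>j = 1..card I. (c (fst (h j)) (snd (h j)) * of_real (M j)) * e j z)" for z
    proof -
      have "f z = (\<Sum>i\<in>I. c (fst i) (snd i) * H 0 i z)"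
        by (simp add: f split_beta' harm)
      also have "\<dots> = (\<Sum>j = 1..card I. c (fst (h j)) (snd (h j)) * H 0 (h j) z)"
        by (rule sum.reindex_bij_betw[OF h, symmetric])
      also have "\<dots> = (\<Sum>j = 1..card I. (c (fst (h j)) (snd (h j)) * of_real (M j)) * e j z)"
      proof (rule sum.cong[OF refl])
        fix j show "c (fst (h j)) (snd (h j)) * H 0 (h j) z = (c (fst (h j)) (snd (h j)) * of_real (M j)) * e j z"
          using M(1)[of j] by (simp add: e_def E_def)
      qed
      finally show ?thesis .
    qed
    then show "\<exists>c. \<forall>z\<in>space ?M. f z = (\<Sum>j = 1..card I. c j * e j z)"
      by (intro exI[of _ "\<lambda>j. c (fst (h j)) (snd (h j)) * of_real (M j)"]) auto
  qed
  have FL2: "F j \<in> L2 ?M" if "j \<in> {1..card I}" for j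
    unfolding F_def using \<beta> by (intro EL2 that)
  have Fnorm: "(\<integral>z. (cmod (F j z))\<^sup>2 \<partial>?M) \<le> B" if j: "j \<in> {1..card I}" for j
  proof -
    have "(\<integral>z. (cmod (F j z))\<^sup>2 \<partial>?M) = gegenbauer_moment (N (fst (h j))) (\<nu> (fst (h j))) (- 2 * \<beta>) / m (fst (h j))"
      using Einner[OF j j \<beta>] unfolding L2_norm_inner F_def by (simp only: simp_thms if_True of_real_eq_iff)
    moreover have "fst (h j) \<le> k"
      using hI[OF j] by (auto simp: I_def grushin_index_def)
    ultimately show ?thesis
      using moments[of "fst (h j)"] m[of "fst (h j)"] by (simp add: N_def \<nu>_def m_def divide_le_eq radial_moment_def)
  qed
  have proj: "of_real (w z) * grushin_proj \<alpha> d Y k (\<lambda>\<zeta>. of_real (w \<zeta>) * g \<zeta>) z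
      = (\<Sum>j = 1..card I. (\<integral>\<zeta>. g \<zeta> * cnj (F j \<zeta>) \<partial>?M) * F j z)" if z: "z \<in> space ?M" for z
  proof -
    \<comment> \<open>The weighted \<open>g\<close> need not be square integrable. In the kernel
      integral the weight is moved onto the basis elements, so only pairings of \<open>g\<close>
      with \<open>F j\<close> occur.\<close>
    have "grushin_proj \<alpha> d Y k (\<lambda>\<zeta>. of_real (w \<zeta>) * g \<zeta>) z
      = (\<integral>\<zeta>. (\<Sum>j = 1..card I. e j z * (g \<zeta> * cnj (F j \<zeta>))) \<partial>?M)"
      unfolding grushin_proj_def orth_proj_def
    proof (intro Bochner_Integration.integral_cong refl)
      fix \<zeta> assume \<zeta>: "\<zeta> \<in> space ?M"
      show "proj_kernel ?M (grushin_space \<alpha> d Y k) z \<zeta> * (of_real (w \<zeta>) * g \<zeta>) = (\<Sum>j = 1..card I. e j z * (g \<zeta> * cnj (F j \<zeta>)))"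
        unfolding proj_kernel_eq[OF basis z \<zeta>] kernel_of_def sum_distrib_right wF[symmetric]
        by (intro sum.cong refl) (simp add: mult_ac)
    qed
    also have "\<dots> = (\<Sum>j = 1..card I. e j z * (\<integral>\<zeta>. g \<zeta> * cnj (F j \<zeta>) \<partial>?M))"
      by (subst Bochner_Integration.integral_sum) (auto intro!: L2_mult_integrable g FL2)
    finally show ?thesis
      by (simp add: sum_distrib_left wF[symmetric] mult_ac)
  qed
  have "(\<integral>\<^sup>+z. ennreal ((cmod (of_real (w z) * grushin_proj \<alpha> d Y k (\<lambda>\<zeta>. of_real (w \<zeta>) * g \<zeta>) z))\<^sup>2) \<partial>?M)
    = (\<integral>\<^sup>+z. ennreal ((cmod (\<Sum>j = 1..card I. (\<integral>\<zeta>. g \<zeta> * cnj (F j \<zeta>) \<partial>?M) * F j z))\<^sup>2) \<partial>?M)"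
    by (intro nn_integral_cong) (simp add: proj)
  also have "\<dots> \<le> ennreal (B\<^sup>2) * (\<integral>\<^sup>+z. ennreal ((cmod (g z))\<^sup>2) \<partial>?M)"
    by (rule orthogonal_expansion_bound) (use FL2 Einner[OF _ _ \<beta>] Fnorm B g in \<open>auto simp: F_def\<close>)
  finally show ?thesis by (simp add: w_def)
qed

text \<open>As \<open>l\<close> varies, the order \<open>\<nu>\<close> runs through a discrete set; \<open>1 / (2(\<alpha> + 1))\<close> is its gap.\<close>

lemma harmonic_order_gap:
  fixes \<alpha> l :: nat
  assumes n: "CARD('n::finite) \<ge> 2"
  defines "\<delta> \<equiv> 1 / (2 * (real \<alpha> + 1))"
  shows "harmonic_order \<alpha> TYPE('n) l \<le> 1 \<or> 1 + \<delta> \<le> harmonic_order \<alpha> TYPE('n) l"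
    and "harmonic_order \<alpha> TYPE('n) l = 1 / 2 \<or> 1 / 2 + \<delta> \<le> harmonic_order \<alpha> TYPE('n) l"
proof -
  define t where "t = 2 * l + CARD('n) - 2"
  have t: "harmonic_order \<alpha> TYPE('n) l = real t * \<delta> + 1 / 2"
    using n by (simp add: harmonic_order_def t_def \<delta>_def of_nat_diff)
  have \<delta>: "\<delta> > 0" "(real \<alpha> + 1) * \<delta> = 1 / 2" by (auto simp: \<delta>_def)
  show "harmonic_order \<alpha> TYPE('n) l \<le> 1 \<or> 1 + \<delta> \<le> harmonic_order \<alpha> TYPE('n) l"
  proof (cases "t \<le> \<alpha> + 1")
    case True
    then have "real t * \<delta> \<le> (real \<alpha> + 1) * \<delta>" using \<delta> by (intro mult_right_mono) auto
    then show ?thesis using t \<delta> by simp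
  next
    case False
    then have "(real \<alpha> + 2) * \<delta> \<le> real t * \<delta>" using \<delta> by (intro mult_right_mono) auto
    then have "1 + \<delta> \<le> real t * \<delta> + 1 / 2" using \<delta>(2) by (simp add: algebra_simps)
    then show ?thesis using t by simp
  qed
  show "harmonic_order \<alpha> TYPE('n) l = 1 / 2 \<or> 1 / 2 + \<delta> \<le> harmonic_order \<alpha> TYPE('n) l"
  proof (cases "t = 0")
    case False
    then have "1 * \<delta> \<le> real t * \<delta>" using \<delta> by (intro mult_right_mono) auto
    then show ?thesis using t by simp
  qed (use t in simp)
qed

text \<open>The gap of the orders makes the constant of \<open>gegenbauer_moment_bound\<close>
  independent of \<open>l\<close> and \<open>k\<close>. What is left is L + 1 <= n' (k + 1), which
  turns the power of 1/(L + 1) into one of k + 1.\<close>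

lemma harmonic_moment_bound:
  assumes n: "CARD('n::finite) \<ge> 2" and \<beta>: "\<beta> \<noteq> 1 / 2" "0 \<le> \<beta>" "\<beta> < 1"
  shows "\<exists>C>0. \<forall>k l. l \<le> k \<longrightarrow>
    radial_moment \<alpha> TYPE('n) k l (- 2 * \<beta>)
    \<le> (if \<beta> < 1 / 2 then C else C * (real k + 1) powr (2 * \<beta> - 1))
      * radial_moment \<alpha> TYPE('n) k l 0"
proof -
  define \<delta> where "\<delta> = 1 / (2 * (real \<alpha> + 1))"
  \<comment> \<open>Chosen because N <= k and \<nu> <= k + n/2 give L + 1 <= 2k + n + 2, where n is
    the dimension.\<close>
  define n' where "n' = real CARD('n) + 2"
  define K where "K = 200 + 10 / \<delta> + 128 / (1 - \<beta>)"
  define C where "C = K * (2 / \<bar>1 - 2 * \<beta>\<bar> * n')"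
  have \<delta>: "\<delta> > 0" by (simp add: \<delta>_def)
  have K: "K > 0" using \<delta> \<beta> by (auto simp: K_def intro!: add_pos_pos)
  have n': "n' \<ge> 1" by (simp add: n'_def)
  have C: "C > 0" using K \<beta> n' by (simp add: C_def)
  show ?thesis
  proof (intro exI[of _ C] conjI allI impI C)
    fix k l :: nat assume l: "l \<le> k"
    define N where "N = (k - l) div (\<alpha> + 1)"
    define \<nu> where "\<nu> = harmonic_order \<alpha> TYPE('n) l"
    have \<nu>: "\<nu> \<ge> 1 / 2" unfolding \<nu>_def using n by (rule harmonic_order_ge)
    have L: "real N + \<nu> + 1 \<le> n' * (real k + 1)"
    proof -
      have "real N \<le> real k" unfolding N_def using div_le_dividend[of "k - l" "\<alpha> + 1"] by linarith
      moreover have "\<nu> \<le> (2 * real l + real CARD('n) - 2) / 2 + 1 / 2"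
        unfolding \<nu>_def harmonic_order_def using n by (intro add_right_mono divide_left_mono) auto
      ultimately have "real N + \<nu> + 1 \<le> 2 * real k + real CARD('n) + 2" using of_nat_mono[OF l, where 'a = real] of_nat_0_le_iff[of "CARD('n)", where 'a = real]
        by (simp add: field_simps)
      also have "\<dots> \<le> n' * (real k + 1)" by (simp add: n'_def algebra_simps)
      finally show ?thesis .
    qed
    have "gegenbauer_moment N \<nu> (- 2 * \<beta>) \<le> K * profile_bound \<beta> (1 / (real N + \<nu> + 1)) * gegenbauer_moment N \<nu> 0"
      unfolding K_def \<nu>_def
      by (rule gegenbauer_moment_bound[OF \<beta> \<delta>])
        (use harmonic_order_gap[OF n, of \<alpha> l] harmonic_order_ge[OF n, of \<alpha> l] in \<open>simp_all add: \<delta>_def\<close>)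
    also have "\<dots> \<le> (if \<beta> < 1 / 2 then C else C * (real k + 1) powr (2 * \<beta> - 1)) * gegenbauer_moment N \<nu> 0"
    proof (rule mult_right_mono)
      show "K * profile_bound \<beta> (1 / (real N + \<nu> + 1)) \<le> (if \<beta> < 1 / 2 then C else C * (real k + 1) powr (2 * \<beta> - 1))"
      proof (cases "\<beta> < 1 / 2")
        case True
        have "2 / \<bar>1 - 2 * \<beta>\<bar> * 1 \<le> 2 / \<bar>1 - 2 * \<beta>\<bar> * n'" using n' by (intro mult_left_mono) auto
        from mult_left_mono[OF this, of K] show ?thesis
          using True K by (simp only: profile_bound_def C_def if_True less_imp_le)
      next
        case False
        have "(1 / (real N + \<nu> + 1)) powr (1 - 2 * \<beta>) = (real N + \<nu> + 1) powr (2 * \<beta> - 1)"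
          using \<nu> by (simp add: powr_divide powr_minus_divide[symmetric])
        also have "\<dots> \<le> (n' * (real k + 1)) powr (2 * \<beta> - 1)"
          using False L \<nu> by (intro powr_mono2) auto
        also have "\<dots> = n' powr (2 * \<beta> - 1) * (real k + 1) powr (2 * \<beta> - 1)"
          using n' by (simp add: powr_mult)
        also have "\<dots> \<le> n' powr 1 * (real k + 1) powr (2 * \<beta> - 1)"
          using n' \<beta> by (intro mult_right_mono powr_mono) auto
        also have "n' powr 1 = n'" using n' by simp
        finally have "(2 / \<bar>1 - 2 * \<beta>\<bar>) * (1 / (real N + \<nu> + 1)) powr (1 - 2 * \<beta>)
            \<le> (2 / \<bar>1 - 2 * \<beta>\<bar>) * (n' * (real k + 1) powr (2 * \<beta> - 1))"
          by (intro mult_left_mono) auto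
        from mult_left_mono[OF this, of K] show ?thesis
          using False K by (simp only: profile_bound_def C_def if_False mult.assoc less_imp_le)
      qed
      show "0 \<le> gegenbauer_moment N \<nu> 0" using gegenbauer_moment_0_pos[OF \<nu>, of N] by simp
    qed
    finally show "radial_moment \<alpha> TYPE('n) k l (- 2 * \<beta>)
      \<le> (if \<beta> < 1 / 2 then C else C * (real k + 1) powr (2 * \<beta> - 1))
        * radial_moment \<alpha> TYPE('n) k l 0"
      by (simp only: N_def \<nu>_def radial_moment_def)
  qed
qed

theorem theorem4p18:
  assumes "CARD('n::finite) \<ge> 2"
  shows
    "(\<forall>(\<alpha>::nat) (\<beta>::real). 0 \<le> \<beta> \<and> \<beta> < 1 \<and> \<beta> \<noteq> 1 / 2 \<longrightarrow>
       (\<exists>C::real. C > 0 \<and>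
         (\<forall>(d :: nat \<Rightarrow> nat) (Y :: nat \<Rightarrow> nat \<Rightarrow> real ^ 'n \<Rightarrow> complex).
            spherical_harmonics_basis d Y \<longrightarrow>
            (\<forall>(k::nat). \<forall>g \<in> L2 (Grushin_measure \<alpha>).
               (\<integral>\<^sup>+z. ennreal ((cmod (of_real (sin (grushin_angle \<alpha> z) powr (-\<beta>)) *
                   grushin_proj \<alpha> d Y k
                     (\<lambda>\<zeta>. of_real (sin (grushin_angle \<alpha> \<zeta>) powr (-\<beta>)) * g \<zeta>) z))\<^sup>2)
                 \<partial>Grushin_measure \<alpha>)
               \<le> ennreal (if \<beta> < 1 / 2 then C else C * (real k + 1) powr (2 * (2 * \<beta> - 1))) *
                 (\<integral>\<^sup>+z. ennreal ((cmod (g z))\<^sup>2) \<partial>Grushin_measure \<alpha>))))) \<and>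
     (\<forall>(\<alpha>::nat) (\<beta>::real). \<alpha> \<ge> 1 \<and> \<alpha> \<noteq> 1 \<and> (real \<alpha> + 1) / (4 * real \<alpha>) \<le> \<beta> \<and> \<beta> < 1 / 2 \<longrightarrow>
       (\<exists>C::real. C > 0 \<and>
         (\<forall>(d :: nat \<Rightarrow> nat) (Y :: nat \<Rightarrow> nat \<Rightarrow> real ^ 'n \<Rightarrow> complex).
            spherical_harmonics_basis d Y \<longrightarrow>
            (\<forall>(k::nat). \<forall>g \<in> L2 (Grushin_measure \<alpha>).
               (\<integral>\<^sup>+z. ennreal ((cmod (of_real (grushin_psi \<alpha> (grushin_angle \<alpha> z) powr (-\<beta>)) *
                   grushin_proj \<alpha> d Y k
                     (\<lambda>\<zeta>. of_real (grushin_psi \<alpha> (grushin_angle \<alpha> \<zeta>) powr (-\<beta>)) * g \<zeta>) z))\<^sup>2)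
                 \<partial>Grushin_measure \<alpha>)
               \<le> ennreal (C * (real k + 1) powr (2 * (real \<alpha> - 1) / (real \<alpha> + 1))) *
                 (\<integral>\<^sup>+z. ennreal ((cmod (g z))\<^sup>2) \<partial>Grushin_measure \<alpha>)))))"
proof (intro conjI allI impI, goal_cases)
  case (1 \<alpha> \<beta>)
  then obtain C where C: "C > 0" "\<And>k l. l \<le> k \<Longrightarrow>
      radial_moment \<alpha> TYPE('n) k l (- 2 * \<beta>)
      \<le> (if \<beta> < 1 / 2 then C else C * (real k + 1) powr (2 * \<beta> - 1))
        * radial_moment \<alpha> TYPE('n) k l 0"
    using harmonic_moment_bound[OF assms, of \<beta> \<alpha>] by blast
  show ?case
  proof (intro exI[of _ "C\<^sup>2"] conjI allI impI ballI, goal_cases)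
    case 1
    show ?case using C by simp
  next
    case (2 d Y k g)
    define B where "B = (if \<beta> < 1 / 2 then C else C * (real k + 1) powr (2 * \<beta> - 1))"
    have "B > 0" using C by (simp add: B_def)
    have "B\<^sup>2 = (if \<beta> < 1 / 2 then C\<^sup>2 else C\<^sup>2 * (real k + 1) powr (2 * (2 * \<beta> - 1)))"
      by (simp add: B_def power_mult_distrib powr_power)
    then show ?case
      using weighted_projection_bound[OF assms \<open>spherical_harmonics_basis d Y\<close> _ \<open>B > 0\<close> _ \<open>g \<in> L2 (Grushin_measure \<alpha>)\<close>, of \<beta> k]
        C(2)[of _ k] \<open>0 \<le> \<beta> \<and> \<beta> < 1 \<and> \<beta> \<noteq> 1 / 2\<close>
      unfolding B_def[symmetric] by simp
  qed
next
  case (2 \<alpha> \<beta>)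
  define \<beta>1 where "\<beta>1 = 2 * real \<alpha> / (real \<alpha> + 1) * \<beta>"
  \<comment> \<open>The value of \<beta>1 at the end point \<beta> = 1/2. It lies strictly between
    1/2 and 1 as \<alpha> >= 2, so the moment bound applies to it even when \<beta>1 is 1/2.\<close>
  define \<beta>2 where "\<beta>2 = real \<alpha> / (real \<alpha> + 1)"
  have \<alpha>: "real \<alpha> \<ge> 2" using 2 by auto
  have \<beta>2: "\<beta>2 > 1 / 2" "\<beta>2 < 1" using \<alpha> by (auto simp: \<beta>2_def less_divide_eq)
  have "\<beta>1 = \<beta>2 * (2 * \<beta>)" by (simp add: \<beta>1_def \<beta>2_def)
  also have "\<dots> \<le> \<beta>2 * 1" using 2 \<beta>2 by (intro mult_left_mono) auto
  finally have le: "\<beta>1 \<le> \<beta>2" by simp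
  have psi: "grushin_psi \<alpha> \<phi> powr (-\<beta>) = sin \<phi> powr (-\<beta>1)" for \<phi>
    by (simp add: grushin_psi_def powr_powr \<beta>1_def)
  obtain C where C: "C > 0" "\<And>k l. l \<le> k \<Longrightarrow>
      radial_moment \<alpha> TYPE('n) k l (- 2 * \<beta>2)
      \<le> C * (real k + 1) powr (2 * \<beta>2 - 1)
        * radial_moment \<alpha> TYPE('n) k l 0"
    using harmonic_moment_bound[OF assms, of \<beta>2 \<alpha>] \<beta>2 by auto
  show ?case
  proof (intro exI[of _ "C\<^sup>2"] conjI allI impI ballI, goal_cases)
    case 1
    show ?case using C by simp
  next
    case (2 d Y k g)
    define B where "B = C * (real k + 1) powr (2 * \<beta>2 - 1)"
    have "B > 0" using C by (simp add: B_def)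
    have "2 * (2 * \<beta>2 - 1) = 2 * (real \<alpha> - 1) / (real \<alpha> + 1)"
      by (simp add: \<beta>2_def field_simps)
    then have B2: "B\<^sup>2 = C\<^sup>2 * (real k + 1) powr (2 * (real \<alpha> - 1) / (real \<alpha> + 1))"
      by (simp add: B_def power_mult_distrib powr_power)
    have "radial_moment \<alpha> TYPE('n) k l (- 2 * \<beta>1)
      \<le> B * radial_moment \<alpha> TYPE('n) k l 0" if "l \<le> k" for l
      using gegenbauer_moment_mono[OF le \<beta>2(2) harmonic_order_ge[OF assms]] C(2)[OF that]
      unfolding B_def radial_moment_def by (rule order.trans)
    moreover have "\<beta>1 < 1" using le \<beta>2 by simp
    ultimately show ?case
      unfolding psi B2[symmetric]
      by (intro weighted_projection_bound assms \<open>spherical_harmonics_basis d Y\<close> \<open>B > 0\<close> \<open>g \<in> L2 (Grushin_measure \<alpha>)\<close>)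
  qed
qed

end
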